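(* Let $n\ge 1$, $N=2n+1$, $m=2n$. Let $f:\mathbb{R}^N\times\mathbb{R}^m\to\mathbb{R}$ satisfy: (1) $f(x,q)$ is measurable in $x$ and convex in $q$; (2) there exist $C_1,C_2>0$ and $\alpha>1$ such that $C_1|q|^\alpha\le f(x,q)\le C_2(|q|^\alpha+1)$ for all $q\in\mathbb{R}^m$, $x\in\mathbb{R}^N$; (3) $f((2k)*x,q)=f(x,q)$ for all $x\in\mathbb{R}^N$, $q\in\mathbb{R}^m$, $k\in\mathbb{Z}^N$. Let $A\subset\mathbb{R}^N$ be a bounded domain with Lipschitz boundary and let $u_0(x)=q\cdot\pi_m(x)+a$ for some $q\in\mathbb{R}^m$ and $a\in\mathbb{R}$. For $\varepsilon>0$ let $$F_\varepsilon(u,A)=\int_A f\big(\delta_{1/\varepsilon}(x),\nabla_{\mathcal X}u(x)\big)\,dx\ \text{ if } u\in W^{1,\alpha}_{\mathcal X}(A),\qquad F_\varepsilon(u,A)=+\infty\ \text{ otherwise.}$$ Then $$\lim_{\varepsilon\to0^+}m(F_\varepsilon,u_0,A)=m(F_\infty,u_0,A),$$ where $$F_\infty(u,A)=\int_A f_0\big(\nabla_{\mathcal X}u(x)\big)\,dx\ \text{ if } u\in W^{1,\alpha}_{\mathcal X}(A),\qquad F_\infty(u,A)=+\infty\ \text{ otherwise,}$$ and $f_0:\mathbb{R}^m\to\mathbb{R}$ is defined by $f_0(p)=C_p$, with $C_p=\lim_{k\to+\infty,\,k\in\mathbb{N}}\mu_p(Q^k)/|Q^k|=\inf_{k\in\mathbb{N},\,k\ge1}\mu_p(Q^k)/|Q^k|$.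 Moreover $f_0$ is measurable, convex and satisfies the same growth condition as $f$, i.e. $C_1|p|^\alpha\le f_0(p)\le C_2(|p|^\alpha+1)$ for all $p\in\mathbb{R}^m$.
   Context: The Heisenberg group $\mathbb{H}^n$ is $\mathbb{R}^N\equiv\mathbb{R}^n\times\mathbb{R}^n\times\mathbb{R}$ with group law $x*y=\big(\underline x_1+\underline y_1,\underline x_2+\underline y_2,x_3+y_3+\tfrac12(\underline x_1\cdot\underline y_2-\underline x_2\cdot\underline y_1)\big)$ and dilations $\delta_t(x)=(t\underline x_1,t\underline x_2,t^2x_3)$, $t>0$. Here $2k$ is the usual Euclidean multiple of $k$. The left-invariant vector fields are, for $i=1,\dots,n$, $X_i=\partial_{x_i}-\tfrac{x_{n+i}}2\partial_{x_{2n+1}}$ and $X_{n+i}=\partial_{x_{n+i}}+\tfrac{x_i}2\partial_{x_{2n+1}}$, and the horizontal gradient is $\nabla_{\mathcal X}u=(X_1u,\dots,X_{2n}u)^T\in\mathbb{R}^m$ (in the distributional sense). $W^{1,\alpha}_{\mathcal X}(A)=\{u\in L^\alpha(A): X_iu\in L^\alpha(A),\ i=1,\dots,m\}$ with norm $\big(\int_A|u|^\alpha+\sum_i\int_A|X_iu|^\alpha\big)^{1/\alpha}$, and $W^{1,\alpha}_{\mathcal X,0}(A)$ is the closure of $C_0^\infty(A)$ in this norm. $\pi_m:\mathbb{R}^N\to\mathbb{R}^m$ is the projection on the first $m$ components and $l_q(x)=q\cdot\pi_m(x)$. For a functional $G$, $m(G,u_0,A)=\min\{G(u,A): u-u_0\in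 W^{1,\alpha}_{\mathcal X,0}(A)\}$. For $p\in\mathbb{R}^m$ and a bounded domain $B$, $\mu_p(B)=\min\big\{\int_B f(x,\nabla_{\mathcal X}u(x))\,dx: u-l_p\in W^{1,\alpha}_{\mathcal X,0}(B)\big\}$. $Q=[-1,1)^N$ and $Q^k=\delta_k(Q)$; in $\mu_p(Q^k)$ the Sobolev space is the one on the interior of $Q^k$. $|\cdot|$ of a set denotes $N$-dimensional Lebesgue measure. *)

theory Defs
  imports "HOL-Analysis.Analysis"
begin

text \<open>The dimension $n$ is \<open>CARD('n)\<close>. Points of $R^N$ are triples, and the index type
  \<open>'n + 'n\<close> of $R^m$ has \<open>Inl i\<close> for the index $i$ and \<open>Inr i\<close> for the index $n + i$.\<close>

type_synonym 'n heis = "(real ^ 'n) \<times> (real ^ 'n) \<times> real"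
type_synonym 'n hor = "real ^ ('n + 'n)"

definition heis_mult :: "'n::finite heis \<Rightarrow> 'n heis \<Rightarrow> 'n heis" where
  "heis_mult = (\<lambda>(x1, x2, x3) (y1, y2, y3).
     (x1 + y1, x2 + y2, x3 + y3 + (x1 \<bullet> y2 - x2 \<bullet> y1) / 2))"

definition dil :: "real \<Rightarrow> 'n::finite heis \<Rightarrow> 'n heis" where
  "dil t = (\<lambda>(x1, x2, x3). (t *\<^sub>R x1, t *\<^sub>R x2, t\<^sup>2 * x3))"

definition integer_points :: "'n::finite heis set" where
  "integer_points = {k. \<forall>b\<in>Basis. k \<bullet> b \<in> \<int>}"

definition hproj :: "'n::finite heis \<Rightarrow> 'n hor" where
  "hproj = (\<lambda>(x1, x2, x3). \<chi> i. case i of Inl j \<Rightarrow> x1 $ j | Inr j \<Rightarrow> x2 $ j)"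

fun Xfield :: "'n::finite + 'n \<Rightarrow> 'n heis \<Rightarrow> 'n heis" where
  "Xfield (Inl i) (x1, x2, x3) = (axis i 1, 0, - (x2 $ i) / 2)"
| "Xfield (Inr i) (x1, x2, x3) = (0, axis i 1, x1 $ i / 2)"

fun C_k :: "nat \<Rightarrow> ('a::euclidean_space \<Rightarrow> real) \<Rightarrow> bool" where
  "C_k 0 \<phi> \<longleftrightarrow> continuous_on UNIV \<phi>"
| "C_k (Suc k) \<phi> \<longleftrightarrow> \<phi> differentiable_on UNIV \<and>
     (\<forall>b\<in>Basis. C_k k (\<lambda>x. frechet_derivative \<phi> (at x) b))"

definition test_functions :: "'a::euclidean_space set \<Rightarrow> ('a \<Rightarrow> real) set" where
  "test_functions A = {\<phi>. (\<forall>k. C_k k \<phi>) \<and>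
     compact (closure {x. \<phi> x \<noteq> 0}) \<and> closure {x. \<phi> x \<noteq> 0} \<subseteq> A}"

definition locally_integrable :: "'a::euclidean_space set \<Rightarrow> ('a \<Rightarrow> real) \<Rightarrow> bool" where
  "locally_integrable A u \<longleftrightarrow> (\<forall>K. compact K \<and> K \<subseteq> A \<longrightarrow> set_integrable lebesgue K u)"

text \<open>The fields \<^term>\<open>Xfield i\<close> are divergence free, so the formal adjoint of $X_i$ is $-X_i$.\<close>

definition weak_X :: "'n::finite heis set \<Rightarrow> 'n + 'n \<Rightarrow> ('n heis \<Rightarrow> real) \<Rightarrow> ('n heis \<Rightarrow> real) \<Rightarrow> bool"
  where "weak_X A i u v \<longleftrightarrow> locally_integrable A u \<and> locally_integrable A v \<and>
     (\<forall>\<phi>\<in>test_functions A.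
        (LINT x|lebesgue_on A. u x * frechet_derivative \<phi> (at x) (Xfield i x)) =
        - (LINT x|lebesgue_on A. v x * \<phi> x))"

text \<open>A representative of the distributional horizontal gradient; it is unique up to null sets
  whenever it exists.\<close>

definition hgrad :: "'n::finite heis set \<Rightarrow> ('n heis \<Rightarrow> real) \<Rightarrow> 'n heis \<Rightarrow> 'n hor" where
  "hgrad A u x = (\<chi> i. (SOME v. weak_X A i u v) x)"

definition Lp :: "real \<Rightarrow> 'a::euclidean_space set \<Rightarrow> ('a \<Rightarrow> real) set" where
  "Lp \<alpha> A = {u. u \<in> borel_measurable (lebesgue_on A) \<and>
     integrable (lebesgue_on A) (\<lambda>x. \<bar>u x\<bar> powr \<alpha>)}"

definition W1 :: "real \<Rightarrow> 'n::finite heis set \<Rightarrow> ('n heis \<Rightarrow> real) set" where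
  "W1 \<alpha> A = {u \<in> Lp \<alpha> A. \<forall>i. \<exists>v\<in>Lp \<alpha> A. weak_X A i u v}"

definition W1_norm :: "real \<Rightarrow> 'n::finite heis set \<Rightarrow> ('n heis \<Rightarrow> real) \<Rightarrow> real" where
  "W1_norm \<alpha> A u = ((LINT x|lebesgue_on A. \<bar>u x\<bar> powr \<alpha>) +
     (\<Sum>i\<in>UNIV. LINT x|lebesgue_on A. \<bar>hgrad A u x $ i\<bar> powr \<alpha>)) powr (1 / \<alpha>)"

definition W1_0 :: "real \<Rightarrow> 'n::finite heis set \<Rightarrow> ('n heis \<Rightarrow> real) set" where
  "W1_0 \<alpha> A = {u \<in> W1 \<alpha> A.
     \<forall>e>0. \<exists>\<phi>\<in>test_functions A. W1_norm \<alpha> A (\<lambda>x. u x - \<phi> x) < e}"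

definition admissible ::
  "real \<Rightarrow> ('n::finite heis \<Rightarrow> real) \<Rightarrow> 'n heis set \<Rightarrow> ('n heis \<Rightarrow> real) set" where
  "admissible \<alpha> u0 A = {u. (\<lambda>x. u x - u0 x) \<in> W1_0 \<alpha> A}"

definition int_functional :: "real \<Rightarrow> ('n::finite heis \<Rightarrow> 'n hor \<Rightarrow> real) \<Rightarrow>
    ('n heis \<Rightarrow> real) \<Rightarrow> 'n heis set \<Rightarrow> ereal" where
  "int_functional \<alpha> g u A =
     (if u \<in> W1 \<alpha> A then ereal (LINT x|lebesgue_on A. g x (hgrad A u x)) else \<infinity>)"

definition F_eps :: "real \<Rightarrow> ('n::finite heis \<Rightarrow> 'n hor \<Rightarrow> real) \<Rightarrow> real \<Rightarrow>
    ('n heis \<Rightarrow> real) \<Rightarrow> 'n heis set \<Rightarrow> ereal" where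
  "F_eps \<alpha> f \<epsilon> = int_functional \<alpha> (\<lambda>x q. f (dil (1 / \<epsilon>) x) q)"

definition min_value :: "real \<Rightarrow> (('n::finite heis \<Rightarrow> real) \<Rightarrow> 'n heis set \<Rightarrow> ereal) \<Rightarrow>
    ('n heis \<Rightarrow> real) \<Rightarrow> 'n heis set \<Rightarrow> ereal" where
  "min_value \<alpha> G u0 A = (LEAST v. v \<in> (\<lambda>u. G u A) ` admissible \<alpha> u0 A)"

definition lin :: "'n::finite hor \<Rightarrow> 'n heis \<Rightarrow> real" where
  "lin q x = q \<bullet> hproj x"

text \<open>For a set \<open>B\<close> that is not open, such as the half-open boxes below, the Sobolev space and the
  gradient are those on \<^term>\<open>interior B\<close>.\<close>

definition cell_energy :: "('n::finite heis \<Rightarrow> 'n hor \<Rightarrow> real) \<Rightarrow> 'n heis set \<Rightarrow>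
    ('n heis \<Rightarrow> real) \<Rightarrow> real" where
  "cell_energy f B u = (LINT x|lebesgue_on B. f x (hgrad (interior B) u x))"

definition mu :: "real \<Rightarrow> ('n::finite heis \<Rightarrow> 'n hor \<Rightarrow> real) \<Rightarrow> 'n hor \<Rightarrow> 'n heis set \<Rightarrow> real" where
  "mu \<alpha> f p B = (LEAST v. v \<in> cell_energy f B ` admissible \<alpha> (lin p) (interior B))"

definition Q_unit :: "'n::finite heis set" where
  "Q_unit = {x. \<forall>b\<in>Basis. -1 \<le> x \<bullet> b \<and> x \<bullet> b < 1}"

definition Q_cube :: "nat \<Rightarrow> 'n::finite heis set" where
  "Q_cube k = dil (real k) ` Q_unit"

definition cell_mean :: "real \<Rightarrow> ('n::finite heis \<Rightarrow> 'n hor \<Rightarrow> real) \<Rightarrow> 'n hor \<Rightarrow> nat \<Rightarrow> real" where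
  "cell_mean \<alpha> f p k = mu \<alpha> f p (Q_cube k) / measure lebesgue (Q_cube k :: 'n heis set)"

definition f_hom :: "real \<Rightarrow> ('n::finite heis \<Rightarrow> 'n hor \<Rightarrow> real) \<Rightarrow> 'n hor \<Rightarrow> real" where
  "f_hom \<alpha> f p = lim (cell_mean \<alpha> f p)"

definition F_inf :: "real \<Rightarrow> ('n::finite heis \<Rightarrow> 'n hor \<Rightarrow> real) \<Rightarrow>
    ('n heis \<Rightarrow> real) \<Rightarrow> 'n heis set \<Rightarrow> ereal" where
  "F_inf \<alpha> f = int_functional \<alpha> (\<lambda>x q. f_hom \<alpha> f q)"

text \<open>Near each boundary point the set is the strict epigraph of a Lipschitz function over the
  hyperplane orthogonal to some unit vector \<open>\<nu>\<close>.\<close>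

definition lipschitz_boundary :: "'a::euclidean_space set \<Rightarrow> bool" where
  "lipschitz_boundary A \<longleftrightarrow> (\<forall>z\<in>frontier A. \<exists>r>0. \<exists>\<nu> L. \<exists>\<gamma>::'a \<Rightarrow> real.
     norm \<nu> = 1 \<and> L-lipschitz_on {y. y \<bullet> \<nu> = 0} \<gamma> \<and>
     A \<inter> ball z r = {x \<in> ball z r. \<gamma> (x - (x \<bullet> \<nu>) *\<^sub>R \<nu>) < x \<bullet> \<nu>})"

end

theory Submission
  imports Defs
begin

text \<open>Minima over Sobolev functions with boundary data \<open>p \<bullet> hproj x + c\<close> are infima over smooth
  perturbations with compact support: such perturbations are dense, and a convex integrand with
  \<open>\<alpha>\<close>-growth has a continuous energy. Minimizers exist because, by uniform convexity of
  \<open>\<bar>t\<bar> powr \<alpha>\<close>, perturbations of almost minimal norm in the sublevel sets of the energy form a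
  Cauchy sequence.

  For the homogenization, let the gain of an open set \<open>B\<close> be
  \<open>C2 * (norm p powr \<alpha> + 1) * measure lebesgue B\<close> minus the infimal energy on \<open>B\<close>. It is
  superadditive over disjoint open sets and invariant under translations by \<open>2 *\<^sub>R k\<close>. Filling a set
  with small dilated copies of a periodicity cell shows that the gain per volume of large dilates is
  asymptotically at least its supremum over the cells \<open>Q_cube k\<close>. For a set with null boundary the reverse
  inequality follows by filling its complement in a large box. For affine boundary data and the
  homogenized integrand the minimum is attained by the data, by Jensen's inequality.\<close>

subsection \<open>Smooth functions and test functions\<close>

text \<open>Three invariances carry the argument. Left translations and dilations have constant
  Jacobians, 1 and \<open>t ^ (2 * CARD('n) + 2)\<close>. Both preserve horizontal gradients up to a
  constant factor. And affine data have the constant horizontal gradient \<open>p\<close>, so that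
  they enter the energy of a smooth perturbation only through \<open>p + Xg \<phi> x\<close>. Hence
  the problem with oscillating coefficients on \<open>A\<close> is, up to the factor
  \<open>\<epsilon> ^ (2 * CARD('n) + 2)\<close>, the problem with fixed coefficients on the image
  of \<open>A\<close> under \<open>dil (1 / \<epsilon>)\<close>, and the limit becomes a question
  about set functions. Dilations by integers map the lattice into itself, which makes cells of all
  integer sizes compatible with the same periodicity. The minima are written with
  \<open>LEAST\<close>, which is informative only if they are attained. Existence is therefore
  proved once for all integrands with convexity and growth, and then used for the cell problems, the
  oscillating problems and the homogenized one.\<close>

lemma C_k_differentiable: "C_k (Suc k) \<phi> \<Longrightarrow> \<phi> differentiable (at x)"
  by (simp add: differentiable_on_def)

lemma C_k_Suc_imp: "C_k (Suc k) \<phi> \<Longrightarrow> C_k k \<phi>"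
proof (induction k arbitrary: \<phi>)
  case 0
  then show ?case by (simp add: differentiable_imp_continuous_on)
next
  case (Suc k)
  then show ?case by (metis C_k.simps(2))
qed

lemma frechet_derivativeI: "(\<phi> has_derivative D) (at x) \<Longrightarrow> frechet_derivative \<phi> (at x) = D"
  by (metis frechet_derivative_at)

lemma C_k_Suc_intro:
  assumes "\<And>x. (\<phi> has_derivative D x) (at x)" "\<And>b. b \<in> Basis \<Longrightarrow> C_k k (\<lambda>x. D x b)"
  shows "C_k (Suc k) \<phi>"
proof -
  have "\<And>x. frechet_derivative \<phi> (at x) = D x" using assms(1) frechet_derivativeI by blast
  moreover have "\<phi> differentiable_on UNIV"
    using assms(1) by (auto simp: differentiable_on_def differentiable_def)
  ultimately show ?thesis using assms(2) by simp
qed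

lemma C_k_const: "C_k k (\<lambda>x::'a::euclidean_space. c)"
proof (induction k arbitrary: c)
  case (Suc k)
  show ?case by (rule C_k_Suc_intro[where D = "\<lambda>_ _. 0"]) (auto intro: Suc)
qed simp

lemma C_k_add:
  assumes "C_k k \<phi>" "C_k k \<psi>"
  shows "C_k k (\<lambda>x. \<phi> x + \<psi> x)"
  using assms
proof (induction k arbitrary: \<phi> \<psi>)
  case 0
  then show ?case by (auto intro: continuous_intros)
next
  case (Suc k)
  show ?case
  proof (rule C_k_Suc_intro)
    show "((\<lambda>x. \<phi> x + \<psi> x) has_derivative
        (\<lambda>h. frechet_derivative \<phi> (at x) h + frechet_derivative \<psi> (at x) h)) (at x)" for x
      using Suc.prems by (intro has_derivative_add frechet_derivative_works[THEN iffD1]) (auto intro: C_k_differentiable)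
  qed (use Suc in auto)
qed

lemma C_k_mult:
  assumes "C_k k \<phi>" "C_k k \<psi>"
  shows "C_k k (\<lambda>x. \<phi> x * \<psi> x)"
  using assms
proof (induction k arbitrary: \<phi> \<psi>)
  case 0
  then show ?case by (auto intro: continuous_intros)
next
  case (Suc k)
  show ?case
  proof (rule C_k_Suc_intro)
    show "((\<lambda>x. \<phi> x * \<psi> x) has_derivative
        (\<lambda>h. \<phi> x * frechet_derivative \<psi> (at x) h + frechet_derivative \<phi> (at x) h * \<psi> x)) (at x)" for x
      using Suc.prems by (intro has_derivative_mult frechet_derivative_works[THEN iffD1]) (auto intro: C_k_differentiable)
    show "C_k k (\<lambda>x. \<phi> x * frechet_derivative \<psi> (at x) b + frechet_derivative \<phi> (at x) b * \<psi> x)"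
      if "b \<in> Basis" for b
      using Suc.prems C_k_Suc_imp that by (intro C_k_add Suc.IH) auto
  qed
qed

lemma C_k_cmult: "C_k k \<phi> \<Longrightarrow> C_k k (\<lambda>x. c * \<phi> x)"
  by (intro C_k_mult C_k_const)

lemma C_k_sum: "finite I \<Longrightarrow> (\<And>i. i \<in> I \<Longrightarrow> C_k k (\<phi> i)) \<Longrightarrow> C_k k (\<lambda>x. \<Sum>i\<in>I. \<phi> i x)"
  by (induction I rule: finite_induct) (auto intro: C_k_const C_k_add)

lemma C_k_prod: "finite I \<Longrightarrow> (\<And>i. i \<in> I \<Longrightarrow> C_k k (\<phi> i)) \<Longrightarrow> C_k k (\<lambda>x. \<Prod>i\<in>I. \<phi> i x)"
  by (induction I rule: finite_induct) (auto intro: C_k_const C_k_mult)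

text \<open>The derivative along a basis vector is a fixed linear combination of partial derivatives
  of \<open>\<phi>\<close> at the affine image, and the induction hypothesis applies to each of
  these.\<close>

lemma C_k_affine_compose:
  fixes \<phi> :: "'a::euclidean_space \<Rightarrow> real" and L :: "'b::euclidean_space \<Rightarrow> 'a"
  assumes "C_k k \<phi>" "linear L"
  shows "C_k k (\<lambda>x. \<phi> (L x + c))"
  using assms(1)
proof (induction k arbitrary: \<phi>)
  case 0
  have "continuous_on UNIV (\<lambda>x. L x + c)"
    using assms(2) by (intro continuous_intros linear_continuous_on) (simp add: linear_conv_bounded_linear)
  moreover have "continuous_on UNIV \<phi>" using 0 by simp
  ultimately show ?case
    using continuous_on_compose2[of UNIV \<phi> UNIV "\<lambda>x. L x + c"] by auto
next
  case (Suc k)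
  let ?D = "\<lambda>x. frechet_derivative \<phi> (at (L x + c))"
  have bl: "bounded_linear L" using assms(2) by (simp add: linear_conv_bounded_linear)
  have d: "(\<phi> has_derivative frechet_derivative \<phi> (at y)) (at y)" for y
    using Suc.prems C_k_differentiable frechet_derivative_works[THEN iffD1] by blast
  show ?case
  proof (rule C_k_Suc_intro)
    show "((\<lambda>x. \<phi> (L x + c)) has_derivative (\<lambda>h. ?D x (L h))) (at x)" for x
      by (rule has_derivative_compose[OF _ d])
        (auto intro!: derivative_eq_intros bounded_linear.has_derivative[OF bl])
    fix b :: 'b assume "b \<in> Basis"
    have "?D x (L b) = (\<Sum>c'\<in>Basis. (L b \<bullet> c') * ?D x c')" for x
    proof -
      have lin: "linear (?D x)" using d has_derivative_linear by blast
      have "?D x (L b) = ?D x (\<Sum>c'\<in>Basis. (L b \<bullet> c') *\<^sub>R c')" by (simp add: euclidean_representation)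
      also have "\<dots> = (\<Sum>c'\<in>Basis. (L b \<bullet> c') * ?D x c')"
        using lin by (simp add: linear_sum linear_cmul)
      finally show ?thesis .
    qed
    moreover have "C_k k (\<lambda>x. \<Sum>c'\<in>Basis. (L b \<bullet> c') * ?D x c')"
      using Suc.prems by (intro C_k_sum C_k_cmult Suc.IH) auto
    ultimately show "C_k k (\<lambda>x. ?D x (L b))" by simp
  qed
qed

text \<open>The family \<open>P(1/t) exp(-1/t)\<close>, extended by \<open>0\<close>, is closed under differentiation.\<close>

definition expoly :: "real poly \<Rightarrow> real \<Rightarrow> real" where
  "expoly P t = (if t > 0 then poly P (1 / t) * exp (- (1 / t)) else 0)"

lemma poly_times_exp_tendsto_0: "((\<lambda>s. poly P s * exp (- s)) \<longlongrightarrow> (0::real)) at_top"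
proof -
  have "((\<lambda>s. \<Sum>i\<le>degree P. coeff P i * (s ^ i / exp s)) \<longlongrightarrow> (\<Sum>i\<le>degree P. coeff P i * 0)) at_top"
    by (intro tendsto_intros tendsto_power_div_exp_0)
  moreover have "(\<Sum>i\<le>degree P. coeff P i * (s ^ i / exp s)) = poly P s * exp (- s)" for s
    by (simp add: poly_altdef sum_distrib_right exp_minus field_simps sum_divide_distrib)
  ultimately show ?thesis by simp
qed

text \<open>With \<open>s = 1 / t\<close> one has d/dt = - s^2 d/ds, and d/ds (P(s) exp(-s)) = (P' -
  P)(s) exp(-s); \<open>[:0, 0, 1:]\<close> is the polynomial s^2. At \<open>t = 0\<close> the right
  difference quotient is s P(s) exp(-s), which tends to 0 as s grows.\<close>

lemma expoly_has_field_derivative: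
  "(expoly P has_field_derivative expoly ([:0, 0, 1:] * (P - pderiv P)) t) (at t)"
proof -
  consider "t > 0" | "t < 0" | "t = 0" by linarith
  then show ?thesis
  proof cases
    case 1
    have "((\<lambda>t. poly P (1 / t) * exp (- (1 / t))) has_field_derivative
        expoly ([:0, 0, 1:] * (P - pderiv P)) t) (at t)"
      using 1 by (auto intro!: derivative_eq_intros simp: expoly_def field_simps power2_eq_square)
    moreover have "\<forall>\<^sub>F s in nhds t. expoly P s = poly P (1 / s) * exp (- (1 / s))"
      using eventually_nhds_in_open[of "{0<..}" t] 1
      by (auto simp: expoly_def elim!: eventually_mono)
    ultimately show ?thesis by (subst DERIV_cong_ev[OF refl _ refl]) auto
  next
    case 2
    have "\<forall>\<^sub>F s in nhds t. expoly P s = 0"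
      using eventually_nhds_in_open[of "{..<0}" t] 2
      by (auto simp: expoly_def elim!: eventually_mono)
    then show ?thesis
      using 2 by (subst DERIV_cong_ev[OF refl _ refl]) (auto simp: expoly_def)
  next
    case 3
    have "((\<lambda>h. expoly P h / h) \<longlongrightarrow> 0) (at_right 0)"
    proof -
      have "((\<lambda>h. poly ([:0,1:] * P) (inverse h) * exp (- inverse h)) \<longlongrightarrow> 0) (at_right 0)"
        by (rule filterlim_compose[OF poly_times_exp_tendsto_0 filterlim_inverse_at_top_right])
      moreover have "\<forall>\<^sub>F h in at_right 0. poly ([:0,1:] * P) (inverse h) * exp (- inverse h) = expoly P h / h"
        by (auto simp: eventually_at_right_field expoly_def field_simps intro!: exI[of _ 1])
      ultimately show ?thesis by (rule Lim_transform_eventually)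
    qed
    moreover have "((\<lambda>h. expoly P h / h) \<longlongrightarrow> 0) (at_left 0)"
      by (rule tendsto_eventually) (auto simp: eventually_at_left_field expoly_def intro!: exI[of _ "-1"])
    ultimately have "((\<lambda>h. expoly P h / h) \<longlongrightarrow> 0) (at 0)" by (simp add: filterlim_split_at)
    then show ?thesis using 3 by (simp add: DERIV_def expoly_def)
  qed
qed

lemma C_k_expoly: "C_k k (\<lambda>x::'a::euclidean_space. expoly P (v \<bullet> x + d))"
proof (induction k arbitrary: P)
  case 0
  have c: "continuous_on UNIV (expoly P)"
    using expoly_has_field_derivative DERIV_continuous_on by blast
  show ?case
    using continuous_on_compose2[OF c, of UNIV "\<lambda>x. v \<bullet> x + d"] by (simp add: continuous_intros)
next
  case (Suc k)
  let ?P = "[:0, 0, 1:] * (P - pderiv P)"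
  show ?case
  proof (rule C_k_Suc_intro)
    show "((\<lambda>x. expoly P (v \<bullet> x + d)) has_derivative (\<lambda>h. (v \<bullet> h) * expoly ?P (v \<bullet> x + d))) (at x)" for x :: 'a
      by (rule has_derivative_eq_rhs[OF has_derivative_compose[OF _
            expoly_has_field_derivative[unfolded has_field_derivative_def]]])
         (auto intro!: derivative_eq_intros)
  qed (use Suc C_k_cmult in blast)
qed

text \<open>Inside the box every factor is exp(-1/(n d)), with d the distance to a face. So
  \<open>n\<close> measures sharpness: the bumps stay between 0 and 1 and converge pointwise to the
  indicator of the open box.\<close>

definition box_bump :: "'a::euclidean_space \<Rightarrow> 'a \<Rightarrow> nat \<Rightarrow> 'a \<Rightarrow> real" where
  "box_bump a c n x = (\<Prod>b\<in>Basis. expoly 1 (real n * (x \<bullet> b - a \<bullet> b)) * expoly 1 (real n * (c \<bullet> b - x \<bullet> b)))"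

lemma test_functionsI:
  assumes "\<And>k. C_k k \<phi>" "\<And>x. \<phi> x \<noteq> 0 \<Longrightarrow> x \<in> K" "compact K" "K \<subseteq> A"
  shows "\<phi> \<in> test_functions A"
proof -
  have sub: "{x. \<phi> x \<noteq> 0} \<subseteq> K" using assms(2) by blast
  then have "closure {x. \<phi> x \<noteq> 0} \<subseteq> K"
    using assms(3) by (intro closure_minimal compact_imp_closed)
  moreover have "bounded {x. \<phi> x \<noteq> 0}"
    using sub assms(3) bounded_subset compact_imp_bounded by blast
  ultimately show ?thesis unfolding test_functions_def compact_closure using assms(1,4) by blast
qed

lemma test_functionsE:
  assumes "\<phi> \<in> test_functions A"
  obtains K where "\<And>k. C_k k \<phi>" "compact K" "K \<subseteq> A" "\<And>x. x \<notin> K \<Longrightarrow> \<phi> x = 0"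
proof
  show "compact (closure {x. \<phi> x \<noteq> 0})" "closure {x. \<phi> x \<noteq> 0} \<subseteq> A" "\<And>k. C_k k \<phi>"
    using assms by (auto simp: test_functions_def)
  show "\<phi> x = 0" if "x \<notin> closure {x. \<phi> x \<noteq> 0}" for x
    using that closure_subset[of "{x. \<phi> x \<noteq> 0}"] by blast
qed

lemma box_bump_zero:
  assumes "x \<notin> box a c" shows "box_bump a c n x = 0"
proof -
  obtain b where "b \<in> Basis" "x \<bullet> b \<le> a \<bullet> b \<or> c \<bullet> b \<le> x \<bullet> b"
    using assms by (auto simp: mem_box not_less)
  then have "expoly 1 (real n * (x \<bullet> b - a \<bullet> b)) * expoly 1 (real n * (c \<bullet> b - x \<bullet> b)) = 0"
    by (auto simp: expoly_def zero_less_mult_iff)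
  then show ?thesis unfolding box_bump_def using \<open>b \<in> Basis\<close> by (intro prod_zero) auto
qed

lemma box_bump_bounds: "0 \<le> box_bump a c n x" "box_bump a c n x \<le> 1"
proof -
  have e: "0 \<le> expoly 1 t" "expoly 1 t \<le> 1" for t by (auto simp: expoly_def)
  show "0 \<le> box_bump a c n x" by (auto simp: box_bump_def intro!: prod_nonneg mult_nonneg_nonneg e)
  show "box_bump a c n x \<le> 1"
    unfolding box_bump_def by (intro prod_le_1 conjI mult_nonneg_nonneg mult_le_one e)
qed

lemma box_bump_tendsto:
  fixes x :: "'a::euclidean_space"
  shows "(\<lambda>n. box_bump a c n x) \<longlonglongrightarrow> indicator (box a c) x"
proof (cases "x \<in> box a c")
  case True
  have e: "(\<lambda>n. expoly 1 (real n * t)) \<longlonglongrightarrow> 1" if "t > 0" for t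
  proof -
    have "(\<lambda>n. exp (- (1 / t * (1 / real n)))) \<longlonglongrightarrow> exp (- (1 / t * 0))"
      by (intro tendsto_intros lim_1_over_n)
    moreover have "\<forall>\<^sub>F n in sequentially. exp (- (1 / t * (1 / real n))) = expoly 1 (real n * t)"
      using that by (intro eventually_mono[OF eventually_gt_at_top[of "0::nat"]])
        (auto simp: expoly_def field_simps)
    ultimately show ?thesis using Lim_transform_eventually by fastforce
  qed
  have "(\<lambda>n. box_bump a c n x) \<longlonglongrightarrow> (\<Prod>b\<in>(Basis :: 'a set). 1 * 1)"
    unfolding box_bump_def by (intro tendsto_prod tendsto_mult e) (use True in \<open>auto simp: mem_box\<close>)
  then show ?thesis using True by simp
qed (simp add: box_bump_zero)

lemma box_bump_test_function:
  assumes "cbox a c \<subseteq> A"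
  shows "box_bump a c n \<in> test_functions A"
proof (rule test_functionsI[of _ "cbox a c"])
  show "C_k k (box_bump a c n)" for k
  proof -
    have "C_k k (\<lambda>x. \<Prod>b\<in>Basis. expoly 1 ((real n *\<^sub>R b) \<bullet> x + - (real n * (a \<bullet> b))) *
        expoly 1 ((- real n *\<^sub>R b) \<bullet> x + real n * (c \<bullet> b)))"
      by (intro C_k_prod C_k_mult C_k_expoly) auto
    moreover have "(\<lambda>x. \<Prod>b\<in>Basis. expoly 1 ((real n *\<^sub>R b) \<bullet> x + - (real n * (a \<bullet> b))) *
        expoly 1 ((- real n *\<^sub>R b) \<bullet> x + real n * (c \<bullet> b))) = box_bump a c n"
      unfolding box_bump_def[abs_def] fun_eq_iff
      by (intro allI prod.cong refl arg_cong2[where f = "(*)"] arg_cong[where f = "expoly 1"])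
        (simp_all add: inner_commute right_diff_distrib)
    ultimately show ?thesis by simp
  qed
  show "\<And>x. box_bump a c n x \<noteq> 0 \<Longrightarrow> x \<in> cbox a c"
    using box_bump_zero box_subset_cbox by blast
qed (use assms in auto)

lemma test_functions_zero: "(\<lambda>x. 0) \<in> test_functions A"
  by (rule test_functionsI[of _ "{}"]) (auto intro: C_k_const)

lemma test_functions_add:
  assumes "\<phi> \<in> test_functions A" "\<psi> \<in> test_functions A"
  shows "(\<lambda>x. \<phi> x + \<psi> x) \<in> test_functions A"
proof -
  obtain K where K: "\<And>k. C_k k \<phi>" "compact K" "K \<subseteq> A" "\<And>x. x \<notin> K \<Longrightarrow> \<phi> x = 0"
    using test_functionsE[OF assms(1)] by blast
  obtain K' where K': "\<And>k. C_k k \<psi>" "compact K'" "K' \<subseteq> A" "\<And>x. x \<notin> K' \<Longrightarrow> \<psi> x = 0"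
    using test_functionsE[OF assms(2)] by blast
  show ?thesis
  proof (rule test_functionsI[of _ "K \<union> K'"])
    show "\<phi> x + \<psi> x \<noteq> 0 \<Longrightarrow> x \<in> K \<union> K'" for x using K(4) K'(4) by fastforce
    show "C_k k (\<lambda>x. \<phi> x + \<psi> x)" for k by (rule C_k_add[OF K(1) K'(1)])
    show "compact (K \<union> K')" "K \<union> K' \<subseteq> A" using K(2,3) K'(2,3) by auto
  qed
qed

lemma test_functions_cmult:
  assumes "\<phi> \<in> test_functions A"
  shows "(\<lambda>x. c * \<phi> x) \<in> test_functions A"
proof -
  obtain K where K: "\<And>k. C_k k \<phi>" "compact K" "K \<subseteq> A" "\<And>x. x \<notin> K \<Longrightarrow> \<phi> x = 0"
    using test_functionsE[OF assms(1)] by blast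
  show ?thesis
  proof (rule test_functionsI[of _ K])
    show "C_k k (\<lambda>x. c * \<phi> x)" for k by (rule C_k_cmult[OF K(1)])
    show "c * \<phi> x \<noteq> 0 \<Longrightarrow> x \<in> K" for x using K(4) by fastforce
  qed (fact K)+
qed

lemma test_functions_mono: "A \<subseteq> B \<Longrightarrow> test_functions A \<subseteq> test_functions B"
  by (auto simp: test_functions_def)

text \<open>The inverse map \<open>S\<close> locates the new support, which is the image under
  \<open>S\<close> of the old one.\<close>

lemma test_functions_compose:
  fixes \<phi> :: "'a::euclidean_space \<Rightarrow> real" and L :: "'a \<Rightarrow> 'a"
  assumes "\<phi> \<in> test_functions A" "linear L" "homeomorphism UNIV UNIV (\<lambda>x. L x + c) S" "S ` A = B"
  shows "(\<lambda>x. \<phi> (L x + c)) \<in> test_functions B"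
proof -
  obtain K where K: "\<And>k. C_k k \<phi>" "compact K" "K \<subseteq> A" "\<And>x. x \<notin> K \<Longrightarrow> \<phi> x = 0"
    using test_functionsE[OF assms(1)] by blast
  have "S (L x + c) = x" for x using assms(3) by (simp add: homeomorphism_def)
  moreover have "continuous_on K S" using assms(3) continuous_on_subset by (auto simp: homeomorphism_def)
  ultimately show ?thesis
  proof (intro test_functionsI[of _ "S ` K"])
    assume S: "\<And>x. S (L x + c) = x" "continuous_on K S"
    show "compact (S ` K)" by (rule compact_continuous_image[OF S(2) K(2)])
    show "x \<in> S ` K" if "\<phi> (L x + c) \<noteq> 0" for x
    proof -
      have "L x + c \<in> K" using that K(4) by blast
      then show ?thesis using S(1)[of x] by (metis imageI)
    qed
    show "C_k k (\<lambda>x. \<phi> (L x + c))" for k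
      by (rule C_k_affine_compose[OF K(1) assms(2)])
    show "S ` K \<subseteq> B" using K(3) assms(4) by blast
  qed
qed

subsection \<open>The fundamental lemma of the calculus of variations\<close>

lemma C1_frechet:
  assumes "C_k (Suc 0) \<phi>"
  shows "(\<phi> has_derivative frechet_derivative \<phi> (at x)) (at x)"
  using assms C_k_differentiable frechet_derivative_works by blast

lemma C1_continuous: "C_k (Suc 0) \<phi> \<Longrightarrow> continuous_on UNIV \<phi>"
  by (metis C_k_Suc_imp C_k.simps(1))

lemma frechet_derivative_basis_sum:
  fixes \<phi> :: "'a::euclidean_space \<Rightarrow> real"
  assumes "\<phi> differentiable (at x)"
  shows "frechet_derivative \<phi> (at x) h = (\<Sum>b\<in>Basis. (h \<bullet> b) * frechet_derivative \<phi> (at x) b)"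
proof -
  have lin: "linear (frechet_derivative \<phi> (at x))" using assms by (rule linear_frechet_derivative)
  have "frechet_derivative \<phi> (at x) h = frechet_derivative \<phi> (at x) (\<Sum>b\<in>Basis. (h \<bullet> b) *\<^sub>R b)"
    by (simp add: euclidean_representation)
  also have "\<dots> = (\<Sum>b\<in>Basis. (h \<bullet> b) * frechet_derivative \<phi> (at x) b)"
    using lin by (simp add: linear_sum linear_cmul)
  finally show ?thesis .
qed

lemma C1_continuous_frechet:
  fixes \<phi> :: "'a::euclidean_space \<Rightarrow> real"
  assumes "C_k (Suc 0) \<phi>" "continuous_on UNIV h"
  shows "continuous_on UNIV (\<lambda>x. frechet_derivative \<phi> (at x) (h x))"
proof -
  have "continuous_on UNIV (\<lambda>x. \<Sum>b\<in>Basis. (h x \<bullet> b) * frechet_derivative \<phi> (at x) b)"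
    using assms(1) by (intro continuous_on_sum continuous_on_mult continuous_on_inner continuous_on_const assms(2)) simp
  then show ?thesis
    by (subst frechet_derivative_basis_sum[OF C_k_differentiable[OF assms(1)]])
qed

lemma frechet_derivative_zero_outside:
  assumes "\<And>x. x \<notin> K \<Longrightarrow> \<phi> x = 0" "closed K" "x \<notin> K"
  shows "frechet_derivative \<phi> (at x) = (\<lambda>h. 0)"
proof (rule frechet_derivativeI)
  show "(\<phi> has_derivative (\<lambda>h. 0)) (at x)"
    by (rule has_derivative_transform_within_open[of "\<lambda>_. 0" _ x UNIV "- K"]) (use assms in auto)
qed

lemma compact_support_bounded:
  fixes h :: "'a::euclidean_space \<Rightarrow> real"
  assumes "continuous_on UNIV h" "compact K" "\<And>x. x \<notin> K \<Longrightarrow> h x = 0"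
  obtains L where "L \<ge> 0" "\<And>x. \<bar>h x\<bar> \<le> L"
proof -
  have "compact (h ` K)" using assms continuous_on_subset compact_continuous_image by blast
  then obtain L where "\<forall>y\<in>h ` K. norm y \<le> L" using compact_imp_bounded bounded_iff by blast
  then have "\<bar>h x\<bar> \<le> max L 0" for x using assms(3)[of x] by (cases "x \<in> K") (auto simp: max_def)
  then show thesis using that[of "max L 0"] by auto
qed

lemma integrable_compact_support:
  fixes h :: "'a::euclidean_space \<Rightarrow> real"
  assumes "continuous_on UNIV h" "compact K" "\<And>x. x \<notin> K \<Longrightarrow> h x = 0"
  shows "integrable lborel h"
proof -
  have "integrable lborel (\<lambda>x. indicator K x *\<^sub>R h x)"
    using assms borel_integrable_compact[of K h] continuous_on_subset
    by (metis (no_types, lifting) subset_UNIV set_integrable_def)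
  moreover have "(\<lambda>x. indicator K x *\<^sub>R h x) = h" using assms(3) by (auto simp: fun_eq_iff indicator_def)
  ultimately show ?thesis by simp
qed

text \<open>Lets the pairing of a locally integrable function with a test function or its
  derivatives be computed over the whole space.\<close>

lemma locally_integrable_mult:
  fixes h v :: "'a::euclidean_space \<Rightarrow> real"
  assumes "locally_integrable A v" "continuous_on UNIV h" "compact K" "K \<subseteq> A" "\<And>x. x \<notin> K \<Longrightarrow> h x = 0" "open A"
  shows "integrable (lebesgue_on A) (\<lambda>x. v x * h x)"
    and "integrable lebesgue (\<lambda>x. v x * h x)"
    and "(LINT x|lebesgue_on A. v x * h x) = (LINT x|lebesgue. v x * h x)"
proof -
  obtain L where L: "L \<ge> 0" "\<And>x. \<bar>h x\<bar> \<le> L" using compact_support_bounded assms by metis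
  have v: "integrable lebesgue (\<lambda>x. indicator K x *\<^sub>R v x)"
    using assms(1,3,4) by (auto simp: locally_integrable_def set_integrable_def)
  have h: "h \<in> borel_measurable lebesgue"
    using assms(2) by (simp add: borel_measurable_continuous_onI measurable_completion)
  have "integrable lebesgue (\<lambda>x. (indicator K x *\<^sub>R v x) * h x)"
    by (rule Bochner_Integration.integrable_bound[OF integrable_mult_right[OF v, of L]])
      (use v h L in \<open>auto intro!: AE_I2 borel_measurable_times simp: abs_mult mult.commute mult_right_mono indicator_def\<close>)
  moreover have e: "(indicator K x *\<^sub>R v x) * h x = v x * h x" for x
    using assms(5) by (auto simp: indicator_def)
  ultimately show i: "integrable lebesgue (\<lambda>x. v x * h x)" by (simp only:)
  have e2: "indicator A x *\<^sub>R (v x * h x) = v x * h x" for x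
    using assms(4,5) by (auto simp: indicator_def)
  have Am: "A \<inter> space lebesgue \<in> sets lebesgue" using assms(6) by auto
  show "integrable (lebesgue_on A) (\<lambda>x. v x * h x)"
    unfolding integrable_restrict_space[OF Am] e2 by (rule i)
  show "(LINT x|lebesgue_on A. v x * h x) = (LINT x|lebesgue. v x * h x)"
    unfolding integral_restrict_space[OF Am] e2 by (rule refl)
qed

lemma test_function_C1: "\<phi> \<in> test_functions A \<Longrightarrow> C_k (Suc 0) \<phi>"
  unfolding test_functions_def by blast

text \<open>The indicator of a box is not a test function, but it is the pointwise limit of the
  bumps \<open>box_bump l u n\<close>. These are bounded by 1 and supported in the closed box, where
  \<open>v\<close> is integrable, so dominated convergence applies.\<close>

lemma fundamental_lemma_box:
  fixes v :: "'a::euclidean_space \<Rightarrow> real"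
  assumes "open A" "locally_integrable A v"
    and "\<And>\<phi>. \<phi> \<in> test_functions A \<Longrightarrow> (LINT x|lebesgue_on A. v x * \<phi> x) = 0" "cbox l u \<subseteq> A"
  shows "(LINT x|lebesgue. indicator (box l u) x * v x) = 0"
proof -
  have v: "integrable lebesgue (\<lambda>x. indicator (cbox l u) x *\<^sub>R v x)"
    using assms(2,4) by (auto simp: locally_integrable_def set_integrable_def)
  have b: "box_bump l u n \<in> test_functions A" for n by (rule box_bump_test_function[OF assms(4)])
  have bc: "continuous_on UNIV (box_bump l u n)" for n using C1_continuous test_function_C1 b by blast
  have bm: "box_bump l u n \<in> borel_measurable lebesgue" for n
    using bc by (simp add: borel_measurable_continuous_onI measurable_completion)
  have z: "x \<notin> cbox l u \<Longrightarrow> box_bump l u n x = 0" for x n using box_bump_zero box_subset_cbox by blast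
  have "(\<lambda>n. LINT x|lebesgue. box_bump l u n x * (indicator (cbox l u) x *\<^sub>R v x)) \<longlonglongrightarrow>
      (LINT x|lebesgue. indicator (box l u) x * (indicator (cbox l u) x *\<^sub>R v x))"
  proof (rule integral_dominated_convergence)
    show "integrable lebesgue (\<lambda>x. norm (indicator (cbox l u) x *\<^sub>R v x))" using v by (rule integrable_norm)
    show "AE x in lebesgue. (\<lambda>n. box_bump l u n x * (indicator (cbox l u) x *\<^sub>R v x)) \<longlonglongrightarrow>
      indicator (box l u) x * (indicator (cbox l u) x *\<^sub>R v x)"
      by (intro AE_I2 tendsto_intros box_bump_tendsto)
    show "AE x in lebesgue. norm (box_bump l u n x * (indicator (cbox l u) x *\<^sub>R v x)) \<le>
      norm (indicator (cbox l u) x *\<^sub>R v x)" for n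
      using box_bump_bounds[of l u n] by (auto intro!: AE_I2 mult_left_le_one_le simp: abs_mult)
    note vm = borel_measurable_integrable[OF v]
    show "(\<lambda>x. indicator (box l u) x * (indicator (cbox l u) x *\<^sub>R v x)) \<in> borel_measurable lebesgue"
      "(\<lambda>x. box_bump l u n x * (indicator (cbox l u) x *\<^sub>R v x)) \<in> borel_measurable lebesgue" for n
      by (intro borel_measurable_times bm vm borel_measurable_indicator; simp)+
  qed
  moreover have "(LINT x|lebesgue. box_bump l u n x * (indicator (cbox l u) x *\<^sub>R v x)) = 0" for n
  proof -
    have "(LINT x|lebesgue. box_bump l u n x * (indicator (cbox l u) x *\<^sub>R v x)) =
        (LINT x|lebesgue. v x * box_bump l u n x)"
      using z by (intro Bochner_Integration.integral_cong refl) (auto simp: indicator_def)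
    also have "\<dots> = (LINT x|lebesgue_on A. v x * box_bump l u n x)"
      by (rule locally_integrable_mult(3)[symmetric, OF assms(2) bc compact_cbox assms(4) z assms(1)])
    finally show ?thesis using assms(3)[OF b] by simp
  qed
  moreover have "indicator (box l u) x * (indicator (cbox l u) x *\<^sub>R v x) = indicator (box l u) x * v x" for x
    using box_subset_cbox[of l u] by (auto simp: indicator_def)
  ultimately show ?thesis by (simp only: LIMSEQ_const_iff)
qed

text \<open>The integral of \<open>g\<close> over a set vanishes on open boxes, an intersection
  stable generator of the Borel sets. Dynkin's argument extends this to all Borel sets, and
  densities are unique almost everywhere.\<close>

lemma AE_zero_if_box_integrals_zero:
  fixes g :: "'a::euclidean_space \<Rightarrow> real"
  assumes g: "integrable lborel g" and box: "\<And>l u. (LINT x|lborel. indicator (box l u) x * g x) = 0"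
  shows "AE x in lborel. g x = 0"
proof -
  have ig: "set_integrable lborel S g" if "S \<in> sets borel" for S
    unfolding set_integrable_def using that by (intro integrable_mult_indicator g) auto
  \<comment> \<open>Passing to complements requires the integral over the whole space, which boxes
    reach only in the limit.\<close>
  have tot: "(LINT x|lborel. g x) = 0"
  proof -
    have "(\<lambda>n. LINT x|lborel. indicator (box (- (real n *\<^sub>R One)) (real n *\<^sub>R One)) x * g x) \<longlonglongrightarrow>
        (LINT x|lborel. g x)"
    proof (rule integral_dominated_convergence)
      show "integrable lborel (\<lambda>x. norm (g x))" using g by (rule integrable_norm)
      show "AE x in lborel. (\<lambda>n. indicator (box (- (real n *\<^sub>R One)) (real n *\<^sub>R One)) x * g x) \<longlonglongrightarrow> g x"
      proof (rule AE_I2)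
        fix x :: 'a
        have "x \<in> (\<Union>i::nat. box (- (real i *\<^sub>R One)) (real i *\<^sub>R One))" using UN_box_eq_UNIV by blast
        then obtain i :: nat where i: "x \<in> box (- (real i *\<^sub>R One)) (real i *\<^sub>R One)" by blast
        have "x \<in> box (- (real n *\<^sub>R One)) (real n *\<^sub>R One)" if "n \<ge> i" for n
          using i that by (fastforce simp: mem_box)
        then have "\<forall>\<^sub>F n in sequentially. indicator (box (- (real n *\<^sub>R One)) (real n *\<^sub>R One)) x * g x = g x"
          by (intro eventually_sequentiallyI[of i]) auto
        then show "(\<lambda>n. indicator (box (- (real n *\<^sub>R One)) (real n *\<^sub>R One)) x * g x) \<longlonglongrightarrow> g x"
          by (rule tendsto_eventually)
      qed
    qed (use g in \<open>auto simp: indicator_def intro!: AE_I2\<close>)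
    then show ?thesis by (simp add: box LIMSEQ_const_iff)
  qed
  have "(LINT x:S|lborel. g x) = 0" if "S \<in> sets borel" for S
  proof -
    have "Int_stable (range (\<lambda>(a, b). box a b :: 'a set))" by (auto simp: Int_stable_def box_Int_box)
    moreover have "range (\<lambda>(a, b). box a b :: 'a set) \<subseteq> Pow UNIV" by simp
    moreover have "S \<in> sigma_sets UNIV (range (\<lambda>(a, b). box a b :: 'a set))" using that by (simp add: borel_eq_box)
    ultimately show ?thesis
    proof (induction rule: sigma_sets_induct_disjoint)
      case (basic S)
      then show ?case using box by (auto simp: set_lebesgue_integral_def)
    next
      case empty
      then show ?case by (simp add: set_lebesgue_integral_def)
    next
      case (compl S)
      then have S: "S \<in> sets borel" by (simp add: borel_eq_box)
      have "(LINT x:(UNIV - S) \<union> S|lborel. g x) = (LINT x:UNIV - S|lborel. g x) + (LINT x:S|lborel. g x)"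
        using S by (intro set_integral_Un ig) auto
      then have "(LINT x:UNIV - S|lborel. g x) = (LINT x:UNIV|lborel. g x) - (LINT x:S|lborel. g x)"
        by simp
      then show ?case using compl tot by (simp add: set_lebesgue_integral_def)
    next
      case (union S)
      then have S: "range S \<subseteq> sets borel" by (simp add: borel_eq_box)
      have "(LINT x:(\<Union>i. S i)|lborel. g x) = (\<Sum>i. (LINT x:(S i)|lborel. g x))"
        using S union(1) by (intro lebesgue_integral_countable_add ig) (auto simp: disjoint_family_on_def)
      then show ?case using union by simp
    qed
  qed
  then show ?thesis using density_unique_real[OF g, of "\<lambda>_. 0"] by (simp add: set_lebesgue_integral_def)
qed

text \<open>The claim is local: it is proved on boxes with closure in \<open>A\<close>, and
  countably many of these cover \<open>A\<close>.\<close>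

lemma fundamental_lemma:
  fixes v :: "'a::euclidean_space \<Rightarrow> real"
  assumes A: "open A" "locally_integrable A v"
    and v: "\<And>\<phi>. \<phi> \<in> test_functions A \<Longrightarrow> (LINT x|lebesgue_on A. v x * \<phi> x) = 0"
  shows "AE x in lebesgue_on A. v x = 0"
proof -
  have loc: "AE x in lebesgue. x \<in> box a c \<longrightarrow> v x = 0" if ac: "cbox a c \<subseteq> A" for a c
  proof -
    have vi: "integrable lebesgue (\<lambda>x. indicator (cbox a c) x *\<^sub>R v x)"
      using A ac by (auto simp: locally_integrable_def set_integrable_def)
    have "integrable lebesgue (\<lambda>x. indicator (box a c) x *\<^sub>R (indicator (cbox a c) x *\<^sub>R v x))"
      by (rule integrable_mult_indicator[OF _ vi]) simp
    moreover have "indicator (box a c) x *\<^sub>R (indicator (cbox a c) x *\<^sub>R v x) = indicator (box a c) x * v x" for x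
      using box_subset_cbox[of a c] by (auto simp: indicator_def)
    ultimately have gi: "integrable lebesgue (\<lambda>x. indicator (box a c) x * v x)" by (simp only:)
    \<comment> \<open>A Borel representative is taken because the box criterion is stated for
      \<open>lborel\<close>.\<close>
    then obtain g where g: "g \<in> borel_measurable lborel" "AE x in lborel. indicator (box a c) x * v x = g x"
      using completion_ex_borel_measurable_real[OF borel_measurable_integrable[OF gi]] by blast
    have g': "AE x in lebesgue. indicator (box a c) x * v x = g x" using g(2) by (rule AE_completion)
    have "integrable lebesgue g"
      using integrable_cong_AE_imp[OF gi _ g'] g(1) by (simp add: measurable_completion)
    then have gl: "integrable lborel g" using g(1) integrable_completion by blast
    have "(LINT x|lborel. indicator (box l u) x * g x) = 0" for l u
    proof -
      have "(LINT x|lborel. indicator (box l u) x * g x) = (LINT x|lebesgue. indicator (box l u) x * g x)"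
        using g(1) by (intro integral_completion[symmetric]) auto
      also have "\<dots> = (LINT x|lebesgue. indicator (box l u) x * (indicator (box a c) x * v x))"
        using g' by (intro integral_cong_AE borel_measurable_times measurable_completion[OF g(1)]
            borel_measurable_integrable[OF gi] borel_measurable_indicator) (auto elim!: eventually_mono)
      also have "\<dots> = (LINT x|lebesgue. indicator (box l u \<inter> box a c) x * v x)"
        by (simp add: indicator_inter_arith mult.assoc)
      also have "\<dots> = 0"
      proof (cases "box l u \<inter> box a c = {}")
        case False
        \<comment> \<open>The box criterion asks for every box, whereas test functions control only
          boxes with closure in \<open>A\<close>. Intersecting with \<open>box a c\<close> produces
          such a box.\<close>
        obtain l' u' where b: "box l u \<inter> box a c = box l' u'" using box_Int_box by blast
        then have "cbox l' u' = closure (box l u \<inter> box a c)" using False by (simp add: closure_box)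
        also have "\<dots> \<subseteq> closure (box a c)" by (intro closure_mono) auto
        also have "\<dots> \<subseteq> A" using False ac closure_box by (metis inf_bot_right)
        finally have "cbox l' u' \<subseteq> A" .
        from fundamental_lemma_box[OF A _ this] v show ?thesis unfolding b by blast
      qed simp
      finally show ?thesis .
    qed
    then have "AE x in lborel. g x = 0" by (rule AE_zero_if_box_integrals_zero[OF gl])
    then have "AE x in lebesgue. g x = 0" by (rule AE_completion)
    with g' show ?thesis by eventually_elim (auto simp: indicator_def)
  qed
  define \<F> where "\<F> = {box a c | a c. cbox a c \<subseteq> A}"
  obtain \<F>' where F: "\<F>' \<subseteq> \<F>" "countable \<F>'" "\<Union>\<F>' = \<Union>\<F>"
  proof (rule Lindelof)
    show "open S" if "S \<in> \<F>" for S using that by (auto simp: \<F>_def)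
  qed blast
  have "A \<subseteq> \<Union>\<F>"
  proof
    fix x assume "x \<in> A"
    with A(1) obtain a c where "cbox a c \<subseteq> A" "x \<in> box a c"
      by (rule open_contains_cbox)
    then show "x \<in> \<Union>\<F>" by (auto simp: \<F>_def)
  qed
  moreover have "AE x in lebesgue. \<forall>S\<in>\<F>'. x \<in> S \<longrightarrow> v x = 0"
  proof (rule AE_ball_countable'[OF _ F(2)])
    fix S assume "S \<in> \<F>'"
    then obtain a c where "S = box a c" "cbox a c \<subseteq> A" using F(1) by (auto simp: \<F>_def)
    then show "AE x in lebesgue. x \<in> S \<longrightarrow> v x = 0" using loc by simp
  qed
  ultimately have "AE x in lebesgue. x \<in> A \<longrightarrow> v x = 0"
    using F(3) by (elim eventually_mono) blast
  moreover have "A \<inter> space lebesgue \<in> sets lebesgue" using A(1) by auto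
  ultimately show ?thesis by (simp add: AE_restrict_space_iff)
qed

subsection \<open>Horizontal derivatives\<close>

lemma test_function_support:
  assumes "\<phi> \<in> test_functions A"
  obtains K where "compact K" "K \<subseteq> A" "\<And>x. x \<notin> K \<Longrightarrow> \<phi> x = 0"
  by (rule test_functionsE[OF assms]) (rule that)

lemma integral_on_compact_support:
  fixes h :: "'a::euclidean_space \<Rightarrow> real"
  assumes "continuous_on UNIV h" "compact K" "\<And>x. x \<notin> K \<Longrightarrow> h x = 0" "K \<subseteq> A" "open A"
  shows "integrable (lebesgue_on A) h" "(LINT x|lebesgue_on A. h x) = (LINT x|lborel. h x)"
proof -
  have i: "integrable lborel h" using integrable_compact_support assms by blast
  then have hm: "h \<in> borel_measurable lborel" by auto
  have Am: "A \<inter> space lebesgue \<in> sets lebesgue" using assms(5) by auto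
  have e: "indicator A x *\<^sub>R h x = h x" for x using assms(3,4) by (auto simp: indicator_def)
  show "integrable (lebesgue_on A) h"
    unfolding integrable_restrict_space[OF Am] e using i hm integrable_completion by blast
  show "(LINT x|lebesgue_on A. h x) = (LINT x|lborel. h x)"
    unfolding integral_restrict_space[OF Am] e using integral_completion[OF hm] by simp
qed

lemma integral_lborel_translate:
  fixes h :: "'a::euclidean_space \<Rightarrow> real"
  assumes "h \<in> borel_measurable borel"
  shows "(LINT x|lborel. h (c + x)) = (LINT x|lborel. h x)"
proof -
  have "(LINT x|lborel. h x) = (LINT x|distr lborel borel ((+) c). h x)" by (simp add: lborel_distr_plus)
  also have "\<dots> = (LINT x|lborel. h (c + x))" using assms by (subst integral_distr) auto
  finally show ?thesis by simp
qed

text \<open>Translation invariance makes the integral of every difference quotient vanish. The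
  quotients converge to the derivative and are dominated by the constant \<open>L\<close> on a
  common ball.\<close>

lemma integral_partial_zero:
  fixes \<psi> :: "'a::euclidean_space \<Rightarrow> real"
  assumes C1: "C_k (Suc 0) \<psi>" and K: "compact K" "\<And>x. x \<notin> K \<Longrightarrow> \<psi> x = 0"
  shows "(LINT x|lborel. frechet_derivative \<psi> (at x) b) = 0"
proof -
  define D where "D x = frechet_derivative \<psi> (at x)" for x
  have D: "(\<psi> has_derivative D x) (at x)" for x unfolding D_def by (rule C1_frechet[OF C1])
  have Dc: "continuous_on UNIV (\<lambda>x. D x b)"
    unfolding D_def by (rule C1_continuous_frechet[OF C1]) simp
  have Dz: "x \<notin> K \<Longrightarrow> D x b = 0" for x
    unfolding D_def using frechet_derivative_zero_outside[OF K(2) compact_imp_closed[OF K(1)]] by simp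
  obtain L where L: "L \<ge> 0" "\<And>x. \<bar>D x b\<bar> \<le> L" using compact_support_bounded[OF Dc K(1) Dz] by blast
  obtain R where R: "\<And>x. x \<in> K \<Longrightarrow> norm x \<le> R"
    using compact_imp_bounded[OF K(1)] unfolding bounded_iff by blast
  define t where "t n = 1 / real (Suc n)" for n
  have t: "t n > 0" "t n \<le> 1" for n by (auto simp: t_def)
  define q where "q n x = (\<psi> (t n *\<^sub>R b + x) - \<psi> x) / t n" for n x
  have line: "((\<lambda>s. \<psi> (s *\<^sub>R b + x)) has_real_derivative D (s *\<^sub>R b + x) b) (at s)" for x s
  proof -
    have "((\<lambda>s. \<psi> (s *\<^sub>R b + x)) has_derivative (\<lambda>h. D (s *\<^sub>R b + x) (h *\<^sub>R b))) (at s)"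
      by (rule has_derivative_compose[OF _ D]) (auto intro!: derivative_eq_intros)
    moreover have "D (s *\<^sub>R b + x) (h *\<^sub>R b) = D (s *\<^sub>R b + x) b * h" for h
      using has_derivative_linear[OF D] by (simp add: linear_cmul)
    ultimately show ?thesis by (simp add: has_field_derivative_def)
  qed
  have qL: "\<bar>q n x\<bar> \<le> L" for n x
  proof -
    obtain z where "\<psi> (t n *\<^sub>R b + x) - \<psi> (0 *\<^sub>R b + x) = (t n - 0) * D (z *\<^sub>R b + x) b"
      using MVT2[of 0 "t n" "\<lambda>s. \<psi> (s *\<^sub>R b + x)" "\<lambda>s. D (s *\<^sub>R b + x) b"] t line by blast
    then have "q n x = D (z *\<^sub>R b + x) b" using t[of n] by (simp add: q_def)
    then show ?thesis using L by simp
  qed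
  \<comment> \<open>The increments \<open>t n\<close> are at most 1, so translation moves the
    support by at most \<open>norm b\<close>.\<close>
  have qz: "q n x = 0" if "x \<notin> cball 0 (R + norm b)" for n x
  proof -
    have nx: "norm x > R + norm b" using that by simp
    have "norm (t n *\<^sub>R b + x) \<ge> norm x - norm (t n *\<^sub>R b)" by (metis add.commute norm_diff_ineq)
    moreover have "norm (t n *\<^sub>R b) \<le> norm b" using t[of n] by (simp add: mult_left_le_one_le)
    ultimately have "norm (t n *\<^sub>R b + x) > R" using nx by linarith
    moreover have "norm x > R" using nx norm_ge_zero[of b] by linarith
    ultimately have "t n *\<^sub>R b + x \<notin> K" "x \<notin> K" using R not_le by blast+
    then show ?thesis by (simp add: q_def K(2))
  qed
  have psi: "continuous_on UNIV \<psi>" by (rule C1_continuous[OF C1])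
  have psim: "\<psi> \<in> borel_measurable borel" by (rule borel_measurable_continuous_onI[OF psi])
  have psii: "integrable lborel \<psi>" by (rule integrable_compact_support[OF psi K])
  have psit: "integrable lborel (\<lambda>x. \<psi> (c + x))" for c
  proof (rule integrable_compact_support)
    show "continuous_on UNIV (\<lambda>x. \<psi> (c + x))"
      by (rule continuous_on_compose2[OF psi]) (auto intro!: continuous_intros)
    show "compact ((\<lambda>x. - c + x) ` K)" by (rule compact_translation[OF K(1)])
    show "\<psi> (c + x) = 0" if "x \<notin> (\<lambda>x. - c + x) ` K" for x
    proof (rule K(2))
      show "c + x \<notin> K" using that image_eqI[of x "\<lambda>x. - c + x" "c + x" K] by auto
    qed
  qed
  have "(\<lambda>n. LINT x|lborel. q n x) \<longlonglongrightarrow> (LINT x|lborel. D x b)"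
  proof (rule integral_dominated_convergence)
    show "integrable lborel (\<lambda>x. L * indicator (cball (0::'a) (R + norm b)) x)"
      by (intro integrable_mult_right integrable_real_indicator) (use emeasure_bounded_finite[of "cball (0::'a) (R + norm b)"] in \<open>auto simp: infinity_ennreal_def\<close>)
    show "(\<lambda>x. D x b) \<in> borel_measurable lborel" using borel_measurable_continuous_onI[OF Dc] by simp
    show "q n \<in> borel_measurable lborel" for n
      unfolding q_def[abs_def] using psit psii by (intro borel_measurable_divide borel_measurable_diff) auto
    show "AE x in lborel. (\<lambda>n. q n x) \<longlonglongrightarrow> D x b"
    proof (rule AE_I2)
      fix x
      have "((\<lambda>h. (\<psi> (h *\<^sub>R b + x) - \<psi> x) / h) \<longlongrightarrow> D x b) (at 0)"
        using line[of x 0] by (simp add: DERIV_def)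
      moreover have "filterlim t (at 0) sequentially"
      proof -
        have "t \<longlonglongrightarrow> 0" unfolding t_def[abs_def]
          using LIMSEQ_inverse_real_of_nat by (simp only: inverse_eq_divide)
        then show ?thesis unfolding filterlim_at using t by (auto intro!: always_eventually simp: less_imp_neq[THEN not_sym])
      qed
      ultimately show "(\<lambda>n. q n x) \<longlonglongrightarrow> D x b" unfolding q_def by (rule filterlim_compose)
    qed
    show "AE x in lborel. norm (q n x) \<le> L * indicator (cball (0::'a) (R + norm b)) x" for n
    proof (rule AE_I2)
      fix x show "norm (q n x) \<le> L * indicator (cball (0::'a) (R + norm b)) x"
        using qL[of n x] qz[of x n] by (cases "x \<in> cball 0 (R + norm b)") auto
    qed
  qed
  moreover have "(LINT x|lborel. q n x) = 0" for n
  proof -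
    have "(LINT x|lborel. q n x) = ((LINT x|lborel. \<psi> (t n *\<^sub>R b + x)) - (LINT x|lborel. \<psi> x)) / t n"
      unfolding q_def using psii psit by simp
    then show ?thesis by (simp add: integral_lborel_translate[OF psim])
  qed
  ultimately show ?thesis by (simp add: LIMSEQ_const_iff D_def)
qed

section \<open>Horizontal fields acting on smooth functions\<close>

definition Xd :: "'n::finite + 'n \<Rightarrow> ('n heis \<Rightarrow> real) \<Rightarrow> 'n heis \<Rightarrow> real" where
  "Xd i \<phi> x = frechet_derivative \<phi> (at x) (Xfield i x)"

text \<open>A horizontal field splits into a constant direction and a multiple of the vertical
  direction. The factor is linear in the horizontal variables and independent of the vertical one,
  which is what makes the field divergence free.\<close>

fun Xbase :: "'n::finite + 'n \<Rightarrow> 'n heis" where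
  "Xbase (Inl j) = (axis j 1, 0, 0)"
| "Xbase (Inr j) = (0, axis j 1, 0)"

fun Xcoef :: "'n::finite + 'n \<Rightarrow> 'n heis \<Rightarrow> real" where
  "Xcoef (Inl j) x = - (fst (snd x) $ j) / 2"
| "Xcoef (Inr j) x = fst x $ j / 2"

lemma Xfield_decomp: "Xfield i x = Xbase i + Xcoef i x *\<^sub>R (0, 0, 1)"
  by (cases i; cases x) auto

lemma linear_Xcoef: "linear (Xcoef i)"
  by (cases i) (auto intro!: linearI simp: field_simps)

lemma C_k_linear:
  fixes L :: "'a::euclidean_space \<Rightarrow> real"
  assumes "linear L" shows "C_k k L"
proof (cases k)
  case 0
  then show ?thesis using assms linear_continuous_on linear_conv_bounded_linear by auto
next
  case (Suc m)
  show ?thesis unfolding Suc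
    by (rule C_k_Suc_intro[of _ "\<lambda>_. L"])
      (use assms in \<open>auto intro: C_k_const linear_imp_has_derivative\<close>)
qed

lemma continuous_Xfield: "continuous_on UNIV (Xfield i)"
proof -
  have "continuous_on UNIV (\<lambda>x. Xbase i + Xcoef i x *\<^sub>R (0, 0, 1))"
    using linear_Xcoef[of i]
    by (intro continuous_on_add continuous_on_scaleR continuous_on_const linear_continuous_on)
      (simp add: linear_conv_bounded_linear)
  then show ?thesis by (simp add: Xfield_decomp[abs_def])
qed

lemma continuous_Xd: "C_k (Suc 0) \<phi> \<Longrightarrow> continuous_on UNIV (Xd i \<phi>)"
  unfolding Xd_def[abs_def] by (rule C1_continuous_frechet[OF _ continuous_Xfield])

lemma Xd_zero_outside: "(\<And>x. x \<notin> K \<Longrightarrow> \<phi> x = 0) \<Longrightarrow> closed K \<Longrightarrow> x \<notin> K \<Longrightarrow> Xd i \<phi> x = 0"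
  unfolding Xd_def by (subst frechet_derivative_zero_outside[of K]) auto

lemma Xd_eqI: "(\<phi> has_derivative D) (at x) \<Longrightarrow> Xd i \<phi> x = D (Xfield i x)"
  unfolding Xd_def by (simp add: frechet_derivativeI)

lemma Xd_mult:
  assumes "C_k (Suc 0) u" "C_k (Suc 0) \<phi>"
  shows "Xd i (\<lambda>x. u x * \<phi> x) x = u x * Xd i \<phi> x + Xd i u x * \<phi> x"
  by (subst Xd_eqI[OF has_derivative_mult[OF C1_frechet[OF assms(1)] C1_frechet[OF assms(2)]]]) (simp add: Xd_def)

lemma Xd_add:
  assumes "C_k (Suc 0) u" "C_k (Suc 0) \<phi>"
  shows "Xd i (\<lambda>x. u x + \<phi> x) x = Xd i u x + Xd i \<phi> x"
  by (subst Xd_eqI[OF has_derivative_add[OF C1_frechet[OF assms(1)] C1_frechet[OF assms(2)]]]) (simp add: Xd_def)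

lemma Xd_const: "Xd i (\<lambda>x. c) x = 0"
  by (subst Xd_eqI[OF has_derivative_const]) simp

lemma Xd_cmult:
  assumes "C_k (Suc 0) \<phi>"
  shows "Xd i (\<lambda>x. c * \<phi> x) x = c * Xd i \<phi> x"
  by (simp add: Xd_mult[OF C_k_const assms] Xd_const)

lemma Xd_linear: "linear L \<Longrightarrow> Xd i L x = L (Xfield i x)"
  by (rule Xd_eqI) (simp add: linear_imp_has_derivative)

text \<open>As \<open>Xcoef i\<close> does not vary in the vertical direction, it can be moved under
  the vertical derivative. Then \<open>Xd i \<psi>\<close> is a sum of derivatives of
  \<open>\<psi>\<close> and \<open>\<eta>\<close> in constant directions, and each of them
  integrates to zero.\<close>

lemma integral_Xd_zero:
  fixes \<psi> :: "'n::finite heis \<Rightarrow> real"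
  assumes C1: "C_k (Suc 0) \<psi>" and K: "compact K" "\<And>x. x \<notin> K \<Longrightarrow> \<psi> x = 0"
  shows "(LINT x|lborel. Xd i \<psi> x) = 0"
proof -
  let ?e = "(0, 0, 1) :: 'n heis"
  define \<eta> where "\<eta> x = Xcoef i x * \<psi> x" for x
  have C1c: "C_k (Suc 0) \<eta>" unfolding \<eta>_def by (intro C_k_mult C_k_linear linear_Xcoef C1)
  have cz: "x \<notin> K \<Longrightarrow> \<eta> x = 0" for x using K(2) by (simp add: \<eta>_def)
  have "Xcoef i ?e = 0" by (cases i) auto
  have chi: "frechet_derivative \<eta> (at x) ?e = Xcoef i x * frechet_derivative \<psi> (at x) ?e" for x
  proof -
    have "(\<eta> has_derivative (\<lambda>h. Xcoef i x * frechet_derivative \<psi> (at x) h + Xcoef i h * \<psi> x)) (at x)"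
      unfolding \<eta>_def using linear_imp_has_derivative[OF linear_Xcoef]
      by (intro has_derivative_mult C1_frechet[OF C1])
    then show ?thesis using \<open>Xcoef i ?e = 0\<close> by (simp add: frechet_derivativeI)
  qed
  have "Xd i \<psi> x = frechet_derivative \<psi> (at x) (Xbase i) + frechet_derivative \<eta> (at x) ?e" for x
    unfolding Xd_def Xfield_decomp chi using linear_frechet_derivative[OF C_k_differentiable[OF C1]]
    by (simp only: linear_add linear_cmul real_scaleR_def)
  moreover have int: "integrable lborel (\<lambda>x. frechet_derivative f (at x) b)"
    if f: "C_k (Suc 0) f" "\<And>x. x \<notin> K \<Longrightarrow> f x = 0" for f :: "'n heis \<Rightarrow> real" and b
    by (rule integrable_compact_support[OF C1_continuous_frechet[OF f(1) continuous_on_const] K(1)])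
      (simp add: frechet_derivative_zero_outside[OF f(2) compact_imp_closed[OF K(1)]])
  ultimately have "(LINT x|lborel. Xd i \<psi> x) =
      (LINT x|lborel. frechet_derivative \<psi> (at x) (Xbase i)) + (LINT x|lborel. frechet_derivative \<eta> (at x) ?e)"
    using int[OF C1 K(2)] int[OF C1c cz] by simp
  then show ?thesis using integral_partial_zero[OF C1 K] integral_partial_zero[OF C1c K(1) cz] by simp
qed

lemma locally_integrable_continuous:
  assumes "continuous_on UNIV u" shows "locally_integrable A u"
  unfolding locally_integrable_def
proof (intro allI impI)
  fix K assume K: "compact K \<and> K \<subseteq> A"
  have "integrable lborel (\<lambda>x. indicator K x *\<^sub>R u x)"
    using K borel_integrable_compact[of K u] continuous_on_subset[OF assms, of K] by (simp add: set_integrable_def)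
  then show "set_integrable lebesgue K u"
    unfolding set_integrable_def using integrable_completion borel_measurable_integrable by blast
qed

text \<open>Integration by parts: the product of \<open>u\<close> with a test function has compact
  support, so the integral of its derivative vanishes.\<close>

lemma weak_X_smooth:
  assumes "open A" "C_k (Suc 0) u"
  shows "weak_X A i u (Xd i u)"
  unfolding weak_X_def
proof (intro conjI ballI)
  have uc: "continuous_on UNIV u" by (rule C1_continuous[OF assms(2)])
  have Xc: "continuous_on UNIV (Xd i u)" by (rule continuous_Xd[OF assms(2)])
  show "locally_integrable A u" "locally_integrable A (Xd i u)"
    by (rule locally_integrable_continuous[OF uc], rule locally_integrable_continuous[OF Xc])
  fix \<phi> assume phi: "\<phi> \<in> test_functions A"
  then have C1: "C_k (Suc 0) \<phi>" by (rule test_function_C1)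
  obtain K where K: "compact K" "K \<subseteq> A" "\<And>x. x \<notin> K \<Longrightarrow> \<phi> x = 0"
    using test_function_support[OF phi] by blast
  have Xz: "x \<notin> K \<Longrightarrow> Xd i \<phi> x = 0" for x by (rule Xd_zero_outside[OF K(3) compact_imp_closed[OF K(1)]])
  have "(LINT x|lborel. Xd i (\<lambda>x. u x * \<phi> x) x) = 0"
    using K(3) by (intro integral_Xd_zero[OF C_k_mult[OF assms(2) C1] K(1)]) auto
  moreover have "(LINT x|lborel. Xd i (\<lambda>x. u x * \<phi> x) x) = (LINT x|lborel. u x * Xd i \<phi> x) + (LINT x|lborel. Xd i u x * \<phi> x)"
    unfolding Xd_mult[OF assms(2) C1]
    using K(3) Xz by (intro Bochner_Integration.integral_add integrable_compact_support[OF _ K(1)]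
        continuous_on_mult uc Xc continuous_Xd[OF C1] C1_continuous[OF C1]) auto
  moreover have "(LINT x|lborel. u x * Xd i \<phi> x) = (LINT x|lebesgue_on A. u x * Xd i \<phi> x)"
    using Xz by (intro integral_on_compact_support(2)[symmetric, OF _ K(1) _ K(2) assms(1)]
        continuous_on_mult uc Xc continuous_Xd[OF C1]) auto
  moreover have "(LINT x|lborel. Xd i u x * \<phi> x) = (LINT x|lebesgue_on A. Xd i u x * \<phi> x)"
    using K(3) by (intro integral_on_compact_support(2)[symmetric, OF _ K(1) _ K(2) assms(1)]
        continuous_on_mult uc Xc C1_continuous[OF C1]) auto
  ultimately show "(LINT x|lebesgue_on A. u x * frechet_derivative \<phi> (at x) (Xfield i x)) =
      - (LINT x|lebesgue_on A. Xd i u x * \<phi> x)"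
    unfolding Xd_def[symmetric] by linarith
qed

section \<open>Uniqueness and linearity of weak horizontal derivatives\<close>

lemma weak_XD:
  assumes "weak_X A i u v" "\<phi> \<in> test_functions A"
  shows "(LINT x|lebesgue_on A. u x * frechet_derivative \<phi> (at x) (Xfield i x)) = - (LINT x|lebesgue_on A. v x * \<phi> x)"
  using assms unfolding weak_X_def by blast

lemma weak_X_unique:
  assumes A: "open A" and v: "weak_X A i u v" and w: "weak_X A i u w"
  shows "AE x in lebesgue_on A. v x = w x"
proof -
  have l: "locally_integrable A v" "locally_integrable A w" using v w by (auto simp: weak_X_def)
  have "AE x in lebesgue_on A. v x - w x = 0"
  proof (rule fundamental_lemma[OF A])
    show "locally_integrable A (\<lambda>x. v x - w x)"
      using l unfolding locally_integrable_def by (simp add: set_integral_diff(1))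
    fix \<phi> assume phi: "\<phi> \<in> test_functions A"
    obtain K where K: "compact K" "K \<subseteq> A" "\<And>x. x \<notin> K \<Longrightarrow> \<phi> x = 0"
    using test_function_support[OF phi] by blast
    have c: "continuous_on UNIV \<phi>" by (rule C1_continuous[OF test_function_C1[OF phi]])
    have "(LINT x|lebesgue_on A. (v x - w x) * \<phi> x) =
        (LINT x|lebesgue_on A. v x * \<phi> x) - (LINT x|lebesgue_on A. w x * \<phi> x)"
      unfolding left_diff_distrib
      by (intro Bochner_Integration.integral_diff locally_integrable_mult(1)[OF _ c K A] l)
    also have "\<dots> = 0"
    proof -
      have "(LINT x|lebesgue_on A. v x * \<phi> x) = - (LINT x|lebesgue_on A. u x * frechet_derivative \<phi> (at x) (Xfield i x))"
        "(LINT x|lebesgue_on A. w x * \<phi> x) = - (LINT x|lebesgue_on A. u x * frechet_derivative \<phi> (at x) (Xfield i x))"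
        using weak_XD[OF v phi] weak_XD[OF w phi] by simp_all
      then show ?thesis by simp
    qed
    finally show "(LINT x|lebesgue_on A. (v x - w x) * \<phi> x) = 0" .
  qed
  then show ?thesis by (auto elim!: eventually_mono)
qed

lemma weak_X_linear_comb:
  assumes A: "open A" and v: "weak_X A i u v" and w: "weak_X A i u' v'"
  shows "weak_X A i (\<lambda>x. u x + c * u' x) (\<lambda>x. v x + c * v' x)"
  unfolding weak_X_def
proof (intro conjI ballI)
  have l: "locally_integrable A u" "locally_integrable A u'" "locally_integrable A v" "locally_integrable A v'"
    using v w by (auto simp: weak_X_def)
  show "locally_integrable A (\<lambda>x. u x + c * u' x)" "locally_integrable A (\<lambda>x. v x + c * v' x)"
    using l unfolding locally_integrable_def by (simp_all add: set_integral_add(1))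
  fix \<phi> assume phi: "\<phi> \<in> test_functions A"
  then have C1: "C_k (Suc 0) \<phi>" by (rule test_function_C1)
  obtain K where K: "compact K" "K \<subseteq> A" "\<And>x. x \<notin> K \<Longrightarrow> \<phi> x = 0"
    using test_function_support[OF phi] by blast
  have Xz: "x \<notin> K \<Longrightarrow> Xd i \<phi> x = 0" for x by (rule Xd_zero_outside[OF K(3) compact_imp_closed[OF K(1)]])
  have *: "(LINT x|lebesgue_on A. (f x + c * g x) * h x) =
      (LINT x|lebesgue_on A. f x * h x) + c * (LINT x|lebesgue_on A. g x * h x)"
    if "locally_integrable A f" "locally_integrable A g" "continuous_on UNIV h" "\<And>x. x \<notin> K \<Longrightarrow> h x = 0" for f g h
  proof -
    have "integrable (lebesgue_on A) (\<lambda>x. f x * h x)" "integrable (lebesgue_on A) (\<lambda>x. g x * h x)"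
      using locally_integrable_mult(1)[OF that(1) that(3) K(1,2) that(4) A]
        locally_integrable_mult(1)[OF that(2) that(3) K(1,2) that(4) A] by simp_all
    then show ?thesis by (simp add: distrib_right mult.assoc)
  qed
  have "(LINT x|lebesgue_on A. u x * Xd i \<phi> x) = - (LINT x|lebesgue_on A. v x * \<phi> x)"
    "(LINT x|lebesgue_on A. u' x * Xd i \<phi> x) = - (LINT x|lebesgue_on A. v' x * \<phi> x)"
    using weak_XD[OF v phi] weak_XD[OF w phi] by (simp_all add: Xd_def)
  moreover have "(LINT x|lebesgue_on A. (u x + c * u' x) * Xd i \<phi> x) =
      (LINT x|lebesgue_on A. u x * Xd i \<phi> x) + c * (LINT x|lebesgue_on A. u' x * Xd i \<phi> x)"
    by (rule *[OF l(1,2) continuous_Xd[OF C1] Xz])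
  moreover have "(LINT x|lebesgue_on A. (v x + c * v' x) * \<phi> x) =
      (LINT x|lebesgue_on A. v x * \<phi> x) + c * (LINT x|lebesgue_on A. v' x * \<phi> x)"
    by (rule *[OF l(3,4) C1_continuous[OF C1] K(3)])
  ultimately show "(LINT x|lebesgue_on A. (u x + c * u' x) * frechet_derivative \<phi> (at x) (Xfield i x)) =
      - (LINT x|lebesgue_on A. (v x + c * v' x) * \<phi> x)"
    unfolding Xd_def[symmetric] by simp
qed

lemma hproj_Xfield: "hproj (Xfield i x) = axis i 1"
  by (cases i; cases x) (auto simp: hproj_def vec_eq_iff axis_def split: sum.splits)

lemma linear_hproj: "linear hproj"
  by (auto intro!: linearI simp: hproj_def vec_eq_iff split: sum.splits)

lemma linear_inner_hproj: "linear (\<lambda>x. p \<bullet> hproj x)"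
  by (rule linearI) (simp_all only: linear_add[OF linear_hproj] linear_cmul[OF linear_hproj]
      inner_add_right inner_scaleR_right real_scaleR_def)

lemma C_k_affine: "C_k k (\<lambda>x. p \<bullet> hproj x + a)"
  by (intro C_k_add C_k_const C_k_linear linear_inner_hproj)

text \<open>\<open>hproj\<close> does not see the vertical part of a field. This is why affine data
  contribute a constant to the gradient and their additive constant contributes nothing.\<close>

lemma Xd_affine: "Xd i (\<lambda>x. p \<bullet> hproj x + a) x = p $ i"
  by (simp add: Xd_add[OF C_k_linear[OF linear_inner_hproj] C_k_const] Xd_linear[OF linear_inner_hproj]
      Xd_const hproj_Xfield cart_eq_inner_axis)

subsection \<open>The spaces of \<open>\<alpha>\<close>-integrable functions\<close>

text \<open>The function \<alpha> sgn(t) |t|^(\<alpha> - 1). Writing it with \<open>max\<close>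
  makes its continuity for \<alpha> > 1 immediate, also at 0.\<close>

definition dpow :: "real \<Rightarrow> real \<Rightarrow> real" where
  "dpow \<alpha> t = \<alpha> * (max t 0 powr (\<alpha> - 1) - max (- t) 0 powr (\<alpha> - 1))"

lemma abs_powr_has_derivative:
  assumes "\<alpha> > 1"
  shows "((\<lambda>t. \<bar>t\<bar> powr \<alpha>) has_real_derivative dpow \<alpha> t) (at t)"
proof -
  consider "t > 0" | "t < 0" | "t = 0" by linarith
  then show ?thesis
  proof cases
    case 1
    have "((\<lambda>t. t powr \<alpha>) has_real_derivative \<alpha> * t powr (\<alpha> - 1)) (at t)"
      using 1 by (rule has_real_derivative_powr)
    moreover have "\<forall>\<^sub>F s in nhds t. \<bar>s\<bar> powr \<alpha> = s powr \<alpha>"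
      using eventually_nhds_in_open[of "{0<..}" t] 1 by (auto elim!: eventually_mono)
    ultimately show ?thesis using 1 by (subst DERIV_cong_ev[OF refl _ refl]) (auto simp: dpow_def)
  next
    case 2
    have "((\<lambda>t. (- t) powr \<alpha>) has_real_derivative \<alpha> * (- t) powr (\<alpha> - 1) * (- 1)) (at t)"
      using 2 by (intro DERIV_chain2[OF has_real_derivative_powr]) (auto intro!: derivative_eq_intros)
    moreover have "\<forall>\<^sub>F s in nhds t. \<bar>s\<bar> powr \<alpha> = (- s) powr \<alpha>"
      using eventually_nhds_in_open[of "{..<0}" t] 2 by (auto elim!: eventually_mono)
    ultimately show ?thesis using 2 by (subst DERIV_cong_ev[OF refl _ refl]) (auto simp: dpow_def)
  next
    case 3
    have "((\<lambda>h::real. \<bar>h\<bar> powr (\<alpha> - 1)) \<longlongrightarrow> \<bar>0\<bar> powr (\<alpha> - 1)) (at 0)"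
      using assms by (intro tendsto_powr' tendsto_intros) auto
    then have "((\<lambda>h::real. \<bar>h\<bar> powr (\<alpha> - 1)) \<longlongrightarrow> 0) (at 0)" by simp
    then have "((\<lambda>h. \<bar>h\<bar> powr \<alpha> / h) \<longlongrightarrow> 0) (at (0::real))"
    proof (rule Lim_null_comparison[rotated])
      have "norm (\<bar>h\<bar> powr \<alpha> / h) \<le> \<bar>h\<bar> powr (\<alpha> - 1)" if "h \<noteq> 0" for h :: real
        using that by (simp add: powr_diff)
      then show "\<forall>\<^sub>F h in at (0::real). norm (\<bar>h\<bar> powr \<alpha> / h) \<le> \<bar>h\<bar> powr (\<alpha> - 1)"
        by (auto simp: eventually_at_filter)
    qed
    then show ?thesis using 3 by (simp add: DERIV_def dpow_def)
  qed
qed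

lemma continuous_dpow: "\<alpha> > 1 \<Longrightarrow> continuous_on UNIV (dpow \<alpha>)"
  unfolding dpow_def[abs_def] by (intro continuous_intros continuous_on_powr') auto

lemma abs_dpow: "\<alpha> > 1 \<Longrightarrow> \<bar>dpow \<alpha> t\<bar> = \<alpha> * \<bar>t\<bar> powr (\<alpha> - 1)"
  by (cases "t \<ge> 0") (auto simp: dpow_def abs_mult max_def)

lemma dpow_strict_mono:
  assumes "\<alpha> > 1" "s < t" shows "dpow \<alpha> s < dpow \<alpha> t"
proof -
  have m: "x \<le> y \<Longrightarrow> 0 \<le> x \<Longrightarrow> x powr (\<alpha> - 1) \<le> y powr (\<alpha> - 1)" for x y :: real
    using assms by (intro powr_mono2) auto
  have ms: "x < y \<Longrightarrow> 0 \<le> x \<Longrightarrow> x powr (\<alpha> - 1) < y powr (\<alpha> - 1)" for x y :: real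
    using assms by (intro powr_less_mono2) auto
  have 1: "max s 0 powr (\<alpha> - 1) \<le> max t 0 powr (\<alpha> - 1)" "max (- t) 0 powr (\<alpha> - 1) \<le> max (- s) 0 powr (\<alpha> - 1)"
    using assms by (auto intro!: m)
  have "max s 0 powr (\<alpha> - 1) < max t 0 powr (\<alpha> - 1) \<or> max (- t) 0 powr (\<alpha> - 1) < max (- s) 0 powr (\<alpha> - 1)"
  proof (cases "t > 0")
    case True
    then show ?thesis using assms by (intro disjI1 ms) auto
  next
    case False
    then show ?thesis using assms by (intro disjI2 ms) auto
  qed
  then have "max s 0 powr (\<alpha> - 1) - max (- s) 0 powr (\<alpha> - 1) < max t 0 powr (\<alpha> - 1) - max (- t) 0 powr (\<alpha> - 1)"
    using 1 by linarith
  then show ?thesis using assms by (simp add: dpow_def)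
qed

text \<open>The mean value theorem on the two halves of the interval yields points \<open>z1\<close>
  and \<open>z2\<close> on either side of the midpoint, and the derivative is strictly
  increasing.\<close>

lemma abs_powr_midpoint_strict:
  fixes a b :: real
  assumes "\<alpha> > 1" "a \<noteq> b"
  shows "\<bar>(a + b) / 2\<bar> powr \<alpha> < (\<bar>a\<bar> powr \<alpha> + \<bar>b\<bar> powr \<alpha>) / 2"
proof -
  have *: "\<bar>(a + b) / 2\<bar> powr \<alpha> < (\<bar>a\<bar> powr \<alpha> + \<bar>b\<bar> powr \<alpha>) / 2" if "a < b" for a b :: real
  proof -
    let ?m = "(a + b) / 2"
    have m: "a < ?m" "?m < b" using that by auto
    obtain z1 where z1: "a < z1" "z1 < ?m" "\<bar>?m\<bar> powr \<alpha> - \<bar>a\<bar> powr \<alpha> = (?m - a) * dpow \<alpha> z1"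
      using MVT2[OF m(1), of "\<lambda>t. \<bar>t\<bar> powr \<alpha>" "dpow \<alpha>"] abs_powr_has_derivative[OF assms(1)] by blast
    obtain z2 where z2: "?m < z2" "z2 < b" "\<bar>b\<bar> powr \<alpha> - \<bar>?m\<bar> powr \<alpha> = (b - ?m) * dpow \<alpha> z2"
      using MVT2[OF m(2), of "\<lambda>t. \<bar>t\<bar> powr \<alpha>" "dpow \<alpha>"] abs_powr_has_derivative[OF assms(1)] by blast
    have "dpow \<alpha> z1 < dpow \<alpha> z2" using z1 z2 by (intro dpow_strict_mono[OF assms(1)]) linarith
    then have "(b - ?m) * dpow \<alpha> z1 < (b - ?m) * dpow \<alpha> z2" using m by (intro mult_strict_left_mono) auto
    moreover have "?m - a = b - ?m" by (simp add: field_simps)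
    ultimately have "\<bar>?m\<bar> powr \<alpha> - \<bar>a\<bar> powr \<alpha> < \<bar>b\<bar> powr \<alpha> - \<bar>?m\<bar> powr \<alpha>" by (simp only: z1(3) z2(3))
    then show ?thesis by (simp add: field_simps)
  qed
  show ?thesis using *[of a b] *[of b a] assms(2) by (cases "a < b") (auto simp: add.commute)
qed

lemma abs_powr_midpoint:
  fixes a b :: real
  assumes "\<alpha> > 1"
  shows "\<bar>(a + b) / 2\<bar> powr \<alpha> \<le> (\<bar>a\<bar> powr \<alpha> + \<bar>b\<bar> powr \<alpha>) / 2"
  using abs_powr_midpoint_strict[OF assms, of a b] by (cases "a = b") auto

lemma powr_add_le:
  fixes a b c :: real
  assumes "\<alpha> > 1" "0 \<le> c" "c \<le> \<bar>a\<bar> + \<bar>b\<bar>"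
  shows "c powr \<alpha> \<le> 2 powr \<alpha> * (\<bar>a\<bar> powr \<alpha> + \<bar>b\<bar> powr \<alpha>)"
proof -
  have "c powr \<alpha> \<le> (2 * max \<bar>a\<bar> \<bar>b\<bar>) powr \<alpha>" using assms by (intro powr_mono2) auto
  also have "\<dots> = 2 powr \<alpha> * max \<bar>a\<bar> \<bar>b\<bar> powr \<alpha>" by (simp add: powr_mult)
  also have "max \<bar>a\<bar> \<bar>b\<bar> powr \<alpha> \<le> \<bar>a\<bar> powr \<alpha> + \<bar>b\<bar> powr \<alpha>" by (auto simp: max_def)
  finally show ?thesis by (simp add: mult_left_mono)
qed

text \<open>All terms are homogeneous of degree \<alpha> in the pair, so it may be normalized to
  \<open>N z = 1\<close>. Where \<open>E z\<close> is below \<open>\<eta>\<close> the first term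
  suffices. The remaining pairs form a compact set that avoids the diagonal; there the convexity gap
  \<open>G\<close> has a positive minimum, and a large multiple of it dominates.\<close>

lemma abs_powr_uniform_convex:
  fixes \<eta> :: real
  assumes "\<alpha> > 1" "\<eta> > 0"
  obtains c where "c \<ge> 0" "\<And>a b::real. \<bar>a - b\<bar> powr \<alpha> \<le> \<eta> * (\<bar>a\<bar> powr \<alpha> + \<bar>b\<bar> powr \<alpha>) +
      c * ((\<bar>a\<bar> powr \<alpha> + \<bar>b\<bar> powr \<alpha>) / 2 - \<bar>(a + b) / 2\<bar> powr \<alpha>)"
proof -
  define N where "N z = \<bar>fst z\<bar> powr \<alpha> + \<bar>snd z\<bar> powr \<alpha>" for z :: "real \<times> real"
  define G where "G z = N z / 2 - \<bar>(fst z + snd z) / 2\<bar> powr \<alpha>" for z :: "real \<times> real"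
  define E where "E z = \<bar>fst z - snd z\<bar> powr \<alpha>" for z :: "real \<times> real"
  have cont: "continuous_on UNIV N" "continuous_on UNIV G" "continuous_on UNIV E"
    unfolding N_def[abs_def] G_def[abs_def] E_def[abs_def] using assms(1)
    by (intro continuous_intros continuous_on_powr'; force)+
  define S where "S = {z. N z = 1} \<inter> {z. \<eta> \<le> E z}"
  have "closed S" unfolding S_def using cont
    by (intro closed_Int closed_Collect_eq closed_Collect_le) auto
  moreover have "S \<subseteq> cbox (-1, -1) (1, 1)"
  proof
    fix z assume "z \<in> S"
    then have n: "\<bar>fst z\<bar> powr \<alpha> + \<bar>snd z\<bar> powr \<alpha> = 1" by (auto simp: S_def N_def)
    have "\<bar>t\<bar> \<le> 1" if "\<bar>t\<bar> powr \<alpha> \<le> 1" for t :: real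
    proof (rule ccontr)
      assume "\<not> \<bar>t\<bar> \<le> 1"
      then have "1 powr \<alpha> < \<bar>t\<bar> powr \<alpha>" using assms(1) by (intro powr_less_mono2) auto
      then show False using that by simp
    qed
    moreover have "\<bar>fst z\<bar> powr \<alpha> \<le> 1" "\<bar>snd z\<bar> powr \<alpha> \<le> 1"
      using n powr_ge_zero[of "\<bar>fst z\<bar>" \<alpha>] powr_ge_zero[of "\<bar>snd z\<bar>" \<alpha>] by linarith+
    ultimately have "\<bar>fst z\<bar> \<le> 1" "\<bar>snd z\<bar> \<le> 1" by blast+
    then show "z \<in> cbox (-1, -1) (1, 1)" by (cases z) (auto simp: mem_box Basis_prod_def)
  qed
  ultimately have cS: "compact S" using compact_cbox closed_Int_compact by (metis inf.absorb_iff1)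
  have Gpos: "G z > 0" if "z \<in> S" for z
  proof -
    have "fst z \<noteq> snd z" using that assms by (auto simp: S_def E_def)
    then show ?thesis using abs_powr_midpoint_strict[OF assms(1)] by (simp add: G_def N_def)
  qed
  have Gnn: "G z \<ge> 0" for z using abs_powr_midpoint[OF assms(1)] by (simp add: G_def N_def)
  have E2: "E z \<le> 2 powr \<alpha> * N z" for z
    unfolding E_def N_def by (rule powr_add_le[OF assms(1)]) auto
  obtain c where c: "c \<ge> 0" "\<And>z. z \<in> S \<Longrightarrow> 2 powr \<alpha> \<le> c * G z"
  proof (cases "S = {}")
    case True
    then show ?thesis using that[of 0] by auto
  next
    case False
    obtain z0 where z0: "z0 \<in> S" "\<And>z. z \<in> S \<Longrightarrow> G z0 \<le> G z"
      using continuous_attains_inf[OF cS False continuous_on_subset[OF cont(2) subset_UNIV]] by blast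
    have p: "G z0 > 0" using Gpos z0 by blast
    show ?thesis
    \<comment> \<open>On \<open>S\<close> one has \<open>N z = 1\<close>, so \<open>E z\<close> is
      at most \<open>2 powr \<alpha>\<close>; the constant is this bound divided by the minimal
      gap.\<close>
    proof (rule that[of "2 powr \<alpha> / G z0"])
      show "2 powr \<alpha> / G z0 \<ge> 0" using p by simp
      fix z assume "z \<in> S"
      then have "2 powr \<alpha> / G z0 * G z0 \<le> 2 powr \<alpha> / G z0 * G z"
        using p z0 by (intro mult_left_mono) auto
      then show "2 powr \<alpha> \<le> 2 powr \<alpha> / G z0 * G z" using p by simp
    qed
  qed
  have main: "E z \<le> \<eta> * N z + c * G z" for z
  proof (cases "N z = 0")
    case True
    then have "E z \<le> 0" using E2[of z] by simp
    also have "\<dots> \<le> c * G z" using c(1) Gnn by (rule mult_nonneg_nonneg)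
    finally show ?thesis using True by simp
  next
    case False
    have Np: "N z > 0" using False by (simp add: N_def less_le)
    \<comment> \<open>Dividing by \<open>l\<close> brings \<open>z\<close> to \<open>N = 1\<close>,
      because \<open>N\<close> is homogeneous of degree \<alpha>.\<close>
    define l where "l = N z powr (1 / \<alpha>)"
    have l: "l > 0" "l powr \<alpha> = N z" using Np assms(1) by (auto simp: l_def powr_powr)
    have pw: "\<bar>t / l\<bar> powr \<alpha> = \<bar>t\<bar> powr \<alpha> / N z" for t
      using l by (simp add: powr_divide)
    define w where "w = (fst z / l, snd z / l)"
    have Nw: "N w = 1" using False by (simp add: w_def N_def pw add_divide_distrib[symmetric] del: abs_divide)
    have Ew: "E w = E z / N z" using pw[of "fst z - snd z"] by (simp add: w_def E_def diff_divide_distrib)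
    have Gw: "G w = G z / N z"
    proof -
      have "(fst z / l + snd z / l) / 2 = ((fst z + snd z) / 2) / l"
        by (simp add: add_divide_distrib mult.commute)
      then have "(fst w + snd w) / 2 = ((fst z + snd z) / 2) / l" by (simp only: w_def fst_conv snd_conv)
      then have "\<bar>(fst w + snd w) / 2\<bar> powr \<alpha> = \<bar>(fst z + snd z) / 2\<bar> powr \<alpha> / N z"
        by (simp only: pw)
      then show ?thesis using False by (simp add: G_def Nw diff_divide_distrib)
    qed
    have "E w \<le> \<eta> + c * G w"
    proof (cases "w \<in> S")
      case True
      then show ?thesis using E2[of w] c(2)[OF True] Nw assms(2) by simp
    next
      case False
      then have "E w < \<eta>" using Nw by (auto simp: S_def)
      then show ?thesis using mult_nonneg_nonneg[OF c(1) Gnn[of w]] by linarith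
    qed
    then show ?thesis using Np by (simp add: Ew Gw field_simps)
  qed
  show thesis
  proof (rule that[OF c(1)])
    fix a b :: real
    show "\<bar>a - b\<bar> powr \<alpha> \<le> \<eta> * (\<bar>a\<bar> powr \<alpha> + \<bar>b\<bar> powr \<alpha>) +
      c * ((\<bar>a\<bar> powr \<alpha> + \<bar>b\<bar> powr \<alpha>) / 2 - \<bar>(a + b) / 2\<bar> powr \<alpha>)"
      using main[of "(a, b)"] by (simp add: E_def N_def G_def)
  qed
qed

text \<open>Young's inequality with unoptimized constants, obtained by comparing
  \<open>\<bar>y\<bar>\<close> with \<open>s * \<bar>t\<bar>\<close>. A small \<open>s\<close>
  permits absorbing the first term.\<close>

lemma powr_young:
  fixes t y s :: real
  assumes "\<alpha> > 1" "s > 0"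
  shows "\<bar>t\<bar> powr (\<alpha> - 1) * \<bar>y\<bar> \<le> s * \<bar>t\<bar> powr \<alpha> + s powr (1 - \<alpha>) * \<bar>y\<bar> powr \<alpha>"
proof (cases "\<bar>y\<bar> \<le> s * \<bar>t\<bar>")
  case True
  have "\<bar>t\<bar> powr (\<alpha> - 1) * \<bar>y\<bar> \<le> \<bar>t\<bar> powr (\<alpha> - 1) * (s * \<bar>t\<bar>)" using True by (intro mult_left_mono) auto
  also have "\<dots> = s * \<bar>t\<bar> powr \<alpha>"
    using powr_mult_base[of "\<bar>t\<bar>" "\<alpha> - 1"] by (simp add: mult.left_commute mult.commute)
  finally have "\<bar>t\<bar> powr (\<alpha> - 1) * \<bar>y\<bar> \<le> s * \<bar>t\<bar> powr \<alpha>" .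
  moreover have "0 \<le> s powr (1 - \<alpha>) * \<bar>y\<bar> powr \<alpha>" by simp
  ultimately show ?thesis by linarith
next
  case False
  have "\<bar>t\<bar> powr (\<alpha> - 1) \<le> (\<bar>y\<bar> / s) powr (\<alpha> - 1)"
    using False assms by (intro powr_mono2) (auto simp: field_simps)
  also have "\<dots> = \<bar>y\<bar> powr (\<alpha> - 1) * s powr (1 - \<alpha>)"
    using assms powr_minus_divide[of s "\<alpha> - 1"] by (simp add: powr_divide)
  finally have "\<bar>t\<bar> powr (\<alpha> - 1) * \<bar>y\<bar> \<le> \<bar>y\<bar> powr (\<alpha> - 1) * s powr (1 - \<alpha>) * \<bar>y\<bar>"
    by (intro mult_right_mono) auto
  also have "\<dots> = s powr (1 - \<alpha>) * \<bar>y\<bar> powr \<alpha>"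
    using powr_mult_base[of "\<bar>y\<bar>" "\<alpha> - 1"] by (simp add: ac_simps)
  finally have "\<bar>t\<bar> powr (\<alpha> - 1) * \<bar>y\<bar> \<le> s powr (1 - \<alpha>) * \<bar>y\<bar> powr \<alpha>" .
  moreover have "0 \<le> s * \<bar>t\<bar> powr \<alpha>" using assms by simp
  ultimately show ?thesis by linarith
qed

text \<open>Young's inequality against the constant 1. On a set of finite measure it bounds the L^1
  norm by the integral of the power, up to an arbitrarily small additive error.\<close>

lemma abs_le_powr:
  fixes t d :: real
  assumes "\<alpha> > 1" "d > 0"
  shows "\<bar>t\<bar> \<le> d + d powr (1 - \<alpha>) * \<bar>t\<bar> powr \<alpha>"
  using powr_young[OF assms, of 1 t] by simp

section \<open>Finite measure spaces: comparison with L^1, and completeness\<close>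

lemma (in finite_measure) integrable_of_powr:
  fixes f :: "'a \<Rightarrow> real"
  assumes "\<alpha> > 1" "f \<in> borel_measurable M" "integrable M (\<lambda>x. \<bar>f x\<bar> powr \<alpha>)"
  shows "integrable M f"
proof (rule Bochner_Integration.integrable_bound)
  show "integrable M (\<lambda>x. 1 + \<bar>f x\<bar> powr \<alpha>)" using assms by auto
  show "AE x in M. norm (f x) \<le> norm (1 + \<bar>f x\<bar> powr \<alpha>)"
    using abs_le_powr[OF assms(1), of 1] by (intro AE_I2) (simp add: add_nonneg_nonneg)
qed (fact assms)

lemma (in finite_measure) integral_abs_le_powr:
  fixes f :: "'a \<Rightarrow> real"
  assumes "\<alpha> > 1" "f \<in> borel_measurable M" "integrable M (\<lambda>x. \<bar>f x\<bar> powr \<alpha>)" "d > 0"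
  shows "(LINT x|M. \<bar>f x\<bar>) \<le> d * measure M (space M) + d powr (1 - \<alpha>) * (LINT x|M. \<bar>f x\<bar> powr \<alpha>)"
proof -
  have "(LINT x|M. \<bar>f x\<bar>) \<le> (LINT x|M. d + d powr (1 - \<alpha>) * \<bar>f x\<bar> powr \<alpha>)"
    using integrable_of_powr[OF assms(1-3)] assms(3) abs_le_powr[OF assms(1,4)] by (intro integral_mono) auto
  also have "\<dots> = d * measure M (space M) + d powr (1 - \<alpha>) * (LINT x|M. \<bar>f x\<bar> powr \<alpha>)"
    using assms(3) by simp
  finally show ?thesis .
qed

lemma (in finite_measure) L1_small_of_powr_small:
  assumes "\<alpha> > 1" "e > 0"
  obtains \<delta> where "\<delta> > 0" "\<And>f::'a \<Rightarrow> real. f \<in> borel_measurable M \<Longrightarrow> integrable M (\<lambda>x. \<bar>f x\<bar> powr \<alpha>) \<Longrightarrow>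
    (LINT x|M. \<bar>f x\<bar> powr \<alpha>) < \<delta> \<Longrightarrow> (LINT x|M. \<bar>f x\<bar>) < e"
proof -
  define m where "m = measure M (space M)"
  \<comment> \<open>Makes the first term of \<open>integral_abs_le_powr\<close> at most
    \<open>e / 2\<close>; the 1 added to \<open>m\<close> covers the case of total mass
    zero.\<close>
  define d where "d = e / (2 * (m + 1))"
  have m: "m \<ge> 0" by (simp add: m_def)
  then have d: "d > 0" using assms(2) by (simp add: d_def)
  have dm: "d * m \<le> e / 2"
  proof -
    have "d * m \<le> d * (m + 1)" using d by (intro mult_left_mono) auto
    also have "\<dots> = e / 2" using m by (simp add: d_def field_simps)
    finally show ?thesis .
  qed
  define D where "D = d powr (1 - \<alpha>)"
  have D: "D > 0" using d by (simp add: D_def)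
  show thesis
  proof (rule that[of "e / (2 * D)"])
    show "e / (2 * D) > 0" using D assms(2) by simp
    fix f :: "'a \<Rightarrow> real" assume f: "f \<in> borel_measurable M" "integrable M (\<lambda>x. \<bar>f x\<bar> powr \<alpha>)"
      and s: "(LINT x|M. \<bar>f x\<bar> powr \<alpha>) < e / (2 * D)"
    have "D * (LINT x|M. \<bar>f x\<bar> powr \<alpha>) < D * (e / (2 * D))" using s D by (rule mult_strict_left_mono)
    also have "\<dots> = e / 2" using D by simp
    finally show "(LINT x|M. \<bar>f x\<bar>) < e"
      using integral_abs_le_powr[OF assms(1) f d] dm unfolding m_def D_def by linarith
  qed
qed

lemma integrable_abs_powr_add:
  fixes f g :: "'a \<Rightarrow> real"
  assumes "\<alpha> > 1" "f \<in> borel_measurable M" "g \<in> borel_measurable M"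
    "integrable M (\<lambda>x. \<bar>f x\<bar> powr \<alpha>)" "integrable M (\<lambda>x. \<bar>g x\<bar> powr \<alpha>)"
  shows "integrable M (\<lambda>x. \<bar>f x + g x\<bar> powr \<alpha>)" "integrable M (\<lambda>x. \<bar>f x - g x\<bar> powr \<alpha>)"
proof -
  have i: "integrable M (\<lambda>x. 2 powr \<alpha> * (\<bar>f x\<bar> powr \<alpha> + \<bar>g x\<bar> powr \<alpha>))" using assms by auto
  show "integrable M (\<lambda>x. \<bar>f x + g x\<bar> powr \<alpha>)" "integrable M (\<lambda>x. \<bar>f x - g x\<bar> powr \<alpha>)"
    using assms(2,3) powr_add_le[OF assms(1)]
    by (auto intro!: Bochner_Integration.integrable_bound[OF i] AE_I2)
qed

text \<open>The argument of Riesz and Fischer. On a finite measure space the sequence is also Cauchy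
  in L^1, so a subsequence converges almost everywhere. Fatou's lemma along that subsequence carries
  the Cauchy estimate over to the limit.\<close>

lemma (in finite_measure) Lpowr_complete:
  fixes f :: "nat \<Rightarrow> 'a \<Rightarrow> real"
  assumes "\<alpha> > 1" and fm: "\<And>n. f n \<in> borel_measurable M" and fi: "\<And>n. integrable M (\<lambda>x. \<bar>f n x\<bar> powr \<alpha>)"
    and cauchy: "\<And>e. e > 0 \<Longrightarrow> \<exists>N. \<forall>i\<ge>N. \<forall>j\<ge>N. (LINT x|M. \<bar>f i x - f j x\<bar> powr \<alpha>) < e"
  obtains g where "g \<in> borel_measurable M" "integrable M (\<lambda>x. \<bar>g x\<bar> powr \<alpha>)"
    "(\<lambda>n. LINT x|M. \<bar>f n x - g x\<bar> powr \<alpha>) \<longlonglongrightarrow> 0"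
proof -
  have dm: "(\<lambda>x. f i x - f j x) \<in> borel_measurable M" for i j using fm by auto
  have di: "integrable M (\<lambda>x. \<bar>f i x - f j x\<bar> powr \<alpha>)" for i j
    by (rule integrable_abs_powr_add(2)[OF assms(1) fm fm fi fi])
  obtain r where r: "strict_mono r" "AE x in M. Cauchy (\<lambda>i. f (r i) x)"
  proof (rule cauchy_L1_AE_cauchy_subseq[of M f])
    show "integrable M (f n)" for n by (rule integrable_of_powr[OF assms(1) fm fi])
    fix e :: real assume "e > 0"
    then obtain \<delta> where d: "\<delta> > 0" "\<And>f. f \<in> borel_measurable M \<Longrightarrow> integrable M (\<lambda>x. \<bar>f x\<bar> powr \<alpha>) \<Longrightarrow>
      (LINT x|M. \<bar>f x\<bar> powr \<alpha>) < \<delta> \<Longrightarrow> (LINT x|M. \<bar>f x\<bar>) < e"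
      using L1_small_of_powr_small[OF assms(1)] by metis
    obtain N where "\<forall>i\<ge>N. \<forall>j\<ge>N. (LINT x|M. \<bar>f i x - f j x\<bar> powr \<alpha>) < \<delta>" using cauchy[OF d(1)] by blast
    then show "\<exists>N. \<forall>i\<ge>N. \<forall>j\<ge>N. (LINT x|M. norm (f i x - f j x)) < e"
      using d(2)[OF dm di] by (intro exI[of _ N]) (simp add: real_norm_def)
  qed
  define g where "g x = lim (\<lambda>i. f (r i) x)" for x
  have gm: "g \<in> borel_measurable M" unfolding g_def[abs_def] using fm by (intro borel_measurable_lim_metric)
  have lim: "AE x in M. (\<lambda>i. f (r i) x) \<longlonglongrightarrow> g x"
    using r(2) by (auto elim!: eventually_mono simp: g_def Cauchy_convergent_iff convergent_LIMSEQ_iff)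
  have key: "(\<integral>\<^sup>+x. ennreal (\<bar>f n x - g x\<bar> powr \<alpha>) \<partial>M) \<le> ennreal e"
    if N: "\<And>i. i \<ge> N \<Longrightarrow> (LINT x|M. \<bar>f n x - f i x\<bar> powr \<alpha>) \<le> e" for n N e
  proof -
    have "(\<integral>\<^sup>+x. ennreal (\<bar>f n x - g x\<bar> powr \<alpha>) \<partial>M) = (\<integral>\<^sup>+x. liminf (\<lambda>i. ennreal (\<bar>f n x - f (r i) x\<bar> powr \<alpha>)) \<partial>M)"
    proof (rule nn_integral_cong_AE)
      show "AE x in M. ennreal (\<bar>f n x - g x\<bar> powr \<alpha>) = liminf (\<lambda>i. ennreal (\<bar>f n x - f (r i) x\<bar> powr \<alpha>))"
        using lim
      proof eventually_elim
        case (elim x)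
        have "(\<lambda>i. \<bar>f n x - f (r i) x\<bar> powr \<alpha>) \<longlonglongrightarrow> \<bar>f n x - g x\<bar> powr \<alpha>"
          using assms(1) by (intro tendsto_powr' tendsto_intros elim) auto
        then have "(\<lambda>i. ennreal (\<bar>f n x - f (r i) x\<bar> powr \<alpha>)) \<longlonglongrightarrow> ennreal (\<bar>f n x - g x\<bar> powr \<alpha>)"
          by (rule tendsto_ennrealI)
        then show ?case by (rule lim_imp_Liminf[OF trivial_limit_sequentially, symmetric])
      qed
    qed
    also have "\<dots> \<le> liminf (\<lambda>i. \<integral>\<^sup>+x. ennreal (\<bar>f n x - f (r i) x\<bar> powr \<alpha>) \<partial>M)"
      using dm by (intro nn_integral_liminf) auto
    also have "\<dots> \<le> limsup (\<lambda>i. \<integral>\<^sup>+x. ennreal (\<bar>f n x - f (r i) x\<bar> powr \<alpha>) \<partial>M)"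
      by (rule Liminf_le_Limsup) simp
    also have "\<dots> \<le> ennreal e"
    proof (rule Limsup_bounded)
      show "\<forall>\<^sub>F i in sequentially. (\<integral>\<^sup>+x. ennreal (\<bar>f n x - f (r i) x\<bar> powr \<alpha>) \<partial>M) \<le> ennreal e"
      proof (rule eventually_sequentiallyI[of N])
        fix i assume "i \<ge> N"
        then have "r i \<ge> N" using seq_suble[OF r(1), of i] by linarith
        have "(\<integral>\<^sup>+x. ennreal (\<bar>f n x - f (r i) x\<bar> powr \<alpha>) \<partial>M) = ennreal (LINT x|M. \<bar>f n x - f (r i) x\<bar> powr \<alpha>)"
          by (rule nn_integral_eq_integral[OF di]) simp
        also have "\<dots> \<le> ennreal e" using N[OF \<open>r i \<ge> N\<close>] by (rule ennreal_leI)
        finally show "(\<integral>\<^sup>+x. ennreal (\<bar>f n x - f (r i) x\<bar> powr \<alpha>) \<partial>M) \<le> ennreal e" .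
      qed
    qed
    finally show ?thesis .
  qed
  have diffm: "(\<lambda>x. \<bar>f n x - g x\<bar> powr \<alpha>) \<in> borel_measurable M" for n using fm gm by auto
  have main: "integrable M (\<lambda>x. \<bar>f n x - g x\<bar> powr \<alpha>) \<and> (LINT x|M. \<bar>f n x - g x\<bar> powr \<alpha>) \<le> e"
    if "e > 0" "\<And>i. i \<ge> N \<Longrightarrow> (LINT x|M. \<bar>f n x - f i x\<bar> powr \<alpha>) \<le> e" for n N e
  proof -
    have k: "(\<integral>\<^sup>+x. ennreal (\<bar>f n x - g x\<bar> powr \<alpha>) \<partial>M) \<le> ennreal e" using key that(2) by blast
    then have i: "integrable M (\<lambda>x. \<bar>f n x - g x\<bar> powr \<alpha>)"
      using diffm by (intro integrableI_nonneg) (auto simp: le_less_trans[OF _ ennreal_less_top])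
    have "ennreal (LINT x|M. \<bar>f n x - g x\<bar> powr \<alpha>) \<le> ennreal e"
      using k nn_integral_eq_integral[OF i] by simp
    then show ?thesis using i that(1) by (simp add: ennreal_le_iff)
  qed
  have ev: "\<exists>N. \<forall>n\<ge>N. integrable M (\<lambda>x. \<bar>f n x - g x\<bar> powr \<alpha>) \<and> (LINT x|M. \<bar>f n x - g x\<bar> powr \<alpha>) \<le> e"
    if e: "e > 0" for e
  proof -
    obtain N where N: "\<forall>i\<ge>N. \<forall>j\<ge>N. (LINT x|M. \<bar>f i x - f j x\<bar> powr \<alpha>) < e" using cauchy[OF e] by blast
    show ?thesis
    proof (intro exI[of _ N] allI impI)
      fix n assume "n \<ge> N"
      then have "\<And>i. i \<ge> N \<Longrightarrow> (LINT x|M. \<bar>f n x - f i x\<bar> powr \<alpha>) \<le> e" using N less_imp_le by blast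
      then show "integrable M (\<lambda>x. \<bar>f n x - g x\<bar> powr \<alpha>) \<and> (LINT x|M. \<bar>f n x - g x\<bar> powr \<alpha>) \<le> e"
        by (rule main[OF e])
    qed
  qed
  obtain N where N: "integrable M (\<lambda>x. \<bar>f N x - g x\<bar> powr \<alpha>)" using ev[of 1] by auto
  \<comment> \<open>The limit \<open>g\<close> is recovered as a difference of two functions whose
    powers are integrable.\<close>
  have "integrable M (\<lambda>x. \<bar>f N x - (f N x - g x)\<bar> powr \<alpha>)"
    using fm gm by (intro integrable_abs_powr_add(2)[OF assms(1) fm _ fi N]) auto
  then have gi: "integrable M (\<lambda>x. \<bar>g x\<bar> powr \<alpha>)" by simp
  have "(\<lambda>n. LINT x|M. \<bar>f n x - g x\<bar> powr \<alpha>) \<longlonglongrightarrow> 0"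
  proof (rule LIMSEQ_I)
    fix e :: real assume "e > 0"
    then obtain N where "\<forall>n\<ge>N. (LINT x|M. \<bar>f n x - g x\<bar> powr \<alpha>) \<le> e / 2" using ev[of "e / 2"] by auto
    then show "\<exists>no. \<forall>n\<ge>no. norm ((LINT x|M. \<bar>f n x - g x\<bar> powr \<alpha>) - 0) < e"
      using \<open>e > 0\<close> by (intro exI[of _ N]) (auto simp: abs_of_nonneg)
  qed
  then show thesis using that gm gi by blast
qed

text \<open>Integrate \<open>X\<^sub>1 (x\<^sub>1 \<bar>\<phi>\<bar> powr \<alpha>)\<close>, whose integral vanishes, and absorb by Young's inequality.\<close>

lemma poincare:
  fixes A :: "'n::finite heis set"
  assumes "\<alpha> > 1" "open A" "bounded A"
  obtains C where "C \<ge> 0" "\<And>\<phi>. \<phi> \<in> test_functions A \<Longrightarrow>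
    (LINT x|lebesgue_on A. \<bar>\<phi> x\<bar> powr \<alpha>) \<le> C * (LINT x|lebesgue_on A. \<bar>Xd (Inl j) \<phi> x\<bar> powr \<alpha>)"
proof -
  define l where "l x = fst x $ j" for x :: "'n heis"
  have ll: "linear l" unfolding l_def by (auto intro!: linearI)
  obtain R where R: "R > 0" "\<And>x. x \<in> A \<Longrightarrow> norm x \<le> R"
    using assms(3) unfolding bounded_pos by blast
  have lR: "\<bar>l x\<bar> \<le> R" if "x \<in> A" for x
  proof -
    have "\<bar>l x\<bar> \<le> norm (fst x)" unfolding l_def by (rule component_le_norm_cart)
    also have "\<dots> \<le> norm x" using norm_fst_le[of "fst x" "snd x"] by simp
    finally show ?thesis using R(2)[OF that] by linarith
  qed
  \<comment> \<open>With this \<open>s\<close>, Young's inequality leaves one half of the integral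
    of \<open>w\<close> on the right, where it can be absorbed; the factor 2 in \<open>C\<close>
    undoes that half.\<close>
  define s where "s = 1 / (2 * R * \<alpha>)"
  have s: "s > 0" "R * \<alpha> * s = 1 / 2" using R(1) assms(1) by (auto simp: s_def)
  define C where "C = 2 * (R * \<alpha> * s powr (1 - \<alpha>))"
  show thesis
  proof (rule that)
    show "C \<ge> 0" using R(1) assms(1) by (simp add: C_def)
    fix \<phi> assume phi: "\<phi> \<in> test_functions A"
    obtain K where K: "compact K" "K \<subseteq> A" "\<And>x. x \<notin> K \<Longrightarrow> \<phi> x = 0"
      using test_function_support[OF phi] by blast
    have C1: "C_k (Suc 0) \<phi>" by (rule test_function_C1[OF phi])
    have pc: "continuous_on UNIV \<phi>" by (rule C1_continuous[OF C1])
    let ?X = "Xd (Inl j) \<phi>"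
    have Xc: "continuous_on UNIV ?X" by (rule continuous_Xd[OF C1])
    have Xz: "x \<notin> K \<Longrightarrow> ?X x = 0" for x by (rule Xd_zero_outside[OF K(3) compact_imp_closed[OF K(1)]])
    define w where "w x = \<bar>\<phi> x\<bar> powr \<alpha>" for x
    have wd: "(w has_derivative (\<lambda>h. frechet_derivative \<phi> (at x) h * dpow \<alpha> (\<phi> x))) (at x)" for x
    proof -
      have "((\<lambda>t. \<bar>t\<bar> powr \<alpha>) has_derivative (\<lambda>h. h * dpow \<alpha> (\<phi> x))) (at (\<phi> x))"
        using abs_powr_has_derivative[OF assms(1), of "\<phi> x"] unfolding has_field_derivative_def
        by (rule has_derivative_eq_rhs) (simp add: fun_eq_iff)
      from has_derivative_compose[OF C1_frechet[OF C1] this] show ?thesis by (simp add: w_def[abs_def])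
    qed
    \<comment> \<open>For \<alpha> > 1 the function \<open>dpow \<alpha>\<close> is continuous at 0,
      so \<open>w\<close> is continuously differentiable even where \<open>\<phi>\<close>
      vanishes.\<close>
    have w1: "C_k (Suc 0) w"
    proof (rule C_k_Suc_intro[OF wd])
      have "continuous_on UNIV (\<lambda>x. dpow \<alpha> (\<phi> x))"
        by (rule continuous_on_compose2[OF continuous_dpow[OF assms(1)] pc]) simp
      then show "C_k 0 (\<lambda>x. frechet_derivative \<phi> (at x) b * dpow \<alpha> (\<phi> x))" for b
        unfolding C_k.simps by (intro continuous_on_mult C1_continuous_frechet[OF C1] continuous_on_const)
    qed
    have wc: "continuous_on UNIV w" by (rule C1_continuous[OF w1])
    have wz: "x \<notin> K \<Longrightarrow> w x = 0" for x using K(3) by (simp add: w_def)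
    have Xw: "Xd (Inl j) w x = ?X x * dpow \<alpha> (\<phi> x)" for x
      by (subst Xd_eqI[OF wd]) (simp add: Xd_def)
    have "l (Xfield (Inl j) x) = 1" for x by (cases x) (simp add: l_def)
    then have Xl: "Xd (Inl j) l x = 1" for x using Xd_linear[OF ll] by metis
    have l1: "C_k (Suc 0) l" by (rule C_k_linear[OF ll])
    have lc: "continuous_on UNIV l" by (rule C1_continuous[OF l1])
    have Xwc: "continuous_on UNIV (Xd (Inl j) w)" by (rule continuous_Xd[OF w1])
    have 0: "(LINT x|lborel. Xd (Inl j) (\<lambda>x. l x * w x) x) = 0"
      using wz by (intro integral_Xd_zero[OF C_k_mult[OF l1 w1] K(1)]) simp
    have pw: "- (l x * Xd (Inl j) w x) \<le> 1 / 2 * w x + C / 2 * \<bar>?X x\<bar> powr \<alpha>" for x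
    proof (cases "x \<in> K")
      case True
      have "- (l x * Xd (Inl j) w x) \<le> \<bar>l x\<bar> * (\<bar>?X x\<bar> * (\<alpha> * \<bar>\<phi> x\<bar> powr (\<alpha> - 1)))"
        unfolding Xw abs_dpow[OF assms(1), symmetric] abs_mult[symmetric] by linarith
      also have "\<dots> \<le> R * (\<bar>?X x\<bar> * (\<alpha> * \<bar>\<phi> x\<bar> powr (\<alpha> - 1)))"
        using lR[of x] True K(2) assms(1) by (intro mult_right_mono) auto
      also have "\<dots> = R * \<alpha> * (\<bar>\<phi> x\<bar> powr (\<alpha> - 1) * \<bar>?X x\<bar>)" by (simp add: ac_simps)
      also have "\<dots> \<le> R * \<alpha> * (s * \<bar>\<phi> x\<bar> powr \<alpha> + s powr (1 - \<alpha>) * \<bar>?X x\<bar> powr \<alpha>)"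
        using R(1) assms(1) by (intro mult_left_mono powr_young[OF assms(1) s(1)]) auto
      also have "\<dots> = (R * \<alpha> * s) * w x + C / 2 * \<bar>?X x\<bar> powr \<alpha>"
        by (simp add: C_def w_def algebra_simps)
      finally show ?thesis using s(2) by simp
    next
      case False
      then have "Xd (Inl j) w x = 0" using Xz by (simp add: Xw)
      then show ?thesis using False wz Xz by simp
    qed
    have Xpc: "continuous_on UNIV (\<lambda>x. \<bar>?X x\<bar> powr \<alpha>)"
      using assms(1) by (intro continuous_on_powr' continuous_on_rabs Xc continuous_on_const) auto
    have iw: "integrable lborel w" by (rule integrable_compact_support[OF wc K(1) wz])
    have iX: "integrable lborel (\<lambda>x. \<bar>?X x\<bar> powr \<alpha>)"
      using Xz by (intro integrable_compact_support[OF Xpc K(1)]) simp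
    have il: "integrable lborel (\<lambda>x. l x * Xd (Inl j) w x)"
      using Xz by (intro integrable_compact_support[OF continuous_on_mult[OF lc Xwc] K(1)]) (simp add: Xw)
    have "(LINT x|lborel. l x * Xd (Inl j) w x) + (LINT x|lborel. w x) = 0"
      using 0 il iw by (simp add: Xd_mult[OF l1 w1] Xl)
    moreover have "- (LINT x|lborel. l x * Xd (Inl j) w x) \<le> (LINT x|lborel. 1 / 2 * w x + C / 2 * \<bar>?X x\<bar> powr \<alpha>)"
      unfolding integral_minus[symmetric] using il iw iX pw by (intro integral_mono) auto
    moreover have "(LINT x|lborel. 1 / 2 * w x + C / 2 * \<bar>?X x\<bar> powr \<alpha>) =
        1 / 2 * (LINT x|lborel. w x) + C / 2 * (LINT x|lborel. \<bar>?X x\<bar> powr \<alpha>)"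
      using iw iX by simp
    ultimately have "(LINT x|lborel. w x) \<le> C * (LINT x|lborel. \<bar>?X x\<bar> powr \<alpha>)" by simp
    moreover have "(LINT x|lebesgue_on A. w x) = (LINT x|lborel. w x)"
      by (rule integral_on_compact_support(2)[OF wc K(1) wz K(2) assms(2)])
    moreover have "(LINT x|lebesgue_on A. \<bar>?X x\<bar> powr \<alpha>) = (LINT x|lborel. \<bar>?X x\<bar> powr \<alpha>)"
      using Xz by (intro integral_on_compact_support(2)[OF Xpc K(1) _ K(2) assms(2)]) simp
    ultimately show "(LINT x|lebesgue_on A. \<bar>\<phi> x\<bar> powr \<alpha>) \<le> C * (LINT x|lebesgue_on A. \<bar>?X x\<bar> powr \<alpha>)"
      unfolding w_def by simp
  qed
qed

subsection \<open>Horizontal Sobolev spaces\<close>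

text \<open>Gradients are representatives picked by \<open>SOME\<close> and thus known only up to
  null sets. Completeness of Lebesgue measure makes measurability independent of the
  representative.\<close>

lemma borel_measurable_lebesgue_on_AE:
  fixes f :: "'a::euclidean_space \<Rightarrow> 'b::euclidean_space"
  assumes B: "B \<in> sets lebesgue" and f: "f \<in> borel_measurable (lebesgue_on B)" and ae: "AE x in lebesgue_on B. f x = g x"
  shows "g \<in> borel_measurable (lebesgue_on B)"
proof -
  have Bs: "B \<inter> space lebesgue \<in> sets lebesgue" using B by simp
  have "(\<lambda>x. indicator B x *\<^sub>R f x) \<in> borel_measurable lebesgue"
    using f borel_measurable_restrict_space_iff[OF Bs] by blast
  moreover have "AE x in lebesgue. indicator B x *\<^sub>R f x = indicator B x *\<^sub>R g x"
    using ae unfolding AE_restrict_space_iff[OF Bs] by (auto elim!: eventually_mono simp: indicator_def)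
  ultimately have "(\<lambda>x. indicator B x *\<^sub>R g x) \<in> borel_measurable lebesgue" by (rule borel_measurable_AE)
  then show ?thesis using borel_measurable_restrict_space_iff[OF Bs] by blast
qed

lemma finite_measure_lebesgue_on:
  fixes B :: "'a::euclidean_space set"
  assumes "open B" "bounded B" shows "finite_measure (lebesgue_on B)"
proof (rule finite_measureI)
  have "emeasure lebesgue B \<noteq> \<infinity>" using emeasure_bounded_finite[OF assms(2)] assms(1) by simp
  then show "emeasure (lebesgue_on B) (space (lebesgue_on B)) \<noteq> \<infinity>"
    using assms(1) by (simp add: emeasure_restrict_space)
qed

lemma Lp_comb:
  assumes "\<alpha> > 1" "u \<in> Lp \<alpha> B" "v \<in> Lp \<alpha> B"
  shows "(\<lambda>x. u x + c * v x) \<in> Lp \<alpha> B"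
proof -
  have um: "u \<in> borel_measurable (lebesgue_on B)" "v \<in> borel_measurable (lebesgue_on B)" using assms by (auto simp: Lp_def)
  have "integrable (lebesgue_on B) (\<lambda>x. \<bar>c * v x\<bar> powr \<alpha>)"
    using assms(3) by (simp add: Lp_def abs_mult powr_mult)
  then have "integrable (lebesgue_on B) (\<lambda>x. \<bar>u x + c * v x\<bar> powr \<alpha>)"
    using assms um by (intro integrable_abs_powr_add(1)) (auto simp: Lp_def)
  then show ?thesis using um by (simp add: Lp_def)
qed

lemma Lp_diff: "\<alpha> > 1 \<Longrightarrow> u \<in> Lp \<alpha> B \<Longrightarrow> v \<in> Lp \<alpha> B \<Longrightarrow> (\<lambda>x. u x - v x) \<in> Lp \<alpha> B"
  using Lp_comb[of \<alpha> u B v "-1"] by simp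

lemma continuous_borel_lebesgue_on: "continuous_on UNIV h \<Longrightarrow> h \<in> borel_measurable (lebesgue_on B)"
  by (intro measurable_restrict_space1 measurable_completion) (simp add: borel_measurable_continuous_onI)

lemma continuous_Lp:
  fixes h :: "'a::euclidean_space \<Rightarrow> real"
  assumes "\<alpha> > 1" "open B" "bounded B" "continuous_on UNIV h"
  shows "h \<in> Lp \<alpha> B"
proof -
  interpret finite_measure "lebesgue_on B" by (rule finite_measure_lebesgue_on[OF assms(2,3)])
  have hm: "h \<in> borel_measurable (lebesgue_on B)" by (rule continuous_borel_lebesgue_on[OF assms(4)])
  have "bounded (h ` closure B)"
    using assms(3) by (intro compact_imp_bounded compact_continuous_image continuous_on_subset[OF assms(4)]) simp_all
  then obtain L where L: "\<And>y. y \<in> h ` closure B \<Longrightarrow> norm y \<le> L" unfolding bounded_iff by blast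
  have "integrable (lebesgue_on B) (\<lambda>x. \<bar>h x\<bar> powr \<alpha>)"
  proof (rule integrable_const_bound[of _ "L powr \<alpha>"])
    have "\<bar>h x\<bar> powr \<alpha> \<le> L powr \<alpha>" if "x \<in> B" for x
      using L[of "h x"] that closure_subset[of B] assms(1) by (intro powr_mono2) auto
    then show "AE x in lebesgue_on B. norm (\<bar>h x\<bar> powr \<alpha>) \<le> L powr \<alpha>"
      using assms(2) by (intro AE_I2) auto
  qed (use hm in auto)
  then show ?thesis using hm by (simp add: Lp_def)
qed

lemma Lp_locally_integrable:
  assumes "\<alpha> > 1" "open B" "bounded B" "u \<in> Lp \<alpha> B"
  shows "locally_integrable B u"
  unfolding locally_integrable_def
proof (intro allI impI)
  interpret finite_measure "lebesgue_on B" by (rule finite_measure_lebesgue_on[OF assms(2,3)])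
  fix K assume K: "compact K \<and> K \<subseteq> B"
  have "integrable (lebesgue_on B) u"
    using assms(4) unfolding Lp_def by (rule_tac integrable_of_powr[OF assms(1)]; simp)
  then have "integrable lebesgue (\<lambda>x. indicator B x *\<^sub>R u x)"
    using assms(2) by (subst (asm) integrable_restrict_space) auto
  moreover have "K \<in> sets lebesgue" using K by (simp add: lmeasurable_compact fmeasurableD)
  ultimately have "integrable lebesgue (\<lambda>x. indicator K x *\<^sub>R (indicator B x *\<^sub>R u x))"
    using integrable_mult_indicator by blast
  moreover have "indicator K x *\<^sub>R (indicator B x *\<^sub>R u x) = indicator K x *\<^sub>R u x" for x
    using K by (auto simp: indicator_def)
  ultimately show "set_integrable lebesgue K u" by (simp only: set_integrable_def)
qed

lemma hgrad_component:
  assumes "open B" "weak_X B i u v"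
  shows "weak_X B i u (\<lambda>x. hgrad B u x $ i)" "AE x in lebesgue_on B. hgrad B u x $ i = v x"
proof -
  have "weak_X B i u (SOME v. weak_X B i u v)" by (rule someI[of "weak_X B i u", OF assms(2)])
  then show *: "weak_X B i u (\<lambda>x. hgrad B u x $ i)" by (simp add: hgrad_def)
  show "AE x in lebesgue_on B. hgrad B u x $ i = v x" by (rule weak_X_unique[OF assms(1) * assms(2)])
qed

text \<open>The representative chosen by \<open>hgrad\<close> may differ from \<open>v\<close>, but
  only on a null set, so it inherits measurability and integrability.\<close>

lemma hgrad_Lp:
  assumes "open B" "weak_X B i u v" "v \<in> Lp \<alpha> B"
  shows "(\<lambda>x. hgrad B u x $ i) \<in> Lp \<alpha> B"
proof -
  have ae: "AE x in lebesgue_on B. v x = hgrad B u x $ i"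
    using hgrad_component(2)[OF assms(1,2)] by (auto elim!: eventually_mono)
  have vm: "v \<in> borel_measurable (lebesgue_on B)" using assms(3) by (simp add: Lp_def)
  have m: "(\<lambda>x. hgrad B u x $ i) \<in> borel_measurable (lebesgue_on B)"
    using assms(1) by (intro borel_measurable_lebesgue_on_AE[OF _ vm ae]) simp
  moreover have "integrable (lebesgue_on B) (\<lambda>x. \<bar>hgrad B u x $ i\<bar> powr \<alpha>)"
    using assms(3) m ae by (subst integrable_cong_AE[of _ _ "\<lambda>x. \<bar>v x\<bar> powr \<alpha>"]) (auto simp: Lp_def elim!: eventually_mono)
  ultimately show ?thesis by (simp add: Lp_def)
qed

text \<open>Treats a function and its horizontal derivatives alike, so that the integrals in the
  Sobolev norm form a single sum over the option type.\<close>

fun Dop :: "('n::finite + 'n) option \<Rightarrow> ('n heis \<Rightarrow> real) \<Rightarrow> 'n heis \<Rightarrow> real" where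
  "Dop None \<phi> = \<phi>"
| "Dop (Some i) \<phi> = Xd i \<phi>"

lemma continuous_Dop: "C_k (Suc 0) \<phi> \<Longrightarrow> continuous_on UNIV (Dop j \<phi>)"
  by (cases j) (auto intro: C1_continuous continuous_Xd)

lemma Dop_add: "C_k (Suc 0) \<phi> \<Longrightarrow> C_k (Suc 0) \<psi> \<Longrightarrow> Dop j (\<lambda>x. \<phi> x + \<psi> x) x = Dop j \<phi> x + Dop j \<psi> x"
  by (cases j) (auto simp: Xd_add)

lemma Dop_cmult: "C_k (Suc 0) \<phi> \<Longrightarrow> Dop j (\<lambda>x. c * \<phi> x) x = c * Dop j \<phi> x"
  by (cases j) (auto simp: Xd_cmult)

lemma Dop_Lp:
  assumes "\<alpha> > 1" "open B" "bounded B" "\<phi> \<in> test_functions B"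
  shows "Dop j \<phi> \<in> Lp \<alpha> B"
  by (rule continuous_Lp[OF assms(1-3) continuous_Dop[OF test_function_C1[OF assms(4)]]])

text \<open>On a bounded set convergence in the power \<alpha> implies convergence in L^1, and a
  test function and its derivatives are bounded. So both sides of the integration by parts for the
  smooth \<open>h n\<close> pass to the limit.\<close>

lemma weak_X_limit:
  fixes h :: "nat \<Rightarrow> 'n::finite heis \<Rightarrow> real"
  assumes a: "\<alpha> > 1" and B: "open B" "bounded B" and h: "\<And>n. h n \<in> test_functions B"
    and L: "u \<in> Lp \<alpha> B" "v \<in> Lp \<alpha> B"
    and lim: "(\<lambda>n. LINT x|lebesgue_on B. \<bar>h n x - u x\<bar> powr \<alpha>) \<longlonglongrightarrow> 0"
      "(\<lambda>n. LINT x|lebesgue_on B. \<bar>Xd i (h n) x - v x\<bar> powr \<alpha>) \<longlonglongrightarrow> 0"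
  shows "weak_X B i u v"
  unfolding weak_X_def
proof (intro conjI ballI)
  interpret finite_measure "lebesgue_on B" by (rule finite_measure_lebesgue_on[OF B])
  show "locally_integrable B u" "locally_integrable B v" using Lp_locally_integrable[OF a B] L by auto
  fix \<phi> assume phi: "\<phi> \<in> test_functions B"
  have C1: "C_k (Suc 0) \<phi>" by (rule test_function_C1[OF phi])
  obtain K where K: "compact K" "K \<subseteq> B" "\<And>x. x \<notin> K \<Longrightarrow> \<phi> x = 0"
    using test_function_support[OF phi] by blast
  have Xz: "x \<notin> K \<Longrightarrow> Xd i \<phi> x = 0" for x by (rule Xd_zero_outside[OF K(3) compact_imp_closed[OF K(1)]])
  have conv: "(\<lambda>n. LINT x|lebesgue_on B. f n x * k x) \<longlonglongrightarrow> (LINT x|lebesgue_on B. g x * k x)"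
    if f: "\<And>n. f n \<in> Lp \<alpha> B" and g: "g \<in> Lp \<alpha> B" and l: "(\<lambda>n. LINT x|lebesgue_on B. \<bar>f n x - g x\<bar> powr \<alpha>) \<longlonglongrightarrow> 0"
      and k: "continuous_on UNIV k" "\<And>x. x \<notin> K \<Longrightarrow> k x = 0" for f :: "nat \<Rightarrow> 'n heis \<Rightarrow> real" and g k
  proof -
    obtain M where M: "M \<ge> 0" "\<And>x. \<bar>k x\<bar> \<le> M" using compact_support_bounded[OF k(1) K(1) k(2)] by blast
    have d: "(\<lambda>x. f n x - g x) \<in> Lp \<alpha> B" for n by (rule Lp_diff[OF a f g])
    have di: "integrable (lebesgue_on B) (\<lambda>x. f n x - g x)" for n
      using d[of n] unfolding Lp_def by (rule_tac integrable_of_powr[OF a]; simp)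
    have i: "integrable (lebesgue_on B) (\<lambda>x. w x * k x)" if "w \<in> Lp \<alpha> B" for w
      by (rule locally_integrable_mult(1)[OF Lp_locally_integrable[OF a B that] k(1) K(1,2) k(2) B(1)])
    have bound: "\<bar>(LINT x|lebesgue_on B. f n x * k x) - (LINT x|lebesgue_on B. g x * k x)\<bar>
        \<le> M * (LINT x|lebesgue_on B. \<bar>f n x - g x\<bar>)" for n
    proof -
      have "(LINT x|lebesgue_on B. f n x * k x) - (LINT x|lebesgue_on B. g x * k x) =
          (LINT x|lebesgue_on B. (f n x - g x) * k x)"
        using i[OF f] i[OF g] by (simp add: left_diff_distrib)
      also have "\<bar>\<dots>\<bar> \<le> (LINT x|lebesgue_on B. \<bar>(f n x - g x) * k x\<bar>)" by (rule integral_abs_bound)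
      also have "\<dots> \<le> (LINT x|lebesgue_on B. M * \<bar>f n x - g x\<bar>)"
      proof (rule integral_mono)
        show "integrable (lebesgue_on B) (\<lambda>x. \<bar>(f n x - g x) * k x\<bar>)" by (rule integrable_abs[OF i[OF d]])
        show "integrable (lebesgue_on B) (\<lambda>x. M * \<bar>f n x - g x\<bar>)" using di by simp
        show "\<bar>(f n x - g x) * k x\<bar> \<le> M * \<bar>f n x - g x\<bar>" for x
          using M(2)[of x] by (simp add: abs_mult mult.commute mult_right_mono)
      qed
      finally show ?thesis by simp
    qed
    have "(\<lambda>n. LINT x|lebesgue_on B. \<bar>f n x - g x\<bar>) \<longlonglongrightarrow> 0"
    proof (rule LIMSEQ_I)
      fix e :: real assume "e > 0"
      then obtain \<delta> where \<delta>: "\<delta> > 0" "\<And>f::'n heis \<Rightarrow> real. f \<in> borel_measurable (lebesgue_on B) \<Longrightarrow>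
          integrable (lebesgue_on B) (\<lambda>x. \<bar>f x\<bar> powr \<alpha>) \<Longrightarrow>
          (LINT x|lebesgue_on B. \<bar>f x\<bar> powr \<alpha>) < \<delta> \<Longrightarrow> (LINT x|lebesgue_on B. \<bar>f x\<bar>) < e"
        using L1_small_of_powr_small[OF a] by metis
      obtain N where N: "\<And>n. n \<ge> N \<Longrightarrow> norm ((LINT x|lebesgue_on B. \<bar>f n x - g x\<bar> powr \<alpha>) - 0) < \<delta>"
        using LIMSEQ_D[OF l \<delta>(1)] by blast
      have "norm ((LINT x|lebesgue_on B. \<bar>f n x - g x\<bar>) - 0) < e" if "n \<ge> N" for n
        using \<delta>(2)[of "\<lambda>x. f n x - g x"] d[of n] N[OF that] by (simp add: Lp_def)
      then show "\<exists>no. \<forall>n\<ge>no. norm ((LINT x|lebesgue_on B. \<bar>f n x - g x\<bar>) - 0) < e" by blast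
    qed
    from tendsto_mult_right_zero[OF this, of M]
    have "(\<lambda>n. (LINT x|lebesgue_on B. f n x * k x) - (LINT x|lebesgue_on B. g x * k x)) \<longlonglongrightarrow> 0"
      by (rule Lim_null_comparison[rotated]) (use bound in \<open>auto intro: always_eventually\<close>)
    then show ?thesis by (simp add: LIM_zero_iff)
  qed
  have 1: "(\<lambda>n. LINT x|lebesgue_on B. h n x * Xd i \<phi> x) \<longlonglongrightarrow> (LINT x|lebesgue_on B. u x * Xd i \<phi> x)"
    using Dop_Lp[OF a B h, where j = None] by (intro conv L lim continuous_Xd[OF C1] Xz) simp_all
  have 2: "(\<lambda>n. LINT x|lebesgue_on B. Xd i (h n) x * \<phi> x) \<longlonglongrightarrow> (LINT x|lebesgue_on B. v x * \<phi> x)"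
    using Dop_Lp[OF a B h, where j = "Some i"] by (intro conv L lim C1_continuous[OF C1] K(3)) simp_all
  have "(LINT x|lebesgue_on B. h n x * Xd i \<phi> x) = - (LINT x|lebesgue_on B. Xd i (h n) x * \<phi> x)" for n
    using weak_XD[OF weak_X_smooth[OF B(1) test_function_C1[OF h]] phi] by (simp add: Xd_def)
  with 1 have "(\<lambda>n. - (LINT x|lebesgue_on B. Xd i (h n) x * \<phi> x)) \<longlonglongrightarrow> (LINT x|lebesgue_on B. u x * Xd i \<phi> x)"
    by simp
  then have "(LINT x|lebesgue_on B. u x * Xd i \<phi> x) = - (LINT x|lebesgue_on B. v x * \<phi> x)"
    using tendsto_minus[OF 2] LIMSEQ_unique by blast
  then show "(LINT x|lebesgue_on B. u x * frechet_derivative \<phi> (at x) (Xfield i x)) = - (LINT x|lebesgue_on B. v x * \<phi> x)"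
    by (simp add: Xd_def)
qed

lemma hgrad_diff_AE:
  assumes "open B" "weak_X B i u v" "C_k (Suc 0) \<phi>"
  shows "AE x in lebesgue_on B. hgrad B (\<lambda>x. u x - \<phi> x) x $ i = v x - Xd i \<phi> x"
  using hgrad_component(2)[OF assms(1) weak_X_linear_comb[OF assms(1,2) weak_X_smooth[OF assms(1,3)], of "-1"]] by simp

text \<open>Replaces the gradient representative hidden in the norm by concrete functions, for which
  convergence can be checked.\<close>

lemma W1_norm_diff:
  assumes "\<alpha> > 1" "open B" "bounded B" "u \<in> Lp \<alpha> B"
    and v: "\<And>i. weak_X B i u (v i)" "\<And>i. v i \<in> Lp \<alpha> B" and phi: "\<phi> \<in> test_functions B"
  shows "W1_norm \<alpha> B (\<lambda>x. u x - \<phi> x) = ((LINT x|lebesgue_on B. \<bar>u x - \<phi> x\<bar> powr \<alpha>) +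
    (\<Sum>i\<in>UNIV. LINT x|lebesgue_on B. \<bar>v i x - Xd i \<phi> x\<bar> powr \<alpha>)) powr (1 / \<alpha>)"
proof -
  have C1: "C_k (Suc 0) \<phi>" by (rule test_function_C1[OF phi])
  have "(LINT x|lebesgue_on B. \<bar>hgrad B (\<lambda>x. u x - \<phi> x) x $ i\<bar> powr \<alpha>) = (LINT x|lebesgue_on B. \<bar>v i x - Xd i \<phi> x\<bar> powr \<alpha>)" for i
  proof (rule integral_cong_AE)
    have d: "(\<lambda>x. v i x - Xd i \<phi> x) \<in> Lp \<alpha> B"
      using Lp_diff[OF assms(1) v(2) Dop_Lp[OF assms(1-3) phi, of "Some i"]] by simp
    have w: "weak_X B i (\<lambda>x. u x - \<phi> x) (\<lambda>x. v i x - Xd i \<phi> x)"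
      using weak_X_linear_comb[OF assms(2) v(1) weak_X_smooth[OF assms(2) C1], of i "-1"] by simp
    show "(\<lambda>x. \<bar>v i x - Xd i \<phi> x\<bar> powr \<alpha>) \<in> borel_measurable (lebesgue_on B)" using d by (auto simp: Lp_def)
    show "(\<lambda>x. \<bar>hgrad B (\<lambda>x. u x - \<phi> x) x $ i\<bar> powr \<alpha>) \<in> borel_measurable (lebesgue_on B)"
      using hgrad_Lp[OF assms(2) w d] by (auto simp: Lp_def)
    show "AE x in lebesgue_on B. \<bar>hgrad B (\<lambda>x. u x - \<phi> x) x $ i\<bar> powr \<alpha> = \<bar>v i x - Xd i \<phi> x\<bar> powr \<alpha>"
      using hgrad_diff_AE[OF assms(2) v(1) C1, of i] by (auto elim!: eventually_mono)
  qed
  then show ?thesis by (simp add: W1_norm_def)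
qed

lemma W1_0_limit:
  fixes h :: "nat \<Rightarrow> 'n::finite heis \<Rightarrow> real"
  assumes a: "\<alpha> > 1" and B: "open B" "bounded B" and h: "\<And>n. h n \<in> test_functions B"
    and L: "u \<in> Lp \<alpha> B" "\<And>i. v i \<in> Lp \<alpha> B"
    and lim: "(\<lambda>n. LINT x|lebesgue_on B. \<bar>h n x - u x\<bar> powr \<alpha>) \<longlonglongrightarrow> 0"
      "\<And>i. (\<lambda>n. LINT x|lebesgue_on B. \<bar>Xd i (h n) x - v i x\<bar> powr \<alpha>) \<longlonglongrightarrow> 0"
  shows "u \<in> W1_0 \<alpha> B" "weak_X B i u (v i)"
proof -
  show w: "weak_X B i u (v i)" for i by (rule weak_X_limit[OF a B h L lim])
  have W: "u \<in> W1 \<alpha> B" using L w by (auto simp: W1_def)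
  have "\<exists>\<phi>\<in>test_functions B. W1_norm \<alpha> B (\<lambda>x. u x - \<phi> x) < e" if e: "e > 0" for e
  proof -
    have "(\<lambda>n. ((LINT x|lebesgue_on B. \<bar>h n x - u x\<bar> powr \<alpha>) +
        (\<Sum>i\<in>UNIV. LINT x|lebesgue_on B. \<bar>Xd i (h n) x - v i x\<bar> powr \<alpha>)) powr (1 / \<alpha>)) \<longlonglongrightarrow>
        (0 + (\<Sum>i\<in>(UNIV :: ('n + 'n) set). 0)) powr (1 / \<alpha>)"
      using a by (intro tendsto_powr' tendsto_add tendsto_sum lim tendsto_const)
        (auto intro!: always_eventually add_nonneg_nonneg sum_nonneg)
    then have "(\<lambda>n. W1_norm \<alpha> B (\<lambda>x. u x - h n x)) \<longlonglongrightarrow> 0"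
      using W1_norm_diff[OF a B L(1) w L(2) h] by (simp add: abs_minus_commute)
    then obtain n where "norm (W1_norm \<alpha> B (\<lambda>x. u x - h n x) - 0) < e" using LIMSEQ_D[OF _ e] by blast
    then show ?thesis using h by (intro bexI[of _ "h n"]) auto
  qed
  then show "u \<in> W1_0 \<alpha> B" using W by (simp add: W1_0_def)
qed

lemma W1_0_approx:
  assumes a: "\<alpha> > 1" and B: "open B" "bounded B" and u: "u \<in> W1_0 \<alpha> B" and e: "e > 0"
  obtains \<phi> where "\<phi> \<in> test_functions B" "\<And>i. (LINT x|lebesgue_on B. \<bar>hgrad B u x $ i - Xd i \<phi> x\<bar> powr \<alpha>) < e"
proof -
  have uL: "u \<in> Lp \<alpha> B" and ex: "\<And>i. \<exists>v\<in>Lp \<alpha> B. weak_X B i u v" using u by (auto simp: W1_0_def W1_def)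
  have w: "weak_X B i u (\<lambda>x. hgrad B u x $ i)" "(\<lambda>x. hgrad B u x $ i) \<in> Lp \<alpha> B" for i
    using ex[of i] hgrad_component(1)[OF B(1)] hgrad_Lp[OF B(1)] by blast+
  \<comment> \<open>This threshold undoes the outer root in \<open>W1_norm\<close>, so that the sum
    of the integrals itself falls below \<open>e\<close>.\<close>
  have "e powr (1 / \<alpha>) > 0" using e by simp
  then obtain \<phi> where phi: "\<phi> \<in> test_functions B" "W1_norm \<alpha> B (\<lambda>x. u x - \<phi> x) < e powr (1 / \<alpha>)"
    using u unfolding W1_0_def by blast
  have "(LINT x|lebesgue_on B. \<bar>hgrad B u x $ i - Xd i \<phi> x\<bar> powr \<alpha>) < e" for i
  proof -
    let ?S = "(LINT x|lebesgue_on B. \<bar>u x - \<phi> x\<bar> powr \<alpha>) + (\<Sum>i\<in>UNIV. LINT x|lebesgue_on B. \<bar>hgrad B u x $ i - Xd i \<phi> x\<bar> powr \<alpha>)"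
    have "?S powr (1 / \<alpha>) < e powr (1 / \<alpha>)"
      using phi(2) W1_norm_diff[OF a B uL w phi(1)] by simp
    then have "?S < e"
      using powr_mono2[of "1 / \<alpha>" e ?S] e a by (cases "?S < e") auto
    moreover have "(LINT x|lebesgue_on B. \<bar>hgrad B u x $ i - Xd i \<phi> x\<bar> powr \<alpha>) \<le>
        (\<Sum>i\<in>UNIV. LINT x|lebesgue_on B. \<bar>hgrad B u x $ i - Xd i \<phi> x\<bar> powr \<alpha>)"
      by (rule member_le_sum) auto
    moreover have "(LINT x|lebesgue_on B. \<bar>u x - \<phi> x\<bar> powr \<alpha>) \<ge> 0" by simp
    ultimately show ?thesis by linarith
  qed
  then show thesis using that phi(1) by blast
qed

subsection \<open>Energies of convex integrands\<close>

definition Xg :: "('n::finite heis \<Rightarrow> real) \<Rightarrow> 'n heis \<Rightarrow> 'n hor" where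
  "Xg \<phi> x = (\<chi> i. Xd i \<phi> x)"

definition LpV :: "real \<Rightarrow> 'a::euclidean_space set \<Rightarrow> ('a \<Rightarrow> 'b::euclidean_space) \<Rightarrow> bool" where
  "LpV \<alpha> B G \<longleftrightarrow> G \<in> borel_measurable (lebesgue_on B) \<and> integrable (lebesgue_on B) (\<lambda>x. norm (G x) powr \<alpha>)"

definition energy :: "('a::euclidean_space \<Rightarrow> 'b \<Rightarrow> real) \<Rightarrow> 'a set \<Rightarrow> ('a \<Rightarrow> 'b) \<Rightarrow> real" where
  "energy g B G = (LINT x|lebesgue_on B. g x (G x))"

text \<open>Only smooth perturbations of compact support compete, so neither weak gradients nor
  boundary conditions appear. That it is also the minimum over the Sobolev class follows from
  \<open>inf_energy_le_admissible\<close> and \<open>minimizer_exists\<close>.\<close>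

definition inf_energy :: "('n::finite heis \<Rightarrow> 'n hor \<Rightarrow> real) \<Rightarrow> 'n hor \<Rightarrow> 'n heis set \<Rightarrow> real" where
  "inf_energy g p B = (INF \<phi>\<in>test_functions B. energy g B (\<lambda>x. p + Xg \<phi> x))"

lemma norm_powr_le_sum:
  fixes v :: "real ^ 'm::finite"
  assumes "\<alpha> > 1"
  shows "norm v powr \<alpha> \<le> real CARD('m) powr \<alpha> * (\<Sum>i\<in>UNIV. \<bar>v $ i\<bar> powr \<alpha>)"
proof -
  define S where "S = (\<Sum>i\<in>UNIV. \<bar>v $ i\<bar> powr \<alpha>)"
  have "S \<ge> 0" by (auto simp: S_def intro: sum_nonneg)
  have "\<bar>v $ i\<bar> \<le> S powr (1 / \<alpha>)" for i
  proof -
    have "\<bar>v $ i\<bar> powr \<alpha> \<le> S" unfolding S_def by (rule member_le_sum) auto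
    then have "(\<bar>v $ i\<bar> powr \<alpha>) powr (1 / \<alpha>) \<le> S powr (1 / \<alpha>)" using assms by (intro powr_mono2) auto
    then show ?thesis using assms by (simp add: powr_powr)
  qed
  then have "(\<Sum>i\<in>UNIV. \<bar>v $ i\<bar>) \<le> (\<Sum>i\<in>(UNIV :: 'm set). S powr (1 / \<alpha>))" by (intro sum_mono)
  then have "norm v \<le> real CARD('m) * S powr (1 / \<alpha>)"
    using norm_le_l1_cart[of v] by simp
  then have "norm v powr \<alpha> \<le> (real CARD('m) * S powr (1 / \<alpha>)) powr \<alpha>" using assms by (intro powr_mono2) auto
  also have "\<dots> = real CARD('m) powr \<alpha> * S"
    using assms \<open>S \<ge> 0\<close> by (simp add: powr_mult powr_powr)
  finally show ?thesis by (simp add: S_def)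
qed

lemma borel_measurable_vec:
  fixes G :: "'a \<Rightarrow> real ^ 'm::finite"
  assumes "\<And>i. (\<lambda>x. G x $ i) \<in> borel_measurable M"
  shows "G \<in> borel_measurable M"
proof (rule borel_measurable_euclidean_space[THEN iffD2], rule ballI)
  fix b :: "real ^ 'm" assume "b \<in> Basis"
  then obtain i where "b = axis i 1" by (auto simp: Basis_vec_def)
  then show "(\<lambda>x. G x \<bullet> b) \<in> borel_measurable M" using assms[of i] by (simp add: cart_eq_inner_axis)
qed

lemma norm_powr_bound_integrals:
  fixes G :: "'a::euclidean_space \<Rightarrow> real ^ 'm::finite"
  assumes "\<alpha> > 1" "\<And>i. (\<lambda>x. G x $ i) \<in> Lp \<alpha> B"
  shows "LpV \<alpha> B G"
    and "(LINT x|lebesgue_on B. norm (G x) powr \<alpha>) \<le>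
      real CARD('m) powr \<alpha> * (\<Sum>i\<in>UNIV. LINT x|lebesgue_on B. \<bar>G x $ i\<bar> powr \<alpha>)"
proof -
  have m: "G \<in> borel_measurable (lebesgue_on B)"
    using assms(2) by (intro borel_measurable_vec) (simp add: Lp_def)
  have ci: "integrable (lebesgue_on B) (\<lambda>x. \<bar>G x $ i\<bar> powr \<alpha>)" for i using assms(2)[of i] by (simp add: Lp_def)
  have i: "integrable (lebesgue_on B) (\<lambda>x. real CARD('m) powr \<alpha> * (\<Sum>i\<in>UNIV. \<bar>G x $ i\<bar> powr \<alpha>))"
    by (intro integrable_mult_right Bochner_Integration.integrable_sum ci)
  have n: "integrable (lebesgue_on B) (\<lambda>x. norm (G x) powr \<alpha>)"
    by (rule Bochner_Integration.integrable_bound[OF i])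
      (use m norm_powr_le_sum[OF assms(1)] in \<open>auto intro!: AE_I2 simp: abs_of_nonneg sum_nonneg\<close>)
  show "LpV \<alpha> B G" using m n by (simp add: LpV_def)
  have "(LINT x|lebesgue_on B. norm (G x) powr \<alpha>) \<le>
      (LINT x|lebesgue_on B. real CARD('m) powr \<alpha> * (\<Sum>i\<in>UNIV. \<bar>G x $ i\<bar> powr \<alpha>))"
    by (rule integral_mono[OF n i norm_powr_le_sum[OF assms(1)]])
  also have "\<dots> = real CARD('m) powr \<alpha> * (\<Sum>i\<in>UNIV. LINT x|lebesgue_on B. \<bar>G x $ i\<bar> powr \<alpha>)"
    using ci by simp
  finally show "(LINT x|lebesgue_on B. norm (G x) powr \<alpha>) \<le>
      real CARD('m) powr \<alpha> * (\<Sum>i\<in>UNIV. LINT x|lebesgue_on B. \<bar>G x $ i\<bar> powr \<alpha>)" .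
qed

text \<open>A simple function takes only finitely many values, so for it the composition is pieced
  together from the measurable sections. Continuity in the second argument then passes to the limit
  of simple approximations of \<open>G\<close>.\<close>

lemma caratheodory_measurable:
  fixes g :: "'a \<Rightarrow> 'b::euclidean_space \<Rightarrow> real"
  assumes "\<And>p. (\<lambda>x. g x p) \<in> borel_measurable M" "\<And>x. continuous_on UNIV (g x)" "G \<in> borel_measurable M"
  shows "(\<lambda>x. g x (G x)) \<in> borel_measurable M"
proof -
  obtain s where s: "\<And>i. simple_function M (s i)" "\<And>x. x \<in> space M \<Longrightarrow> (\<lambda>i. s i x) \<longlonglongrightarrow> G x"
    using borel_measurable_implies_sequence_metric[OF assms(3), of 0] by blast
  have "(\<lambda>x. g x (s i x)) \<in> borel_measurable M" for i
  proof (rule measurable_compose_countable'[of "s i ` space M" "\<lambda>p x. g x p"])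
    show "s i \<in> measurable M (count_space (s i ` space M))"
      using s(1)[of i] by (simp add: simple_function_def measurable_count_space_eq2)
    show "countable (s i ` space M)" using s(1)[of i] by (simp add: simple_function_def countable_finite)
  qed (rule assms(1))
  then show ?thesis
  proof (rule borel_measurable_LIMSEQ_real[rotated])
    fix x assume "x \<in> space M"
    have "isCont (g x) (G x)" using assms(2) by (simp add: continuous_on_eq_continuous_at)
    then show "(\<lambda>i. g x (s i x)) \<longlonglongrightarrow> g x (G x)"
      using s(2)[OF \<open>x \<in> space M\<close>] isCont_tendsto_compose by blast
  qed
qed

text \<open>Periodicity is kept out: the rescaled and the homogenized integrands satisfy these
  conditions with the same constants, and so does the pure power in the lower bound. Existence of
  minimizers is thereby available for all of them.\<close>

locale integrand =
  fixes g :: "'n::finite heis \<Rightarrow> 'n hor \<Rightarrow> real" and C1 C2 \<alpha> :: real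
  assumes meas: "\<And>p. (\<lambda>x. g x p) \<in> borel_measurable lebesgue"
    and convex: "\<And>x. convex_on UNIV (g x)"
    and params: "C1 > 0" "C2 > 0" "\<alpha> > 1"
    and lower: "\<And>x p. C1 * norm p powr \<alpha> \<le> g x p"
    and upper: "\<And>x p. g x p \<le> C2 * (norm p powr \<alpha> + 1)"
begin

lemma nonneg: "0 \<le> g x p"
  using lower[of p x] params by (meson mult_nonneg_nonneg order_trans less_imp_le powr_ge_zero)

lemma meas_compose:
  assumes "G \<in> borel_measurable (lebesgue_on B)"
  shows "(\<lambda>x. g x (G x)) \<in> borel_measurable (lebesgue_on B)"
  by (rule caratheodory_measurable[OF measurable_restrict_space1[OF meas] convex_on_continuous[OF open_UNIV convex] assms])

lemma integrable_compose:
  assumes B: "open B" "bounded B" and G: "LpV \<alpha> B G"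
  shows "integrable (lebesgue_on B) (\<lambda>x. g x (G x))"
proof (rule Bochner_Integration.integrable_bound)
  interpret finite_measure "lebesgue_on B" by (rule finite_measure_lebesgue_on[OF B])
  show "integrable (lebesgue_on B) (\<lambda>x. C2 * (norm (G x) powr \<alpha> + 1))" using G by (simp add: LpV_def)
  show "(\<lambda>x. g x (G x)) \<in> borel_measurable (lebesgue_on B)" using G by (intro meas_compose) (simp add: LpV_def)
  show "AE x in lebesgue_on B. norm (g x (G x)) \<le> norm (C2 * (norm (G x) powr \<alpha> + 1))"
    using upper nonneg by (intro AE_I2) (simp add: abs_of_nonneg order_trans[OF _ abs_ge_self])
qed

text \<open>Writing \<open>b\<close> as a convex combination of \<open>a\<close> and a far away point turns convexity and
  growth into a one-sided modulus of continuity.\<close>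

lemma convex_growth_bound:
  assumes "0 < s" "s < 1"
  shows "g x b \<le> g x a + s * (C2 * (1 + 2 powr \<alpha> * norm a powr \<alpha>)) +
    C2 * 2 powr \<alpha> * s powr (1 - \<alpha>) * norm (b - a) powr \<alpha>"
proof -
  let ?c = "a + (1 / s) *\<^sub>R (b - a)"
  have "b = (1 - s) *\<^sub>R a + s *\<^sub>R ?c" using assms by (simp add: algebra_simps)
  then have "g x b = g x ((1 - s) *\<^sub>R a + s *\<^sub>R ?c)" by simp
  also have "\<dots> \<le> (1 - s) * g x a + s * g x ?c"
    using convex_onD[OF convex, of s a ?c x] assms by simp
  also have "\<dots> \<le> g x a + s * (C2 * (norm ?c powr \<alpha> + 1))"
  proof -
    have "0 \<le> s * g x a" using assms nonneg[of x a] by simp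
    moreover have "s * g x ?c \<le> s * (C2 * (norm ?c powr \<alpha> + 1))" using assms upper by (intro mult_left_mono) auto
    ultimately show ?thesis by (simp add: left_diff_distrib)
  qed
  also have "\<dots> \<le> g x a + s * (C2 * (2 powr \<alpha> * (norm a powr \<alpha> + norm (b - a) powr \<alpha> * s powr (- \<alpha>)) + 1))"
  proof -
    have "norm ?c powr \<alpha> \<le> 2 powr \<alpha> * (\<bar>norm a\<bar> powr \<alpha> + \<bar>norm ((1 / s) *\<^sub>R (b - a))\<bar> powr \<alpha>)"
      using norm_triangle_ineq[of a "(1 / s) *\<^sub>R (b - a)"] by (intro powr_add_le[OF params(3)]) auto
    also have "\<bar>norm ((1 / s) *\<^sub>R (b - a))\<bar> powr \<alpha> = norm (b - a) powr \<alpha> * s powr (- \<alpha>)"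
      using assms by (simp add: powr_divide powr_minus_divide)
    finally show ?thesis using params assms by (intro add_left_mono mult_left_mono add_right_mono) auto
  qed
  also have "\<dots> = g x a + s * (C2 * (1 + 2 powr \<alpha> * norm a powr \<alpha>)) +
      C2 * 2 powr \<alpha> * (s * s powr (- \<alpha>)) * norm (b - a) powr \<alpha>" by (simp add: algebra_simps)
  \<comment> \<open>The far point \<open>?c\<close> has distance \<open>norm (b - a) / s\<close>
    from \<open>a\<close> and weight \<open>s\<close>; this is where the exponent 1 - \<alpha> comes
    from.\<close>
  also have "s * s powr (- \<alpha>) = s powr (1 - \<alpha>)" using powr_mult_base[of s "- \<alpha>"] assms by simp
  finally show ?thesis .
qed

lemma energy_bound:
  assumes B: "open B" "bounded B" and G: "LpV \<alpha> B G" "LpV \<alpha> B H" "LpV \<alpha> B (\<lambda>x. H x - G x)" and s: "0 < s" "s < 1"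
  shows "energy g B H \<le> energy g B G +
    s * (C2 * (measure lebesgue B + 2 powr \<alpha> * (LINT x|lebesgue_on B. norm (G x) powr \<alpha>))) +
    C2 * 2 powr \<alpha> * s powr (1 - \<alpha>) * (LINT x|lebesgue_on B. norm (H x - G x) powr \<alpha>)"
proof -
  interpret finite_measure "lebesgue_on B" by (rule finite_measure_lebesgue_on[OF B])
  have i: "integrable (lebesgue_on B) (\<lambda>x. norm (G x) powr \<alpha>)" "integrable (lebesgue_on B) (\<lambda>x. norm (H x - G x) powr \<alpha>)"
    using G by (auto simp: LpV_def)
  have mB: "measure (lebesgue_on B) (space (lebesgue_on B)) = measure lebesgue B"
    using B(1) by (simp add: measure_restrict_space)
  have "energy g B H \<le> (LINT x|lebesgue_on B. g x (G x) + s * (C2 * (1 + 2 powr \<alpha> * norm (G x) powr \<alpha>)) +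
      C2 * 2 powr \<alpha> * s powr (1 - \<alpha>) * norm (H x - G x) powr \<alpha>)"
    unfolding energy_def
    by (rule integral_mono[OF integrable_compose[OF B G(2)] _ convex_growth_bound[OF s]])
      (use i integrable_compose[OF B G(1)] in simp)
  also have "\<dots> = energy g B G +
    s * (C2 * (measure lebesgue B + 2 powr \<alpha> * (LINT x|lebesgue_on B. norm (G x) powr \<alpha>))) +
    C2 * 2 powr \<alpha> * s powr (1 - \<alpha>) * (LINT x|lebesgue_on B. norm (H x - G x) powr \<alpha>)"
    using i integrable_compose[OF B G(1)] mB by (simp add: energy_def)
  finally show ?thesis .
qed

text \<open>In \<open>energy_bound\<close> the parameter \<open>s\<close> is fixed first, to make
  the term linear in \<open>s\<close> small. The large factor \<open>s powr (1 - \<alpha>)\<close>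
  is then a constant, and \<open>\<delta>\<close> compensates for it. The bound is applied in both
  directions, so the size of \<open>G\<close> has to be controlled by that of
  \<open>H\<close>.\<close>

lemma energy_continuous:
  assumes B: "open B" "bounded B" and H: "LpV \<alpha> B H" and e: "e > 0"
  obtains \<delta> where "\<delta> > 0" "\<And>G. LpV \<alpha> B G \<Longrightarrow> LpV \<alpha> B (\<lambda>x. G x - H x) \<Longrightarrow>
    (LINT x|lebesgue_on B. norm (G x - H x) powr \<alpha>) < \<delta> \<Longrightarrow> \<bar>energy g B G - energy g B H\<bar> < e"
proof -
  define I where "I G = (LINT x|lebesgue_on B. norm (G x) powr \<alpha>)" for G :: "'n heis \<Rightarrow> 'n hor"
  have Inn: "I G \<ge> 0" for G by (simp add: I_def)
  \<comment> \<open>The number \<open>2 powr \<alpha> * (I H + 1)\<close> dominates both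
    \<open>I H\<close> and \<open>I G\<close> for every \<open>G\<close> in question, whose distance
    integral is below 1. The final 1 keeps \<open>L\<close> positive.\<close>
  define L where "L = C2 * (measure lebesgue B + 2 powr \<alpha> * (2 powr \<alpha> * (I H + 1))) + 1"
  have hL: "C2 * (measure lebesgue B + 2 powr \<alpha> * (2 powr \<alpha> * (I H + 1))) \<ge> 0"
    using params Inn[of H] by (intro mult_nonneg_nonneg add_nonneg_nonneg) auto
  then have L: "L > 0" by (simp add: L_def)
  define s where "s = min (1 / 2) (e / (2 * L))"
  have s: "0 < s" "s < 1" using e L by (auto simp: s_def)
  have sL: "s * (L - 1) \<le> e / 2"
  proof -
    have "s * (L - 1) \<le> e / (2 * L) * L" using s hL e L by (intro mult_mono) (auto simp: s_def L_def)
    then show ?thesis using L by simp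
  qed
  define N where "N = C2 * 2 powr \<alpha> * s powr (1 - \<alpha>)"
  have N: "N > 0" using params s by (simp add: N_def)
  define \<delta> where "\<delta> = min 1 (e / (2 * N))"
  have d: "\<delta> > 0" using e N by (simp add: \<delta>_def)
  show thesis
  proof (rule that[OF d])
    fix G assume G: "LpV \<alpha> B G" "LpV \<alpha> B (\<lambda>x. G x - H x)" "(LINT x|lebesgue_on B. norm (G x - H x) powr \<alpha>) < \<delta>"
    have sym: "norm (H x - G x) = norm (G x - H x)" for x by (rule norm_minus_commute)
    have d1: "I (\<lambda>x. G x - H x) < 1" "N * I (\<lambda>x. G x - H x) < e / 2"
    proof -
      show "I (\<lambda>x. G x - H x) < 1" using G(3) by (simp add: I_def \<delta>_def)
      have "N * I (\<lambda>x. G x - H x) < N * (e / (2 * N))"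
        using G(3) N by (intro mult_strict_left_mono) (simp_all add: I_def \<delta>_def)
      then show "N * I (\<lambda>x. G x - H x) < e / 2" using N by simp
    qed
    have IG: "I G \<le> 2 powr \<alpha> * (I H + 1)"
    proof -
      have "I G \<le> (LINT x|lebesgue_on B. 2 powr \<alpha> * (norm (H x) powr \<alpha> + norm (G x - H x) powr \<alpha>))"
        unfolding I_def
      proof (rule integral_mono)
        show "integrable (lebesgue_on B) (\<lambda>x. norm (G x) powr \<alpha>)" using G by (simp add: LpV_def)
        show "integrable (lebesgue_on B) (\<lambda>x. 2 powr \<alpha> * (norm (H x) powr \<alpha> + norm (G x - H x) powr \<alpha>))"
          using G H by (simp add: LpV_def)
        fix x
        have "norm (G x) powr \<alpha> \<le> 2 powr \<alpha> * (\<bar>norm (H x)\<bar> powr \<alpha> + \<bar>norm (G x - H x)\<bar> powr \<alpha>)"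
          using norm_triangle_ineq[of "H x" "G x - H x"] by (intro powr_add_le[OF params(3)]) auto
        then show "norm (G x) powr \<alpha> \<le> 2 powr \<alpha> * (norm (H x) powr \<alpha> + norm (G x - H x) powr \<alpha>)" by simp
      qed
      also have "\<dots> = 2 powr \<alpha> * (I H + I (\<lambda>x. G x - H x))" using G H by (simp add: LpV_def I_def)
      also have "\<dots> \<le> 2 powr \<alpha> * (I H + 1)" using d1(1) by (intro mult_left_mono) auto
      finally show ?thesis .
    qed
    have IH: "I H \<le> 2 powr \<alpha> * (I H + 1)"
    proof -
      have "1 * (I H + 1) \<le> 2 powr \<alpha> * (I H + 1)"
        using Inn[of H] params(3) ge_one_powr_ge_zero[of 2 \<alpha>] by (intro mult_right_mono) auto
      then show ?thesis by simp
    qed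
    have small: "s * (C2 * (measure lebesgue B + 2 powr \<alpha> * t)) \<le> e / 2" if "t \<le> 2 powr \<alpha> * (I H + 1)" for t
    proof -
      have "s * (C2 * (measure lebesgue B + 2 powr \<alpha> * t)) \<le> s * (L - 1)"
        unfolding L_def using s params that by (simp add: mult_left_mono)
      then show ?thesis using sL by linarith
    qed
    have HG: "LpV \<alpha> B (\<lambda>x. H x - G x)"
    proof -
      have "(\<lambda>x. - (G x - H x)) \<in> borel_measurable (lebesgue_on B)"
        using G(2) by (intro borel_measurable_uminus) (simp add: LpV_def)
      then show ?thesis using G(2) by (simp add: LpV_def sym)
    qed
    have "energy g B G \<le> energy g B H + s * (C2 * (measure lebesgue B + 2 powr \<alpha> * I H)) + N * I (\<lambda>x. G x - H x)"
      using energy_bound[OF B H G(1,2) s] by (simp add: I_def N_def)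
    moreover have "energy g B H \<le> energy g B G + s * (C2 * (measure lebesgue B + 2 powr \<alpha> * I G)) + N * I (\<lambda>x. G x - H x)"
      using energy_bound[OF B G(1) H HG s] by (simp add: I_def N_def sym)
    ultimately show "\<bar>energy g B G - energy g B H\<bar> < e"
      using small[OF IH] small[OF IG] d1(2) by linarith
  qed
qed

end

section \<open>Affine boundary data and compactly supported perturbations\<close>

lemma Xg_add: "C_k (Suc 0) \<phi> \<Longrightarrow> C_k (Suc 0) \<psi> \<Longrightarrow> Xg (\<lambda>x. \<phi> x + \<psi> x) x = Xg \<phi> x + Xg \<psi> x"
  by (simp add: Xg_def vec_eq_iff Xd_add)

lemma Xg_cmult: "C_k (Suc 0) \<phi> \<Longrightarrow> Xg (\<lambda>x. c * \<phi> x) x = c *\<^sub>R Xg \<phi> x"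
  by (simp add: Xg_def vec_eq_iff Xd_cmult)

lemma LpV_test:
  assumes "\<alpha> > 1" "open B" "bounded B" "\<phi> \<in> test_functions B"
  shows "LpV \<alpha> B (\<lambda>x. p + Xg \<phi> x)"
proof (rule norm_powr_bound_integrals(1)[OF assms(1)])
  fix i
  have "(\<lambda>x. p $ i) \<in> Lp \<alpha> B" by (rule continuous_Lp[OF assms(1-3)]) simp
  then show "(\<lambda>x. (p + Xg \<phi> x) $ i) \<in> Lp \<alpha> B"
    using Lp_comb[OF assms(1) _ Dop_Lp[OF assms, of "Some i"], of "\<lambda>x. p $ i" 1] by (simp add: Xg_def)
qed

lemma hgrad_W1_0:
  assumes "\<alpha> > 1" "open B" "bounded B" "w \<in> W1_0 \<alpha> B"
  shows "weak_X B i w (\<lambda>x. hgrad B w x $ i)" "(\<lambda>x. hgrad B w x $ i) \<in> Lp \<alpha> B"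
proof -
  obtain v where "v \<in> Lp \<alpha> B" "weak_X B i w v" using assms(4) unfolding W1_0_def W1_def by blast
  then show "weak_X B i w (\<lambda>x. hgrad B w x $ i)" "(\<lambda>x. hgrad B w x $ i) \<in> Lp \<alpha> B"
    using hgrad_component(1)[OF assms(2)] hgrad_Lp[OF assms(2)] by blast+
qed

text \<open>Linearity of the gradient holds only almost everywhere, because the two applications of
  \<open>hgrad\<close> choose their representatives independently.\<close>

lemma admissible_affine:
  assumes a: "\<alpha> > 1" and B: "open B" "bounded B" and u0: "\<And>x. u0 x = p \<bullet> hproj x + c"
    and u: "u \<in> admissible \<alpha> u0 B"
  shows "AE x in lebesgue_on B. hgrad B u x = p + hgrad B (\<lambda>x. u x - u0 x) x"
    and "u \<in> W1 \<alpha> B" and "LpV \<alpha> B (hgrad B u)"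
proof -
  define w where "w = (\<lambda>x. u x - u0 x)"
  have u0': "u0 = (\<lambda>x. p \<bullet> hproj x + c)" using u0 by (simp add: fun_eq_iff)
  have C1: "C_k (Suc 0) u0" unfolding u0' by (rule C_k_affine)
  have Xu: "Xd i u0 = (\<lambda>x. p $ i)" for i unfolding u0' by (simp add: fun_eq_iff Xd_affine)
  have w0: "w \<in> W1_0 \<alpha> B" using u by (simp add: admissible_def w_def)
  note hw = hgrad_W1_0[OF a B w0]
  have uw: "(\<lambda>x. w x + 1 * u0 x) = u" by (simp add: w_def fun_eq_iff)
  have wk: "weak_X B i u (\<lambda>x. hgrad B w x $ i + 1 * p $ i)" for i
    using weak_X_linear_comb[OF B(1) hw(1) weak_X_smooth[OF B(1) C1], of i 1] unfolding uw Xu by simp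
  have L: "(\<lambda>x. hgrad B w x $ i + 1 * p $ i) \<in> Lp \<alpha> B" for i
    by (rule Lp_comb[OF a hw(2) continuous_Lp[OF a B]]) simp
  have hL: "(\<lambda>x. hgrad B u x $ i) \<in> Lp \<alpha> B" for i by (rule hgrad_Lp[OF B(1) wk L])
  have "AE x in lebesgue_on B. \<forall>i\<in>UNIV. hgrad B u x $ i = hgrad B w x $ i + 1 * p $ i"
    using hgrad_component(2)[OF B(1) wk] by (intro AE_finite_allI) auto
  then show "AE x in lebesgue_on B. hgrad B u x = p + hgrad B (\<lambda>x. u x - u0 x) x"
    by (auto elim!: eventually_mono simp: vec_eq_iff w_def[symmetric])
  have "(\<lambda>x. w x + 1 * u0 x) \<in> Lp \<alpha> B"
    using w0 by (intro Lp_comb[OF a _ continuous_Lp[OF a B C1_continuous[OF C1]]]) (simp add: W1_0_def W1_def)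
  then show "u \<in> W1 \<alpha> B" using wk L unfolding uw W1_def by blast
  show "LpV \<alpha> B (hgrad B u)" by (rule norm_powr_bound_integrals(1)[OF a hL])
qed

context integrand
begin

lemma energy_nonneg: "0 \<le> energy g B G"
  unfolding energy_def by (intro integral_nonneg_AE AE_I2 nonneg)

lemma bdd_below_energy: "bdd_below ((\<lambda>\<phi>. energy g B (\<lambda>x. p + Xg \<phi> x)) ` test_functions B)"
  using energy_nonneg by (intro bdd_belowI2[of _ 0]) auto

lemma inf_energy_le: "\<phi> \<in> test_functions B \<Longrightarrow> inf_energy g p B \<le> energy g B (\<lambda>x. p + Xg \<phi> x)"
  unfolding inf_energy_def by (rule cINF_lower[OF bdd_below_energy])

lemma inf_energy_approx:
  assumes "e > 0" obtains \<phi> where "\<phi> \<in> test_functions B" "energy g B (\<lambda>x. p + Xg \<phi> x) < inf_energy g p B + e"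
proof -
  have "inf_energy g p B < inf_energy g p B + e" using assms by simp
  then show thesis
    using that test_functions_zero[of B] unfolding inf_energy_def
    by (subst (asm) cINF_less_iff[OF _ bdd_below_energy]) auto
qed

lemma energy_cong_AE:
  assumes "AE x in lebesgue_on B. G x = H x" "G \<in> borel_measurable (lebesgue_on B)" "H \<in> borel_measurable (lebesgue_on B)"
  shows "energy g B G = energy g B H"
  unfolding energy_def using assms by (intro integral_cong_AE meas_compose) (auto elim!: eventually_mono)

lemma energy_continuous_ex:
  assumes "open B" "bounded B" "LpV \<alpha> B H" "e > 0"
  shows "\<exists>\<delta>>0. \<forall>G. LpV \<alpha> B G \<longrightarrow> LpV \<alpha> B (\<lambda>x. G x - H x) \<longrightarrow>
    (LINT x|lebesgue_on B. norm (G x - H x) powr \<alpha>) < \<delta> \<longrightarrow> \<bar>energy g B G - energy g B H\<bar> < e"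
proof (rule energy_continuous[OF assms], goal_cases)
  case (1 \<delta>)
  then show ?case by (intro exI[of _ \<delta>]) simp
qed

text \<open>Rough competitors cannot lower the infimum: their gradients are approximated by those of
  smooth perturbations, and the energy is continuous in the gradient.\<close>

lemma inf_energy_le_admissible:
  assumes B: "open B" "bounded B" and u0: "\<And>x. u0 x = p \<bullet> hproj x + c" and u: "u \<in> admissible \<alpha> u0 B"
  shows "inf_energy g p B \<le> energy g B (hgrad B u)"
proof (rule field_le_epsilon)
  fix e :: real assume e: "e > 0"
  define w where "w = (\<lambda>x. u x - u0 x)"
  have w0: "w \<in> W1_0 \<alpha> B" using u by (simp add: admissible_def w_def)
  note hw = hgrad_W1_0[OF params(3) B w0]
  note adm = admissible_affine[OF params(3) B u0 u]
  define H where "H x = p + hgrad B w x" for x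
  have ae: "AE x in lebesgue_on B. hgrad B u x = H x" using adm(1) by (simp add: H_def w_def)
  have HL: "LpV \<alpha> B H"
  proof (rule norm_powr_bound_integrals(1)[OF params(3)])
    fix i
    have "(\<lambda>x. p $ i + 1 * hgrad B w x $ i) \<in> Lp \<alpha> B"
      by (rule Lp_comb[OF params(3) continuous_Lp[OF params(3) B] hw(2)]) simp
    then show "(\<lambda>x. H x $ i) \<in> Lp \<alpha> B" by (simp add: H_def)
  qed
  obtain \<delta> where d: "\<delta> > 0" "\<And>G. LpV \<alpha> B G \<Longrightarrow> LpV \<alpha> B (\<lambda>x. G x - H x) \<Longrightarrow>
    (LINT x|lebesgue_on B. norm (G x - H x) powr \<alpha>) < \<delta> \<Longrightarrow> \<bar>energy g B G - energy g B H\<bar> < e"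
    using energy_continuous_ex[OF B HL e] by blast
  \<comment> \<open>Passing from components to the norm costs the factor
    \<open>real CARD('n + 'n) powr \<alpha>\<close> and a sum of \<open>CARD('n + 'n)\<close> terms,
    each kept below \<open>\<delta> / K\<close>.\<close>
  define K where "K = real CARD('n + 'n) powr \<alpha> * real CARD('n + 'n)"
  have K: "K > 0" by (simp add: K_def)
  obtain \<phi> where phi: "\<phi> \<in> test_functions B" "\<And>i. (LINT x|lebesgue_on B. \<bar>hgrad B w x $ i - Xd i \<phi> x\<bar> powr \<alpha>) < \<delta> / K"
    using W1_0_approx[OF params(3) B w0 divide_pos_pos[OF d(1) K]] by blast
  have dc: "(\<lambda>x. (p + Xg \<phi> x - H x) $ i) \<in> Lp \<alpha> B" for i
    using Lp_diff[OF params(3) Dop_Lp[OF params(3) B phi(1), of "Some i"] hw(2)[of i]] by (simp add: H_def Xg_def)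
  have "(LINT x|lebesgue_on B. norm (p + Xg \<phi> x - H x) powr \<alpha>) \<le>
      real CARD('n + 'n) powr \<alpha> * (\<Sum>i\<in>UNIV. LINT x|lebesgue_on B. \<bar>(p + Xg \<phi> x - H x) $ i\<bar> powr \<alpha>)"
    by (rule norm_powr_bound_integrals(2)[OF params(3) dc])
  also have "\<dots> < real CARD('n + 'n) powr \<alpha> * (\<Sum>i\<in>(UNIV :: ('n + 'n) set). \<delta> / K)"
    using phi(2) by (intro mult_strict_left_mono sum_strict_mono) (auto simp: H_def Xg_def abs_minus_commute)
  also have "\<dots> = \<delta>" using K by (simp add: K_def)
  finally have "\<bar>energy g B (\<lambda>x. p + Xg \<phi> x) - energy g B H\<bar> < e"
    by (intro d(2) LpV_test[OF params(3) B phi(1)] norm_powr_bound_integrals(1)[OF params(3) dc])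
  moreover have "energy g B (hgrad B u) = energy g B H"
    using ae adm(3) HL by (intro energy_cong_AE) (auto simp: LpV_def)
  ultimately show "inf_energy g p B \<le> energy g B (hgrad B u) + e" using inf_energy_le[OF phi(1), of p] by linarith
qed

lemma energy_midpoint:
  assumes B: "open B" "bounded B" and f: "\<phi> \<in> test_functions B" "\<psi> \<in> test_functions B"
  shows "energy g B (\<lambda>x. p + Xg (\<lambda>x. 1 / 2 * (\<phi> x + \<psi> x)) x) \<le>
    (energy g B (\<lambda>x. p + Xg \<phi> x) + energy g B (\<lambda>x. p + Xg \<psi> x)) / 2"
proof -
  have C1: "C_k (Suc 0) \<phi>" "C_k (Suc 0) \<psi>" using f test_function_C1 by blast+
  have i: "integrable (lebesgue_on B) (\<lambda>x. g x (p + Xg \<phi> x))" if "\<phi> \<in> test_functions B" for \<phi>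
    by (rule integrable_compose[OF B LpV_test[OF params(3) B that]])
  have "energy g B (\<lambda>x. p + Xg (\<lambda>x. 1 / 2 * (\<phi> x + \<psi> x)) x) \<le>
      (LINT x|lebesgue_on B. (g x (p + Xg \<phi> x) + g x (p + Xg \<psi> x)) / 2)"
    unfolding energy_def
  proof (rule integral_mono)
    show "integrable (lebesgue_on B) (\<lambda>x. g x (p + Xg (\<lambda>x. 1 / 2 * (\<phi> x + \<psi> x)) x))"
      by (intro i test_functions_cmult test_functions_add f)
    show "integrable (lebesgue_on B) (\<lambda>x. (g x (p + Xg \<phi> x) + g x (p + Xg \<psi> x)) / 2)"
      using i[OF f(1)] i[OF f(2)] by simp
    fix x
    have "p + Xg (\<lambda>x. 1 / 2 * (\<phi> x + \<psi> x)) x = (1 - 1 / 2) *\<^sub>R (p + Xg \<phi> x) + (1 / 2) *\<^sub>R (p + Xg \<psi> x)"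
      by (simp only: Xg_cmult[OF C_k_add[OF C1]] Xg_add[OF C1]) (simp add: scaleR_add_right flip: scaleR_add_left)
    then show "g x (p + Xg (\<lambda>x. 1 / 2 * (\<phi> x + \<psi> x)) x) \<le> (g x (p + Xg \<phi> x) + g x (p + Xg \<psi> x)) / 2"
      using convex_onD[OF convex, of "1 / 2" "p + Xg \<phi> x" "p + Xg \<psi> x" x] by simp
  qed
  also have "\<dots> = (energy g B (\<lambda>x. p + Xg \<phi> x) + energy g B (\<lambda>x. p + Xg \<psi> x)) / 2"
    using i[OF f(1)] i[OF f(2)] by (simp add: energy_def)
  finally show ?thesis .
qed

text \<open>Coercivity bounds the horizontal derivatives, and the Poincare inequality bounds the
  function by one of them.\<close>

lemma sobolev_bound:
  assumes B: "open B" "bounded B"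
  obtains D where "\<And>\<phi>. \<phi> \<in> test_functions B \<Longrightarrow> energy g B (\<lambda>x. p + Xg \<phi> x) \<le> t \<Longrightarrow>
    (\<Sum>j\<in>UNIV. LINT x|lebesgue_on B. \<bar>Dop j \<phi> x\<bar> powr \<alpha>) \<le> D"
proof -
  interpret finite_measure "lebesgue_on B" by (rule finite_measure_lebesgue_on[OF B])
  \<comment> \<open>Any direction of type \<open>'n\<close> serves for the Poincare inequality;
    \<open>undefined\<close> names one.\<close>
  obtain C where "C \<ge> 0" and C2: "\<forall>\<phi>\<in>test_functions B.
    (LINT x|lebesgue_on B. \<bar>\<phi> x\<bar> powr \<alpha>) \<le> C * (LINT x|lebesgue_on B. \<bar>Xd (Inl (undefined :: 'n)) \<phi> x\<bar> powr \<alpha>)"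
    by (rule poincare[OF params(3) B, of "undefined :: 'n"]) blast
  then have C: "C \<ge> 0" "\<And>\<phi>. \<phi> \<in> test_functions B \<Longrightarrow>
    (LINT x|lebesgue_on B. \<bar>\<phi> x\<bar> powr \<alpha>) \<le> C * (LINT x|lebesgue_on B. \<bar>Xd (Inl (undefined :: 'n)) \<phi> x\<bar> powr \<alpha>)"
    by simp_all
  define D1 where "D1 = 2 powr \<alpha> * (\<bar>t\<bar> / C1 + norm p powr \<alpha> * measure lebesgue B)"
  have D1: "D1 \<ge> 0" using params by (simp add: D1_def)
  show thesis
  \<comment> \<open>\<open>C * D1\<close> bounds the term of \<open>None\<close> and
    \<open>D1\<close> those of \<open>Some i\<close>; \<open>(C + 1) * D1\<close> covers
    both.\<close>
  proof (rule that[of "\<Sum>j\<in>(UNIV :: ('n + 'n) option set). (C + 1) * D1"])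
    fix \<phi> assume phi: "\<phi> \<in> test_functions B" and t: "energy g B (\<lambda>x. p + Xg \<phi> x) \<le> t"
    have L: "LpV \<alpha> B (\<lambda>x. p + Xg \<phi> x)" by (rule LpV_test[OF params(3) B phi])
    have "C1 * (LINT x|lebesgue_on B. norm (p + Xg \<phi> x) powr \<alpha>) \<le> energy g B (\<lambda>x. p + Xg \<phi> x)"
      unfolding energy_def integral_mult_right_zero[symmetric]
      using L lower by (intro integral_mono integrable_compose[OF B L]) (auto simp: LpV_def)
    then have "C1 * (LINT x|lebesgue_on B. norm (p + Xg \<phi> x) powr \<alpha>) \<le> \<bar>t\<bar>" using t by linarith
    then have n: "(LINT x|lebesgue_on B. norm (p + Xg \<phi> x) powr \<alpha>) \<le> \<bar>t\<bar> / C1"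
      using params by (simp add: field_simps)
    have X: "(LINT x|lebesgue_on B. \<bar>Xd i \<phi> x\<bar> powr \<alpha>) \<le> D1" for i
    proof -
      have "(LINT x|lebesgue_on B. \<bar>Xd i \<phi> x\<bar> powr \<alpha>) \<le>
          (LINT x|lebesgue_on B. 2 powr \<alpha> * (norm (p + Xg \<phi> x) powr \<alpha> + norm p powr \<alpha>))"
      proof (rule integral_mono)
        show "integrable (lebesgue_on B) (\<lambda>x. \<bar>Xd i \<phi> x\<bar> powr \<alpha>)"
          using Dop_Lp[OF params(3) B phi, of "Some i"] by (simp add: Lp_def)
        show "integrable (lebesgue_on B) (\<lambda>x. 2 powr \<alpha> * (norm (p + Xg \<phi> x) powr \<alpha> + norm p powr \<alpha>))"
          using L by (simp add: LpV_def)
        fix x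
        have "\<bar>Xd i \<phi> x\<bar> \<le> norm (Xg \<phi> x)" using component_le_norm_cart[of "Xg \<phi> x" i] by (simp add: Xg_def)
        also have "\<dots> \<le> \<bar>norm (p + Xg \<phi> x)\<bar> + \<bar>norm p\<bar>" using norm_triangle_ineq4[of "p + Xg \<phi> x" p] by simp
        finally have "\<bar>Xd i \<phi> x\<bar> powr \<alpha> \<le> 2 powr \<alpha> * (\<bar>norm (p + Xg \<phi> x)\<bar> powr \<alpha> + \<bar>norm p\<bar> powr \<alpha>)"
          by (intro powr_add_le[OF params(3)]) auto
        then show "\<bar>Xd i \<phi> x\<bar> powr \<alpha> \<le> 2 powr \<alpha> * (norm (p + Xg \<phi> x) powr \<alpha> + norm p powr \<alpha>)" by simp
      qed
      also have "\<dots> = 2 powr \<alpha> * ((LINT x|lebesgue_on B. norm (p + Xg \<phi> x) powr \<alpha>) + norm p powr \<alpha> * measure lebesgue B)"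
        using L B(1) by (simp add: LpV_def measure_restrict_space mult.commute)
      also have "\<dots> \<le> D1" unfolding D1_def using n by (intro mult_left_mono add_right_mono) auto
      finally show ?thesis .
    qed
    have "(LINT x|lebesgue_on B. \<bar>Dop j \<phi> x\<bar> powr \<alpha>) \<le> (C + 1) * D1" for j
    proof (cases j)
      case None
      have "(LINT x|lebesgue_on B. \<bar>\<phi> x\<bar> powr \<alpha>) \<le> C * D1"
        using C(2)[OF phi] mult_left_mono[OF X C(1)] by (rule order_trans)
      then show ?thesis using None D1 by (simp add: distrib_right)
    next
      case (Some i)
      have "0 \<le> C * D1" using C(1) D1 by simp
      then show ?thesis using Some X[of i] by (simp add: distrib_right)
    qed
    then show "(\<Sum>j\<in>UNIV. LINT x|lebesgue_on B. \<bar>Dop j \<phi> x\<bar> powr \<alpha>) \<le> (\<Sum>j\<in>(UNIV :: ('n + 'n) option set). (C + 1) * D1)"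
      by (intro sum_mono)
  qed
qed

end

subsection \<open>Existence of minimizers\<close>

context integrand
begin

text \<open>Integrated form of \<open>abs_powr_uniform_convex\<close>. The constant is chosen before
  the measure and the functions, so it serves all pairs of a sequence at once.\<close>

lemma uniform_convexity_integral:
  assumes "\<eta> > 0"
  obtains c where "c \<ge> 0" "\<And>(M :: 'a measure) f h. f \<in> borel_measurable M \<Longrightarrow> h \<in> borel_measurable M \<Longrightarrow>
    integrable M (\<lambda>x. \<bar>f x\<bar> powr \<alpha>) \<Longrightarrow> integrable M (\<lambda>x. \<bar>h x\<bar> powr \<alpha>) \<Longrightarrow>
    (LINT x|M. \<bar>f x - h x\<bar> powr \<alpha>) \<le> \<eta> * ((LINT x|M. \<bar>f x\<bar> powr \<alpha>) + (LINT x|M. \<bar>h x\<bar> powr \<alpha>)) +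
      c * (((LINT x|M. \<bar>f x\<bar> powr \<alpha>) + (LINT x|M. \<bar>h x\<bar> powr \<alpha>)) / 2 - (LINT x|M. \<bar>(f x + h x) / 2\<bar> powr \<alpha>))"
proof -
  obtain c where c: "c \<ge> 0" "\<forall>a b::real. \<bar>a - b\<bar> powr \<alpha> \<le> \<eta> * (\<bar>a\<bar> powr \<alpha> + \<bar>b\<bar> powr \<alpha>) +
      c * ((\<bar>a\<bar> powr \<alpha> + \<bar>b\<bar> powr \<alpha>) / 2 - \<bar>(a + b) / 2\<bar> powr \<alpha>)"
    by (rule abs_powr_uniform_convex[OF params(3) assms]) blast
  show thesis
  proof (rule that[OF c(1)])
    fix M :: "'a measure" and f h
    assume fh: "f \<in> borel_measurable M" "h \<in> borel_measurable M"
      "integrable M (\<lambda>x. \<bar>f x\<bar> powr \<alpha>)" "integrable M (\<lambda>x. \<bar>h x\<bar> powr \<alpha>)"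
    have d: "integrable M (\<lambda>x. \<bar>f x - h x\<bar> powr \<alpha>)" by (rule integrable_abs_powr_add(2)[OF params(3) fh])
    have "integrable M (\<lambda>x. (1 / 2) powr \<alpha> * \<bar>f x + h x\<bar> powr \<alpha>)"
      by (intro integrable_mult_right integrable_abs_powr_add(1)[OF params(3) fh])
    moreover have "(1 / 2) powr \<alpha> * \<bar>f x + h x\<bar> powr \<alpha> = \<bar>(f x + h x) / 2\<bar> powr \<alpha>" for x
      by (simp add: powr_mult[symmetric])
    ultimately have m: "integrable M (\<lambda>x. \<bar>(f x + h x) / 2\<bar> powr \<alpha>)" by (simp only:)
    have "(LINT x|M. \<bar>f x - h x\<bar> powr \<alpha>) \<le> (LINT x|M. \<eta> * (\<bar>f x\<bar> powr \<alpha> + \<bar>h x\<bar> powr \<alpha>) +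
      c * ((\<bar>f x\<bar> powr \<alpha> + \<bar>h x\<bar> powr \<alpha>) / 2 - \<bar>(f x + h x) / 2\<bar> powr \<alpha>))"
    proof (rule integral_mono[OF d])
      show "integrable M (\<lambda>x. \<eta> * (\<bar>f x\<bar> powr \<alpha> + \<bar>h x\<bar> powr \<alpha>) +
        c * ((\<bar>f x\<bar> powr \<alpha> + \<bar>h x\<bar> powr \<alpha>) / 2 - \<bar>(f x + h x) / 2\<bar> powr \<alpha>))"
        by (intro Bochner_Integration.integrable_add integrable_mult_right Bochner_Integration.integrable_diff
            integrable_divide_zero fh(3,4) m)
    qed (use c(2) in blast)
    also have "\<dots> = \<eta> * ((LINT x|M. \<bar>f x\<bar> powr \<alpha>) + (LINT x|M. \<bar>h x\<bar> powr \<alpha>)) +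
      c * (((LINT x|M. \<bar>f x\<bar> powr \<alpha>) + (LINT x|M. \<bar>h x\<bar> powr \<alpha>)) / 2 - (LINT x|M. \<bar>(f x + h x) / 2\<bar> powr \<alpha>))"
      using fh(3,4) m by simp
    finally show "(LINT x|M. \<bar>f x - h x\<bar> powr \<alpha>) \<le> \<eta> * ((LINT x|M. \<bar>f x\<bar> powr \<alpha>) + (LINT x|M. \<bar>h x\<bar> powr \<alpha>)) +
      c * (((LINT x|M. \<bar>f x\<bar> powr \<alpha>) + (LINT x|M. \<bar>h x\<bar> powr \<alpha>)) / 2 - (LINT x|M. \<bar>(f x + h x) / 2\<bar> powr \<alpha>))" .
  qed
qed

text \<open>The sublevel sets \<open>K n\<close> are closed under midpoints, so by uniform convexity near-minimizers
  of the norm on them form a Cauchy sequence; this replaces weak compactness.\<close>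

lemma minimizing_Cauchy_sequence:
  assumes B: "open B" "bounded B"
  obtains h where "\<And>n::nat. h n \<in> test_functions B"
    "\<And>n. energy g B (\<lambda>x. p + Xg (h n) x) \<le> inf_energy g p B + 1 / real (Suc n)"
    "\<And>j e. e > 0 \<Longrightarrow> \<exists>N. \<forall>n\<ge>N. \<forall>k\<ge>N. (LINT x|lebesgue_on B. \<bar>Dop j (h n) x - Dop j (h k) x\<bar> powr \<alpha>) < e"
proof -
  define J where "J \<phi> = energy g B (\<lambda>x. p + Xg \<phi> x)" for \<phi>
  define m where "m = inf_energy g p B"
  define I where "I j \<phi> = (LINT x|lebesgue_on B. \<bar>Dop j \<phi> x\<bar> powr \<alpha>)" for j \<phi>
  define \<Phi> where "\<Phi> \<phi> = (\<Sum>j\<in>UNIV. I j \<phi>)" for \<phi>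
  define K where "K n = {\<phi> \<in> test_functions B. J \<phi> \<le> m + 1 / real (Suc n)}" for n :: nat
  obtain D where "\<forall>\<phi>\<in>test_functions B. J \<phi> \<le> m + 1 \<longrightarrow> \<Phi> \<phi> \<le> D"
    unfolding J_def \<Phi>_def I_def by (rule sobolev_bound[OF B, of p "m + 1"]) blast
  then have D: "\<Phi> \<phi> \<le> D" if "\<phi> \<in> test_functions B" "J \<phi> \<le> m + 1" for \<phi> using that by blast
  have Inn: "I j \<phi> \<ge> 0" for j \<phi> by (simp add: I_def)
  have Phinn: "\<Phi> \<phi> \<ge> 0" for \<phi> unfolding \<Phi>_def by (intro sum_nonneg Inn)
  have IPhi: "I j \<phi> \<le> \<Phi> \<phi>" for j \<phi> unfolding \<Phi>_def by (rule member_le_sum) (auto simp: Inn)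
  have Kne: "K n \<noteq> {}" for n
  proof -
    obtain \<phi> where "\<phi> \<in> test_functions B" "J \<phi> < m + 1 / real (Suc n)"
      using inf_energy_approx[of "1 / real (Suc n)" B p] unfolding J_def m_def by auto
    then have "\<phi> \<in> K n" by (simp add: K_def less_imp_le)
    then show ?thesis by blast
  qed
  have Kmono: "K k \<subseteq> K n" if "n \<le> k" for n k
  proof -
    have "1 / real (Suc k) \<le> 1 / real (Suc n)" using that by (intro divide_left_mono) auto
    then show ?thesis by (auto simp: K_def)
  qed
  have KD: "\<Phi> \<phi> \<le> D" if "\<phi> \<in> K n" for \<phi> n
    using D Kmono[of 0 n] that by (auto simp: K_def)
  \<comment> \<open>The infima \<open>d n\<close> increase because the sets \<open>K n\<close>
    shrink, and \<open>D\<close> bounds them. Closeness of \<open>d N\<close> to the limit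
    \<open>dl\<close> will force the Cauchy property.\<close>
  define d where "d n = (INF \<phi>\<in>K n. \<Phi> \<phi>)" for n
  have bdd: "bdd_below (\<Phi> ` K n)" for n using Phinn by (intro bdd_belowI2[of _ 0]) auto
  have dle: "d n \<le> \<Phi> \<phi>" if "\<phi> \<in> K n" for \<phi> n unfolding d_def by (rule cINF_lower[OF bdd that])
  have dD: "d n \<le> D" for n using Kne[of n] dle KD by (meson ex_in_conv order_trans)
  have "incseq d"
    unfolding incseq_def d_def by (intro allI impI cINF_superset_mono Kne bdd Kmono) auto
  then obtain dl where dl: "d \<longlonglongrightarrow> dl" "\<And>n. d n \<le> dl" using incseq_convergent dD by metis
  have "\<exists>\<phi>. \<phi> \<in> K n \<and> \<Phi> \<phi> < d n + 1 / real (Suc n)" for n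
  proof -
    have "d n < d n + 1 / real (Suc n)" by simp
    then show ?thesis unfolding d_def by (subst (asm) cINF_less_iff[OF Kne bdd]) blast
  qed
  then obtain h where h: "\<And>n. h n \<in> K n" "\<And>n. \<Phi> (h n) < d n + 1 / real (Suc n)" by metis
  have hT: "h n \<in> test_functions B" for n using h(1)[of n] by (simp add: K_def)
  define mid where "mid n k = (\<lambda>x. 1 / 2 * (h n x + h k x))" for n k
  have hL: "Dop j (h n) \<in> borel_measurable (lebesgue_on B)" "integrable (lebesgue_on B) (\<lambda>x. \<bar>Dop j (h n) x\<bar> powr \<alpha>)" for j n
    using Dop_Lp[OF params(3) B hT[of n], of j] by (auto simp: Lp_def)
  have Imid: "I j (mid n k) = (LINT x|lebesgue_on B. \<bar>(Dop j (h n) x + Dop j (h k) x) / 2\<bar> powr \<alpha>)" for j n k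
    unfolding I_def mid_def
    by (simp only: Dop_cmult[OF C_k_add[OF test_function_C1[OF hT] test_function_C1[OF hT]]]
        Dop_add[OF test_function_C1[OF hT] test_function_C1[OF hT]]) simp
  have gapnn: "0 \<le> (I j (h n) + I j (h k)) / 2 - I j (mid n k)" for j n k
  proof -
    have "I j (mid n k) \<le> (LINT x|lebesgue_on B. (\<bar>Dop j (h n) x\<bar> powr \<alpha> + \<bar>Dop j (h k) x\<bar> powr \<alpha>) / 2)"
      unfolding Imid
    proof (rule integral_mono)
      have "integrable (lebesgue_on B) (\<lambda>x. \<bar>Dop j (mid n k) x\<bar> powr \<alpha>)"
        using Dop_Lp[OF params(3) B test_functions_cmult[OF test_functions_add[OF hT hT]], of j "1 / 2" n k]
        unfolding mid_def Lp_def by blast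
      then show "integrable (lebesgue_on B) (\<lambda>x. \<bar>(Dop j (h n) x + Dop j (h k) x) / 2\<bar> powr \<alpha>)"
        unfolding mid_def
        by (simp only: Dop_cmult[OF C_k_add[OF test_function_C1[OF hT] test_function_C1[OF hT]]]
          Dop_add[OF test_function_C1[OF hT] test_function_C1[OF hT]]) simp
    qed (use hL abs_powr_midpoint[OF params(3)] in auto)
    also have "\<dots> = (I j (h n) + I j (h k)) / 2" using hL by (simp add: I_def)
    finally show ?thesis by simp
  qed
  \<comment> \<open>The midpoint remains in \<open>K N\<close>, so its value of
    \<open>\<Phi>\<close> is at least \<open>d N\<close>, while the values at \<open>h n\<close> and
    \<open>h k\<close> are below \<open>dl + 1 / real (Suc N)\<close>. Little room is left for a
    convexity gap.\<close>
  have gap: "(I j (h n) + I j (h k)) / 2 - I j (mid n k) \<le> dl - d N + 1 / real (Suc N)"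
    if "n \<ge> N" "k \<ge> N" for j n k N
  proof -
    have "mid n k \<in> K N"
    proof -
      have "h n \<in> K N" "h k \<in> K N" using h(1) Kmono that by blast+
      then have "J (h n) \<le> m + 1 / real (Suc N)" "J (h k) \<le> m + 1 / real (Suc N)" by (auto simp: K_def)
      moreover have "J (mid n k) \<le> (J (h n) + J (h k)) / 2"
        unfolding J_def mid_def by (rule energy_midpoint[OF B hT hT])
      moreover have "mid n k \<in> test_functions B"
        unfolding mid_def by (intro test_functions_cmult test_functions_add hT)
      ultimately show ?thesis by (simp add: K_def)
    qed
    then have dm: "d N \<le> \<Phi> (mid n k)" by (rule dle)
    \<comment> \<open>What is controlled is the sum of the gaps over \<open>j\<close>; as none of
      them is negative, it bounds each one.\<close>
    have "(I j (h n) + I j (h k)) / 2 - I j (mid n k) \<le> (\<Sum>j\<in>UNIV. (I j (h n) + I j (h k)) / 2 - I j (mid n k))"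
      by (rule member_le_sum) (use gapnn in auto)
    also have "\<dots> = (\<Phi> (h n) + \<Phi> (h k)) / 2 - \<Phi> (mid n k)"
      by (simp add: \<Phi>_def sum_subtractf sum.distrib flip: sum_divide_distrib)
    also have "\<dots> \<le> dl - d N + 1 / real (Suc N)"
    proof -
      have "1 / real (Suc n) \<le> 1 / real (Suc N)" "1 / real (Suc k) \<le> 1 / real (Suc N)"
        using that by (intro divide_left_mono; simp)+
      then show ?thesis using h(2)[of n] h(2)[of k] dl(2)[of n] dl(2)[of k] dm by argo
    qed
    finally show ?thesis .
  qed
  have ID: "I j (h n) \<le> D" for j n using IPhi KD[OF h(1)] order_trans by blast
  have Dnn: "D \<ge> 0" using ID[of None 0] Inn order_trans by blast
  have "\<exists>N. \<forall>n\<ge>N. \<forall>k\<ge>N. (LINT x|lebesgue_on B. \<bar>Dop j (h n) x - Dop j (h k) x\<bar> powr \<alpha>) < e"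
    if e: "e > 0" for j e
  proof -
    \<comment> \<open>Makes the contribution of \<open>\<eta>\<close> at most \<open>e / 2\<close>.
      The constant \<open>c\<close> depends on this \<open>\<eta>\<close>, and \<open>N\<close> is
      chosen afterwards to make its contribution small.\<close>
    define \<eta> where "\<eta> = e / (4 * (D + 1))"
    have eta: "\<eta> > 0" using e Dnn by (simp add: \<eta>_def)
    have etaD: "\<eta> * (D + D) \<le> e / 2"
    proof -
      have "\<eta> * (D + D) \<le> \<eta> * (2 * (D + 1))" using eta by (intro mult_left_mono) auto
      also have "\<dots> = e / 2" using Dnn by (simp add: \<eta>_def field_simps)
      finally show ?thesis .
    qed
    obtain c where c0: "c \<ge> 0" and c1: "\<forall>(M :: 'n heis measure) f h. f \<in> borel_measurable M \<longrightarrow> h \<in> borel_measurable M \<longrightarrow>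
      integrable M (\<lambda>x. \<bar>f x\<bar> powr \<alpha>) \<longrightarrow> integrable M (\<lambda>x. \<bar>h x\<bar> powr \<alpha>) \<longrightarrow>
      (LINT x|M. \<bar>f x - h x\<bar> powr \<alpha>) \<le> \<eta> * ((LINT x|M. \<bar>f x\<bar> powr \<alpha>) + (LINT x|M. \<bar>h x\<bar> powr \<alpha>)) +
      c * (((LINT x|M. \<bar>f x\<bar> powr \<alpha>) + (LINT x|M. \<bar>h x\<bar> powr \<alpha>)) / 2 - (LINT x|M. \<bar>(f x + h x) / 2\<bar> powr \<alpha>))"
      by (rule uniform_convexity_integral[OF eta, where 'a = "'n heis"]) blast
    have "(\<lambda>N. c * (dl - d N + 1 / real (Suc N))) \<longlonglongrightarrow> c * (dl - dl + 0)"
      by (intro tendsto_intros dl(1) lim_1_over_n LIMSEQ_Suc[OF lim_1_over_n])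
    then have "(\<lambda>N. c * (dl - d N + 1 / real (Suc N))) \<longlonglongrightarrow> 0" by simp
    from LIMSEQ_D[OF this, of "e / 2"] e obtain N where "norm (c * (dl - d N + 1 / real (Suc N)) - 0) < e / 2" by auto
    then have N: "c * (dl - d N + 1 / real (Suc N)) < e / 2" by simp
    show ?thesis
    proof (intro exI[of _ N] allI impI)
      fix n k assume nk: "n \<ge> N" "k \<ge> N"
      have "(LINT x|lebesgue_on B. \<bar>Dop j (h n) x - Dop j (h k) x\<bar> powr \<alpha>) \<le>
          \<eta> * (I j (h n) + I j (h k)) + c * ((I j (h n) + I j (h k)) / 2 - I j (mid n k))"
        unfolding Imid using c1 hL unfolding I_def by blast
      moreover have "\<eta> * (I j (h n) + I j (h k)) \<le> \<eta> * (D + D)" using eta ID by (intro mult_left_mono add_mono) auto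
      moreover have "c * ((I j (h n) + I j (h k)) / 2 - I j (mid n k)) \<le> c * (dl - d N + 1 / real (Suc N))"
        by (rule mult_left_mono[OF gap[OF nk] c0])
      ultimately show "(LINT x|lebesgue_on B. \<bar>Dop j (h n) x - Dop j (h k) x\<bar> powr \<alpha>) < e" using etaD N by linarith
    qed
  qed
  moreover have "energy g B (\<lambda>x. p + Xg (h n) x) \<le> inf_energy g p B + 1 / real (Suc n)" for n
    using h(1)[of n] by (simp add: K_def J_def m_def)
  ultimately show thesis using that hT by blast
qed

text \<open>The perturbations converge strongly together with their horizontal derivatives. So
  \<open>W1_0_limit\<close> places the limit in the Sobolev space with zero boundary values, and
  continuity of the energy gives its value.\<close>

theorem minimizer_exists:
  assumes B: "open B" "bounded B" and u0: "\<And>x. u0 x = p \<bullet> hproj x + c"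
  obtains u where "u \<in> admissible \<alpha> u0 B" "energy g B (hgrad B u) = inf_energy g p B"
proof -
  interpret finite_measure "lebesgue_on B" by (rule finite_measure_lebesgue_on[OF B])
  obtain h where hT: "\<And>n::nat. h n \<in> test_functions B"
    and hJ: "\<And>n. energy g B (\<lambda>x. p + Xg (h n) x) \<le> inf_energy g p B + 1 / real (Suc n)"
    and hC: "\<And>j e. e > 0 \<Longrightarrow> \<exists>N. \<forall>n\<ge>N. \<forall>k\<ge>N. (LINT x|lebesgue_on B. \<bar>Dop j (h n) x - Dop j (h k) x\<bar> powr \<alpha>) < e"
    by (rule minimizing_Cauchy_sequence[OF B, of p]) blast
  have hL: "Dop j (h n) \<in> borel_measurable (lebesgue_on B)" "integrable (lebesgue_on B) (\<lambda>x. \<bar>Dop j (h n) x\<bar> powr \<alpha>)" for j n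
    using Dop_Lp[OF params(3) B hT[of n], of j] by (auto simp: Lp_def)
  have "\<exists>w. w \<in> Lp \<alpha> B \<and> (\<lambda>n. LINT x|lebesgue_on B. \<bar>Dop j (h n) x - w x\<bar> powr \<alpha>) \<longlonglongrightarrow> 0" for j
  proof (rule Lpowr_complete[OF params(3), of "\<lambda>n. Dop j (h n)"], goal_cases)
    case (1 n)
    show ?case by (rule hL(1))
  next
    case (2 n)
    show ?case by (rule hL(2))
  next
    case (3 e)
    then show ?case by (rule hC)
  next
    case (4 w)
    then show ?case by (intro exI[of _ w]) (simp add: Lp_def)
  qed
  then have "\<exists>w. \<forall>j. w j \<in> Lp \<alpha> B \<and> (\<lambda>n. LINT x|lebesgue_on B. \<bar>Dop j (h n) x - w j x\<bar> powr \<alpha>) \<longlonglongrightarrow> 0"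
    by (intro choice allI)
  then obtain w where w: "\<And>j. w j \<in> Lp \<alpha> B"
    "\<And>j. (\<lambda>n. LINT x|lebesgue_on B. \<bar>Dop j (h n) x - w j x\<bar> powr \<alpha>) \<longlonglongrightarrow> 0" by blast
  define v where "v i = w (Some i)" for i
  have wl: "(\<lambda>n. LINT x|lebesgue_on B. \<bar>h n x - w None x\<bar> powr \<alpha>) \<longlonglongrightarrow> 0"
    and vl: "(\<lambda>n. LINT x|lebesgue_on B. \<bar>Xd i (h n) x - v i x\<bar> powr \<alpha>) \<longlonglongrightarrow> 0" for i
    using w(2)[of None] w(2)[of "Some i"] by (simp_all add: v_def)
  have vL: "v i \<in> Lp \<alpha> B" for i by (simp add: v_def w(1))
  note W = W1_0_limit[OF params(3) B hT w(1)[of None] vL wl vl]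
  define u where "u = (\<lambda>x. w None x + u0 x)"
  have uw: "(\<lambda>x. u x - u0 x) = w None" by (simp add: u_def)
  have adm: "u \<in> admissible \<alpha> u0 B" using W(1) by (simp add: admissible_def uw)
  note adm_props = admissible_affine[OF params(3) B u0 adm]
  define H where "H x = p + (\<chi> i. v i x)" for x
  have HL: "LpV \<alpha> B H"
  proof (rule norm_powr_bound_integrals(1)[OF params(3)])
    fix i
    have "(\<lambda>x. p $ i + 1 * v i x) \<in> Lp \<alpha> B"
      by (rule Lp_comb[OF params(3) continuous_Lp[OF params(3) B] vL]) simp
    then show "(\<lambda>x. H x $ i) \<in> Lp \<alpha> B" by (simp add: H_def)
  qed
  have ae: "AE x in lebesgue_on B. hgrad B u x = H x"
  proof -
    have "AE x in lebesgue_on B. \<forall>i\<in>UNIV. hgrad B (w None) x $ i = v i x"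
      using hgrad_component(2)[OF B(1) W(2)] by (intro AE_finite_allI) auto
    then show ?thesis using adm_props(1) unfolding uw by eventually_elim (simp add: H_def vec_eq_iff)
  qed
  have eq: "energy g B (hgrad B u) = energy g B H"
    using adm_props(3) HL by (intro energy_cong_AE[OF ae]) (auto simp: LpV_def)
  have "energy g B H \<le> inf_energy g p B"
  proof (rule field_le_epsilon)
    fix e :: real assume e: "e > 0"
    then have "e / 2 > 0" by simp
    then obtain \<delta> where d: "\<delta> > 0" "\<And>G. LpV \<alpha> B G \<Longrightarrow> LpV \<alpha> B (\<lambda>x. G x - H x) \<Longrightarrow>
      (LINT x|lebesgue_on B. norm (G x - H x) powr \<alpha>) < \<delta> \<Longrightarrow> \<bar>energy g B G - energy g B H\<bar> < e / 2"
      using energy_continuous_ex[OF B HL] by blast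
    have dc: "(\<lambda>x. (p + Xg (h n) x - H x) $ i) \<in> Lp \<alpha> B" for i n
      using Lp_diff[OF params(3) Dop_Lp[OF params(3) B hT, of "Some i"] vL[of i]] by (simp add: H_def Xg_def)
    have "(\<lambda>n. real CARD('n + 'n) powr \<alpha> * (\<Sum>i\<in>UNIV. LINT x|lebesgue_on B. \<bar>Xd i (h n) x - v i x\<bar> powr \<alpha>)) \<longlonglongrightarrow>
        real CARD('n + 'n) powr \<alpha> * (\<Sum>i\<in>(UNIV :: ('n + 'n) set). 0)"
      by (intro tendsto_mult tendsto_const tendsto_sum vl)
    then have "\<forall>\<^sub>F n in sequentially. real CARD('n + 'n) powr \<alpha> * (\<Sum>i\<in>UNIV. LINT x|lebesgue_on B. \<bar>Xd i (h n) x - v i x\<bar> powr \<alpha>) < \<delta>"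
      using d(1) by (intro order_tendstoD(2)) auto
    moreover have "\<forall>\<^sub>F n in sequentially. 1 / real (Suc n) < e / 2"
      using e by (intro order_tendstoD(2)[OF LIMSEQ_Suc[OF lim_1_over_n]]) auto
    ultimately have "\<forall>\<^sub>F n in sequentially. energy g B H \<le> inf_energy g p B + e"
    proof eventually_elim
      case (elim n)
      have "(LINT x|lebesgue_on B. norm (p + Xg (h n) x - H x) powr \<alpha>) \<le>
        real CARD('n + 'n) powr \<alpha> * (\<Sum>i\<in>UNIV. LINT x|lebesgue_on B. \<bar>(p + Xg (h n) x - H x) $ i\<bar> powr \<alpha>)"
        by (rule norm_powr_bound_integrals(2)[OF params(3) dc])
      also have "\<dots> < \<delta>" using elim(1) by (simp add: H_def Xg_def)
      finally have "\<bar>energy g B (\<lambda>x. p + Xg (h n) x) - energy g B H\<bar> < e / 2"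
        by (intro d(2) LpV_test[OF params(3) B hT] norm_powr_bound_integrals(1)[OF params(3) dc])
      then show ?case using hJ[of n] elim(2) by linarith
    qed
    then show "energy g B H \<le> inf_energy g p B + e" by (simp add: eventually_const)
  qed
  moreover have "inf_energy g p B \<le> energy g B (hgrad B u)"
    by (rule inf_energy_le_admissible[OF B u0 adm])
  ultimately show thesis using that[OF adm] eq by simp
qed

end

subsection \<open>Translations and dilations\<close>

text \<open>Change of variables with constant Jacobian \<open>c\<close>. Stated through nonnegative
  Borel functions, it is inherited by compositions with the product of the factors.\<close>

definition scales_lborel :: "('a::euclidean_space \<Rightarrow> 'a) \<Rightarrow> real \<Rightarrow> bool" where
  "scales_lborel T c \<longleftrightarrow> T \<in> borel_measurable borel \<and> c > 0 \<and>
    (\<forall>f\<in>borel_measurable borel. (\<integral>\<^sup>+x. f x \<partial>lborel) = ennreal c * (\<integral>\<^sup>+x. f (T x) \<partial>lborel))"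

lemma scales_lborelD:
  "scales_lborel T c \<Longrightarrow> f \<in> borel_measurable borel \<Longrightarrow>
    (\<integral>\<^sup>+x. f x \<partial>lborel) = ennreal c * (\<integral>\<^sup>+x. f (T x) \<partial>lborel)"
  unfolding scales_lborel_def by blast

lemma scales_lborelI:
  assumes "T \<in> borel_measurable borel" "c > 0"
    "\<And>f. f \<in> borel_measurable borel \<Longrightarrow> (\<integral>\<^sup>+x. f x \<partial>lborel) = ennreal c * (\<integral>\<^sup>+x. f (T x) \<partial>lborel)"
  shows "scales_lborel T c"
  unfolding scales_lborel_def using assms by (intro conjI ballI)

lemma scales_lborel_compose:
  assumes "scales_lborel T c" "scales_lborel S d"
  shows "scales_lborel (\<lambda>x. T (S x)) (c * d)"
proof -
  have m: "T \<in> borel_measurable borel" "S \<in> borel_measurable borel" and p: "c > 0" "d > 0"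
    using assms by (auto simp: scales_lborel_def)
  have "(\<integral>\<^sup>+x. f x \<partial>lborel) = ennreal (c * d) * (\<integral>\<^sup>+x. f (T (S x)) \<partial>lborel)"
    if f: "f \<in> borel_measurable borel" for f
  proof -
    have "(\<lambda>x. f (T x)) \<in> borel_measurable borel" by (rule measurable_compose[OF m(1) f])
    then have "(\<integral>\<^sup>+x. f (T x) \<partial>lborel) = ennreal d * (\<integral>\<^sup>+x. f (T (S x)) \<partial>lborel)"
      using assms(2) by (simp add: scales_lborel_def)
    moreover have "(\<integral>\<^sup>+x. f x \<partial>lborel) = ennreal c * (\<integral>\<^sup>+x. f (T x) \<partial>lborel)"
      using assms(1) f by (simp add: scales_lborel_def)
    ultimately show ?thesis using p by (simp add: ennreal_mult mult.assoc)
  qed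
  moreover have "(\<lambda>x. T (S x)) \<in> borel_measurable borel" by (rule measurable_compose[OF m(2,1)])
  ultimately show ?thesis unfolding scales_lborel_def using p by (intro conjI ballI mult_pos_pos)
qed

lemma scales_lborel_translate: "scales_lborel (\<lambda>x. a + x) 1"
proof -
  have "(\<integral>\<^sup>+x. f x \<partial>lborel) = ennreal 1 * (\<integral>\<^sup>+x. f (a + x) \<partial>lborel)" if "f \<in> borel_measurable borel" for f
  proof -
    have "(\<integral>\<^sup>+x. f x \<partial>lborel) = (\<integral>\<^sup>+x. f x \<partial>distr lborel borel ((+) a))" by (simp add: lborel_distr_plus)
    also have "\<dots> = (\<integral>\<^sup>+x. f (a + x) \<partial>lborel)" using that by (subst nn_integral_distr) auto
    finally show ?thesis by simp
  qed
  then show ?thesis by (intro scales_lborelI) (simp, simp, blast)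
qed

text \<open>For fixed \<open>x\<close> and \<open>y\<close> the shear is a translation of the last
  coordinate, so Tonelli's theorem reduces the claim to translation invariance on the line.\<close>

lemma scales_lborel_shear:
  fixes s :: "'a::euclidean_space \<Rightarrow> 'b::euclidean_space \<Rightarrow> real"
  assumes s: "(\<lambda>(x, y). s x y) \<in> borel_measurable borel"
  shows "scales_lborel (\<lambda>(x, y, z). (x, y, z + s x y)) 1"
proof -
  let ?S = "\<lambda>(x, y, z). (x, y, z + s x y)"
  have Sm: "?S \<in> borel_measurable borel"
  proof -
    have "(\<lambda>w. (fst w, fst (snd w))) \<in> borel_measurable borel"
      by (intro borel_measurable_continuous_onI continuous_intros)
    from measurable_compose[OF this s]
    have sm: "(\<lambda>w :: 'a \<times> 'b \<times> real. s (fst w) (fst (snd w))) \<in> borel_measurable borel" by simp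
    have "(\<lambda>w :: 'a \<times> 'b \<times> real. fst w) \<in> borel_measurable borel"
      "(\<lambda>w :: 'a \<times> 'b \<times> real. fst (snd w)) \<in> borel_measurable borel"
      "(\<lambda>w :: 'a \<times> 'b \<times> real. snd (snd w)) \<in> borel_measurable borel"
      by (intro borel_measurable_continuous_onI continuous_intros)+
    with sm have "(\<lambda>w. (fst w, fst (snd w), snd (snd w) + s (fst w) (fst (snd w)))) \<in> borel_measurable borel"
      by (intro borel_measurable_Pair borel_measurable_add)
    then show ?thesis by (simp add: case_prod_beta')
  qed
  have fub: "(\<integral>\<^sup>+w. h w \<partial>lborel) = (\<integral>\<^sup>+x. \<integral>\<^sup>+y. \<integral>\<^sup>+z. h (x, y, z) \<partial>lborel \<partial>lborel \<partial>lborel)"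
    if h: "h \<in> borel_measurable borel" for h :: "'a \<times> 'b \<times> real \<Rightarrow> ennreal"
  proof -
    have hm: "h \<in> borel_measurable (lborel \<Otimes>\<^sub>M lborel)" using h by (simp add: lborel_prod)
    have "(\<integral>\<^sup>+w. h w \<partial>lborel) = (\<integral>\<^sup>+x. \<integral>\<^sup>+v. h (x, v) \<partial>lborel \<partial>lborel)"
      using lborel.nn_integral_fst[OF hm] by (simp add: lborel_prod)
    also have "\<dots> = (\<integral>\<^sup>+x. \<integral>\<^sup>+y. \<integral>\<^sup>+z. h (x, y, z) \<partial>lborel \<partial>lborel \<partial>lborel)"
    proof (rule nn_integral_cong)
      fix x :: 'a
      have "(\<lambda>v. (x, v)) \<in> borel_measurable borel" by (intro borel_measurable_continuous_onI continuous_intros)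
      from measurable_compose[OF this h] have "(\<lambda>v. h (x, v)) \<in> borel_measurable (lborel \<Otimes>\<^sub>M lborel)"
        by (simp add: lborel_prod)
      from lborel.nn_integral_fst[OF this]
      show "(\<integral>\<^sup>+v. h (x, v) \<partial>lborel) = (\<integral>\<^sup>+y. \<integral>\<^sup>+z. h (x, y, z) \<partial>lborel \<partial>lborel)" by (simp add: lborel_prod)
    qed
    finally show ?thesis .
  qed
  have "(\<integral>\<^sup>+w. f w \<partial>lborel) = (\<integral>\<^sup>+w. f (?S w) \<partial>lborel)" if f: "f \<in> borel_measurable borel" for f
  proof -
    have "(\<integral>\<^sup>+w. f (?S w) \<partial>lborel) = (\<integral>\<^sup>+x. \<integral>\<^sup>+y. \<integral>\<^sup>+z. f (x, y, z + s x y) \<partial>lborel \<partial>lborel \<partial>lborel)"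
      using fub[OF measurable_compose[OF Sm f]] by simp
    also have "\<dots> = (\<integral>\<^sup>+x. \<integral>\<^sup>+y. \<integral>\<^sup>+z. f (x, y, z) \<partial>lborel \<partial>lborel \<partial>lborel)"
    proof (rule nn_integral_cong, rule nn_integral_cong)
      fix x :: 'a and y :: 'b
      have "(\<lambda>z. (x, y, z)) \<in> borel_measurable borel" by (intro borel_measurable_continuous_onI continuous_intros)
      from measurable_compose[OF this f] have m: "(\<lambda>z. f (x, y, z)) \<in> borel_measurable borel" .
      have "(\<integral>\<^sup>+z. f (x, y, z) \<partial>lborel) = (\<integral>\<^sup>+z. f (x, y, s x y + z) \<partial>lborel)"
        using scales_lborelD[OF scales_lborel_translate[of "s x y"] m] by simp
      then show "(\<integral>\<^sup>+z. f (x, y, z + s x y) \<partial>lborel) = (\<integral>\<^sup>+z. f (x, y, z) \<partial>lborel)" by (simp add: add.commute)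
    qed
    also have "\<dots> = (\<integral>\<^sup>+w. f w \<partial>lborel)" using fub[OF f] by simp
    finally show ?thesis by (rule sym)
  qed
  then have "(\<integral>\<^sup>+w. f w \<partial>lborel) = ennreal 1 * (\<integral>\<^sup>+w. f (?S w) \<partial>lborel)" if "f \<in> borel_measurable borel" for f
    using that by (simp only: ennreal_1 mult_1)
  then show ?thesis by (rule scales_lborelI[OF Sm zero_less_one])
qed

lemma DIM_heis: "DIM('n::finite heis) = 2 * CARD('n) + 1"
  by simp

lemma Basis_heis_cases:
  assumes "b \<in> (Basis :: 'n::finite heis set)"
  obtains i where "b = (axis i 1, 0, 0)" | i where "b = (0, axis i 1, 0)" | "b = (0, 0, 1)"
  using assms by (auto simp: Basis_prod_def Basis_vec_def zero_prod_def)

text \<open>The exponent is the homogeneous dimension: \<open>2 * CARD('n)\<close> coordinates scale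
  by \<open>t\<close> and the vertical one by \<open>t\<^sup>2\<close>.\<close>

lemma scales_lborel_dil:
  assumes "t > 0"
  shows "scales_lborel (dil t :: 'n::finite heis \<Rightarrow> 'n heis) (t ^ (2 * CARD('n) + 2))"
proof -
  define c where "c b = (if b = (0, 0, 1) then t\<^sup>2 else t)" for b :: "'n heis"
  have c0: "c b \<noteq> 0" for b using assms by (simp add: c_def)
  have db: "dil t x \<bullet> b = c b * (x \<bullet> b)" if "b \<in> Basis" for x b :: "'n heis"
    using that by (cases x; cases rule: Basis_heis_cases) (auto simp: dil_def c_def inner_axis)
  have D: "dil t = (\<lambda>x :: 'n heis. 0 + (\<Sum>j\<in>Basis. (c j * (x \<bullet> j)) *\<^sub>R j))"
  proof
    fix x :: "'n heis"
    have "dil t x = (\<Sum>j\<in>Basis. (dil t x \<bullet> j) *\<^sub>R j)" by (simp add: euclidean_representation)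
    then show "dil t x = 0 + (\<Sum>j\<in>Basis. (c j * (x \<bullet> j)) *\<^sub>R j)" using db by simp
  qed
  have Dm: "dil t \<in> borel_measurable (borel :: 'n heis measure)"
    unfolding D by (intro borel_measurable_continuous_onI continuous_intros)
  have e3: "(0, 0, 1) \<in> (Basis :: 'n heis set)" by (simp add: Basis_prod_def)
  have "(\<Prod>j\<in>(Basis :: 'n heis set). \<bar>c j\<bar>) = \<bar>c (0, 0, 1)\<bar> * (\<Prod>j\<in>(Basis :: 'n heis set) - {(0, 0, 1)}. \<bar>c j\<bar>)"
    by (rule prod.remove[OF finite_Basis e3])
  also have "(\<Prod>j\<in>(Basis :: 'n heis set) - {(0, 0, 1)}. \<bar>c j\<bar>) = (\<Prod>j\<in>(Basis :: 'n heis set) - {(0, 0, 1)}. t)"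
    using assms by (intro prod.cong) (auto simp: c_def)
  also have "\<dots> = t ^ (2 * CARD('n))"
    using e3 DIM_heis[where 'n = 'n] by (simp add: card_Diff_singleton mult_2)
  finally have pr: "(\<Prod>j\<in>(Basis :: 'n heis set). \<bar>c j\<bar>) = t ^ (2 * CARD('n) + 2)"
    by (simp add: c_def power_add power2_eq_square)
  have "(\<integral>\<^sup>+x. f x \<partial>lborel) = ennreal (t ^ (2 * CARD('n) + 2)) * (\<integral>\<^sup>+x. f (dil t x) \<partial>lborel)"
    if f: "f \<in> borel_measurable borel" for f :: "'n heis \<Rightarrow> ennreal"
  proof -
    have "(\<integral>\<^sup>+x. f x \<partial>lborel) = (\<integral>\<^sup>+x. f x \<partial>density (distr lborel borel (dil t)) (\<lambda>_. ennreal (t ^ (2 * CARD('n) + 2))))"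
      using lborel_affine_euclidean[of c 0] c0 unfolding pr D by simp
    also have "\<dots> = (\<integral>\<^sup>+x. ennreal (t ^ (2 * CARD('n) + 2)) * f x \<partial>distr lborel borel (dil t))"
      using f by (subst nn_integral_density) auto
    also have "\<dots> = ennreal (t ^ (2 * CARD('n) + 2)) * (\<integral>\<^sup>+x. f x \<partial>distr lborel borel (dil t))"
      using f by (intro nn_integral_cmult) auto
    also have "(\<integral>\<^sup>+x. f x \<partial>distr lborel borel (dil t)) = (\<integral>\<^sup>+x. f (dil t x) \<partial>lborel)"
      using f Dm by (intro nn_integral_distr) auto
    finally show ?thesis .
  qed
  then show ?thesis using assms Dm by (intro scales_lborelI zero_less_power)
qed

text \<open>Dilations and left translations in one family, which is closed under inverses: the
  inverse has parameters \<open>dil (1 / t) (- a)\<close> and \<open>1 / t\<close>.\<close>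

definition htrans :: "'n::finite heis \<Rightarrow> real \<Rightarrow> 'n heis \<Rightarrow> 'n heis" where
  "htrans a t x = heis_mult a (dil t x)"

section \<open>Group laws and their compatibility with dilations\<close>

lemma heis_mult_assoc: "heis_mult (heis_mult x y) z = heis_mult x (heis_mult y z)"
  by (cases x; cases y; cases z) (simp add: heis_mult_def inner_add_left inner_add_right field_simps)

lemma heis_mult_zero [simp]: "heis_mult 0 x = x" "heis_mult x 0 = x"
  by (cases x; simp add: heis_mult_def zero_prod_def)+

lemma heis_mult_minus [simp]: "heis_mult (- x) x = 0" "heis_mult x (- x) = 0"
  by (cases x; simp add: heis_mult_def zero_prod_def inner_commute)+

lemma dil_heis_mult: "dil t (heis_mult x y) = heis_mult (dil t x) (dil t y)"
  by (cases x; cases y) (simp add: heis_mult_def dil_def scaleR_add_right power2_eq_square field_simps)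

lemma dil_dil: "dil s (dil t x) = dil (s * t) x"
  by (cases x) (simp add: dil_def power_mult_distrib)

lemma dil_1 [simp]: "dil 1 x = x"
  by (cases x) (simp add: dil_def)

lemma dil_minus: "dil t (- x) = - dil t x"
  by (cases x) (simp add: dil_def)

lemma htrans_inverse:
  assumes "t > 0"
  shows "htrans (dil (1 / t) (- a)) (1 / t) (htrans a t x) = x" "htrans a t (htrans (dil (1 / t) (- a)) (1 / t) x) = x"
  using assms by (simp_all add: htrans_def dil_heis_mult dil_dil dil_minus flip: heis_mult_assoc)

text \<open>Left translation by \<open>a\<close> is a shear of the vertical coordinate followed by a
  Euclidean translation. Both have Jacobian 1, so only the dilation contributes.\<close>

lemma scales_lborel_htrans:
  assumes "t > 0"
  shows "scales_lborel (htrans a t :: 'n::finite heis \<Rightarrow> 'n heis) (t ^ (2 * CARD('n) + 2))"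
proof -
  obtain a1 a2 a3 where a: "a = (a1, a2, a3)" by (cases a)
  let ?S = "\<lambda>(x :: real ^ 'n, y :: real ^ 'n, z). (x, y, z + (a1 \<bullet> y - a2 \<bullet> x) / 2)"
  have "(\<lambda>(x :: real ^ 'n, y :: real ^ 'n). (a1 \<bullet> y - a2 \<bullet> x) / 2) \<in> borel_measurable borel"
    unfolding case_prod_beta' by (intro borel_measurable_continuous_onI continuous_intros) auto
  then have "scales_lborel ?S 1" by (rule scales_lborel_shear)
  from scales_lborel_compose[OF scales_lborel_translate[of a] scales_lborel_compose[OF this scales_lborel_dil[OF assms]]]
  have "scales_lborel (\<lambda>x. a + ?S (dil t x)) (t ^ (2 * CARD('n) + 2))" by simp
  moreover have "(\<lambda>x. a + ?S (dil t x)) = htrans a t"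
    by (auto simp: fun_eq_iff a htrans_def heis_mult_def split: prod.splits)
  ultimately show ?thesis by simp
qed

text \<open>Passage from Borel to Lebesgue measure. Since \<open>c\<close> is positive, a Borel set
  is null exactly when its preimage is, and completion therefore commutes with taking the image
  measure.\<close>

lemma scales_lborel_lebesgue:
  fixes T :: "'a::euclidean_space \<Rightarrow> 'a"
  assumes "scales_lborel T c"
  shows "lebesgue = density (distr lebesgue lebesgue T) (\<lambda>_. ennreal c)" and "T \<in> lebesgue \<rightarrow>\<^sub>M lebesgue"
proof -
  have T [measurable]: "T \<in> borel \<rightarrow>\<^sub>M borel" and c: "c > 0" using assms by (auto simp: scales_lborel_def)
  have em: "emeasure lborel A = ennreal c * emeasure lborel (T -` A)" if A: "A \<in> sets borel" for A
  proof -
    have "emeasure lborel A = (\<integral>\<^sup>+x. indicator A x \<partial>lborel)" using A by simp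
    also have "\<dots> = ennreal c * (\<integral>\<^sup>+x. indicator A (T x) \<partial>lborel)"
      using A by (intro scales_lborelD[OF assms]) simp
    also have "(\<integral>\<^sup>+x. indicator A (T x) \<partial>lborel) = (\<integral>\<^sup>+x. indicator (T -` A) x \<partial>lborel)"
      by (simp add: indicator_def)
    also have "\<dots> = emeasure lborel (T -` A)"
      using measurable_sets[OF T A] by (intro nn_integral_indicator) simp
    finally show ?thesis .
  qed
  have dist: "lborel = density (distr lborel borel T) (\<lambda>_. ennreal c)" (is "_ = ?D")
  proof (rule measure_eqI)
    fix A :: "'a set" assume "A \<in> sets lborel"
    then have A: "A \<in> sets borel" by simp
    have "emeasure ?D A = ennreal c * emeasure (distr lborel borel T) A"
      using A by (simp add: emeasure_density nn_integral_cmult)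
    also have "emeasure (distr lborel borel T) A = emeasure lborel (T -` A)"
      using A by (subst emeasure_distr) auto
    finally show "emeasure lborel A = emeasure ?D A" using em[OF A] by simp
  qed simp
  have nul: "null_sets lborel = null_sets (distr lebesgue lborel T)"
  proof -
    have "emeasure lborel A = 0 \<longleftrightarrow> emeasure (distr lebesgue lborel T) A = 0" if A: "A \<in> sets borel" for A
    proof -
      have "emeasure (distr lebesgue lborel T) A = emeasure lborel (T -` A)"
        using A by (simp add: distr_completion emeasure_distr)
      then show ?thesis using em[OF A] c by simp
    qed
    then show ?thesis by (auto simp: null_sets_def)
  qed
  show "T \<in> lebesgue \<rightarrow>\<^sub>M lebesgue"
    by (simp add: completion.measurable_completion2 nul measurable_completion)
  have "lebesgue = completion (density (distr lborel borel T) (\<lambda>_. ennreal c))" using dist by simp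
  also have "\<dots> = density (completion (distr lebesgue lborel T)) (\<lambda>_. ennreal c)"
    using c by (auto intro!: always_eventually completion_density_eq simp: distr_completion cong: distr_cong)
  also have "\<dots> = density (distr lebesgue lebesgue T) (\<lambda>_. ennreal c)"
    by (subst completion.completion_distr_eq) (auto simp: nul measurable_completion)
  finally show "lebesgue = density (distr lebesgue lebesgue T) (\<lambda>_. ennreal c)" .
qed

lemma integral_scales:
  fixes F :: "'a::euclidean_space \<Rightarrow> real"
  assumes "scales_lborel T c" "F \<in> borel_measurable lebesgue"
  shows "(LINT x|lebesgue. F x) = c * (LINT x|lebesgue. F (T x))"
proof -
  have c: "c > 0" using assms(1) by (simp add: scales_lborel_def)
  note L = scales_lborel_lebesgue[OF assms(1)]
  have "(LINT x|lebesgue. F x) = (LINT x|density (distr lebesgue lebesgue T) (\<lambda>_. ennreal c). F x)"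
    using L(1) by simp
  also have "\<dots> = (LINT x|distr lebesgue lebesgue T. c *\<^sub>R F x)"
    using c assms(2) by (intro integral_density) auto
  also have "\<dots> = (LINT x|lebesgue. c *\<^sub>R F (T x))"
    using L(2) assms(2) by (intro integral_distr) auto
  finally show ?thesis by simp
qed

text \<open>The linear part of \<open>htrans a t\<close>; the group law is affine in its right
  factor.\<close>

definition hlin :: "'n::finite heis \<Rightarrow> real \<Rightarrow> 'n heis \<Rightarrow> 'n heis" where
  "hlin a t = (\<lambda>(x1, x2, x3). (t *\<^sub>R x1, t *\<^sub>R x2, t\<^sup>2 * x3 + t * (fst a \<bullet> x2 - fst (snd a) \<bullet> x1) / 2))"

lemma htrans_hlin: "htrans a t x = hlin a t x + a"
  by (cases a; cases x) (simp add: htrans_def hlin_def heis_mult_def dil_def algebra_simps)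

lemma htrans_eq: "htrans a t = (\<lambda>x. hlin a t x + a)"
  by (simp add: fun_eq_iff htrans_hlin)

lemma linear_hlin: "linear (hlin a t)"
  by (rule linearI) (auto simp: hlin_def inner_add_right scaleR_add_right algebra_simps add_divide_distrib diff_divide_distrib)

text \<open>Left invariance of the fields and their homogeneity of degree one under dilations, in
  one identity.\<close>

lemma hlin_Xfield: "hlin a t (Xfield i x) = t *\<^sub>R Xfield i (htrans a t x)"
  by (cases a; cases x; cases i)
    (auto simp: hlin_def htrans_def heis_mult_def dil_def inner_axis power2_eq_square algebra_simps add_divide_distrib)

lemma continuous_htrans: "continuous_on S (htrans a t)"
proof -
  have "continuous_on UNIV (\<lambda>x. hlin a t x + a)"
    by (intro continuous_on_add linear_continuous_on continuous_on_const)
      (simp add: linear_conv_bounded_linear[symmetric] linear_hlin)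
  then show ?thesis using continuous_on_subset by (metis (no_types, lifting) continuous_on_cong htrans_hlin top_greatest)
qed

lemma homeomorphism_htrans:
  assumes "t > 0"
  shows "homeomorphism UNIV UNIV (htrans a t) (htrans (dil (1 / t) (- a)) (1 / t))"
  using htrans_inverse[OF assms, of a] by (intro homeomorphismI continuous_htrans) simp_all

lemma htrans_image_vimage:
  assumes "t > 0"
  shows "htrans a t ` B = htrans (dil (1 / t) (- a)) (1 / t) -` B"
proof (intro equalityI subsetI)
  fix y assume "y \<in> htrans a t ` B"
  then show "y \<in> htrans (dil (1 / t) (- a)) (1 / t) -` B" using htrans_inverse(1)[OF assms, of a] by auto
next
  fix y assume "y \<in> htrans (dil (1 / t) (- a)) (1 / t) -` B"
  then show "y \<in> htrans a t ` B" using htrans_inverse(2)[OF assms, of a y] by (intro image_eqI[of _ _ "htrans (dil (1 / t) (- a)) (1 / t) y"]) auto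
qed

lemma open_htrans: "t > 0 \<Longrightarrow> open B \<Longrightarrow> open (htrans a t ` B)"
  unfolding htrans_image_vimage by (rule open_vimage[OF _ continuous_htrans])

lemma bounded_htrans: 
  assumes "bounded B" shows "bounded (htrans a t ` B)"
proof -
  have "compact (htrans a t ` closure B)"
    using assms by (intro compact_continuous_image continuous_htrans) simp
  then show ?thesis using bounded_subset[OF compact_imp_bounded] closure_subset by (metis image_mono)
qed

lemma lebesgue_htrans: "t > 0 \<Longrightarrow> B \<in> sets lebesgue \<Longrightarrow> htrans a t ` B \<in> sets lebesgue"
  unfolding htrans_image_vimage
  using measurable_sets[OF scales_lborel_lebesgue(2)[OF scales_lborel_htrans], of "1 / t" B "dil (1 / t) (- a)"] by simp

lemma measure_htrans:
  fixes B :: "'n::finite heis set"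
  assumes "t > 0" "B \<in> sets lebesgue"
  shows "measure lebesgue (htrans a t ` B) = t ^ (2 * CARD('n) + 2) * measure lebesgue B"
proof -
  have inj: "htrans a t x \<in> htrans a t ` B \<longleftrightarrow> x \<in> B" for x
    using htrans_inverse(1)[OF assms(1), of a] by (metis image_iff)
  have "measure lebesgue (htrans a t ` B) = (LINT x|lebesgue. indicator (htrans a t ` B) x)" by simp
  also have "\<dots> = t ^ (2 * CARD('n) + 2) * (LINT x|lebesgue. indicator (htrans a t ` B) (htrans a t x))"
    using lebesgue_htrans[OF assms] by (intro integral_scales[OF scales_lborel_htrans[OF assms(1)]]) simp
  also have "(LINT x|lebesgue. indicator (htrans a t ` B) (htrans a t x)) = (LINT x|lebesgue. indicator B x :: real)"
    by (intro Bochner_Integration.integral_cong refl) (simp add: indicator_def inj)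
  finally show ?thesis by simp
qed

section \<open>Change of variables for the infimal energy\<close>

lemma energy_lebesgue:
  assumes "B \<in> sets lebesgue"
  shows "energy g B G = (LINT x|lebesgue. indicator B x * g x (G x))"
  unfolding energy_def using assms by (subst integral_restrict_space) auto

lemma integrand_htrans:
  assumes "integrand g C1 C2 \<alpha>" "t > 0"
  shows "integrand (\<lambda>x. g (htrans a t x)) C1 C2 \<alpha>"
proof -
  interpret integrand g C1 C2 \<alpha> by fact
  show ?thesis
  proof
    show "(\<lambda>x. g (htrans a t x) p) \<in> borel_measurable lebesgue" for p
      by (rule measurable_compose[OF scales_lborel_lebesgue(2)[OF scales_lborel_htrans[OF assms(2)]] meas])
  qed (use convex params lower upper in auto)
qed

text \<open>Competitors on the image are pulled back. The factor \<open>1 / t\<close> in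
  \<open>\<psi>\<close> cancels the \<open>t\<close> of \<open>hlin_Xfield\<close>, so the
  horizontal gradients agree and the slope \<open>p\<close> is unchanged.\<close>

lemma inf_energy_htrans_ge:
  fixes B :: "'n::finite heis set"
  assumes g: "integrand g C1 C2 \<alpha>" and t: "t > 0" and B: "open B" "bounded B"
  shows "t ^ (2 * CARD('n) + 2) * inf_energy (\<lambda>x. g (htrans a t x)) p B \<le> inf_energy g p (htrans a t ` B)"
proof -
  interpret integrand g C1 C2 \<alpha> by fact
  interpret gt: integrand "\<lambda>x. g (htrans a t x)" C1 C2 \<alpha> by (rule integrand_htrans[OF g t])
  let ?T = "htrans a t" and ?c = "t ^ (2 * CARD('n) + 2)"
  have TB: "open (?T ` B)" "bounded (?T ` B)" by (rule open_htrans[OF t B(1)], rule bounded_htrans[OF B(2)])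
  have inj: "?T x \<in> ?T ` B \<longleftrightarrow> x \<in> B" for x
    using htrans_inverse(1)[OF t, of a] by (metis image_iff)
  show ?thesis unfolding inf_energy_def[of g]
  proof (rule cINF_greatest)
    show "test_functions (?T ` B) \<noteq> {}" using test_functions_zero by blast
    fix \<phi> assume phi: "\<phi> \<in> test_functions (?T ` B)"
    have C1: "C_k (Suc 0) \<phi>" by (rule test_function_C1[OF phi])
    define \<psi> where "\<psi> x = 1 / t * \<phi> (?T x)" for x
    have "(\<lambda>x. \<phi> (hlin a t x + a)) \<in> test_functions B"
    proof (rule test_functions_compose[OF phi linear_hlin])
      show "homeomorphism UNIV UNIV (\<lambda>x. hlin a t x + a) (htrans (dil (1 / t) (- a)) (1 / t))"
        using homeomorphism_htrans[OF t, of a] unfolding htrans_eq .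
      show "htrans (dil (1 / t) (- a)) (1 / t) ` ?T ` B = B"
        using htrans_inverse(1)[OF t, of a] by (simp add: image_image)
    qed
    then have psi: "\<psi> \<in> test_functions B" unfolding \<psi>_def[abs_def] htrans_hlin by (rule test_functions_cmult)
    have X: "Xg \<psi> x = Xg \<phi> (?T x)" for x
    proof -
      have "(?T has_derivative hlin a t) (at x)"
        unfolding htrans_eq by (rule has_derivative_add_const[OF linear_imp_has_derivative[OF linear_hlin]])
      from has_derivative_mult_right[OF has_derivative_compose[OF this C1_frechet[OF C1]], of "1 / t"]
      have d: "(\<psi> has_derivative (\<lambda>h. 1 / t * frechet_derivative \<phi> (at (?T x)) (hlin a t h))) (at x)"
        by (simp add: \<psi>_def[abs_def])
      have "Xd i \<psi> x = Xd i \<phi> (?T x)" for i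
        using linear_cmul[OF linear_frechet_derivative[OF C_k_differentiable[OF C1]]] t
        by (subst Xd_eqI[OF d]) (simp add: hlin_Xfield Xd_def)
      then show ?thesis by (simp add: Xg_def)
    qed
    have m: "(\<lambda>x. indicator (?T ` B) x * g x (p + Xg \<phi> x)) \<in> borel_measurable lebesgue"
    proof -
      have "(\<lambda>x. g x (p + Xg \<phi> x)) \<in> borel_measurable (lebesgue_on (?T ` B))"
        using LpV_test[OF params(3) TB phi] by (intro meas_compose) (simp add: LpV_def)
      then show ?thesis using TB(1) by (subst (asm) borel_measurable_restrict_space_iff) auto
    qed
    have "energy g (?T ` B) (\<lambda>x. p + Xg \<phi> x) = (LINT x|lebesgue. indicator (?T ` B) x * g x (p + Xg \<phi> x))"
      using TB(1) by (intro energy_lebesgue) simp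
    also have "\<dots> = ?c * (LINT x|lebesgue. indicator (?T ` B) (?T x) * g (?T x) (p + Xg \<phi> (?T x)))"
      by (rule integral_scales[OF scales_lborel_htrans[OF t] m])
    also have "\<dots> = ?c * (LINT x|lebesgue. indicator B x * g (?T x) (p + Xg \<psi> x))"
      by (simp add: X indicator_def inj)
    also have "\<dots> = ?c * energy (\<lambda>x. g (?T x)) B (\<lambda>x. p + Xg \<psi> x)"
      using B(1) by (subst energy_lebesgue) simp_all
    finally show "?c * inf_energy (\<lambda>x. g (?T x)) p B \<le> energy g (?T ` B) (\<lambda>x. p + Xg \<phi> x)"
      using gt.inf_energy_le[OF psi, of p] t by (simp add: mult_left_mono)
  qed
qed

text \<open>The missing inequality is the previous one applied to the inverse map.\<close>

lemma inf_energy_htrans: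
  fixes B :: "'n::finite heis set"
  assumes g: "integrand g C1 C2 \<alpha>" and t: "t > 0" and B: "open B" "bounded B"
  shows "inf_energy g p (htrans a t ` B) = t ^ (2 * CARD('n) + 2) * inf_energy (\<lambda>x. g (htrans a t x)) p B"
proof (rule antisym)
  let ?T = "htrans a t" and ?S = "htrans (dil (1 / t) (- a)) (1 / t)" and ?c = "t ^ (2 * CARD('n) + 2)"
  have "(1 / t) ^ (2 * CARD('n) + 2) * inf_energy (\<lambda>x. g (?T (?S x))) p (?T ` B)
      \<le> inf_energy (\<lambda>x. g (?T x)) p (?S ` ?T ` B)"
    using t by (intro inf_energy_htrans_ge[OF integrand_htrans[OF g t] _ open_htrans[OF t B(1)] bounded_htrans[OF B(2)]]) simp
  moreover have "?S ` ?T ` B = B" using htrans_inverse(1)[OF t, of a] by (simp add: image_image)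
  moreover have "(\<lambda>x. g (?T (?S x))) = g" using htrans_inverse(2)[OF t, of a] by simp
  moreover have "(1 / t) ^ (2 * CARD('n) + 2) * inf_energy g p (?T ` B) = inf_energy g p (?T ` B) / ?c"
    by (simp only: power_one_over times_divide_eq_left mult_1)
  ultimately have "inf_energy g p (?T ` B) / ?c \<le> inf_energy (\<lambda>x. g (?T x)) p B" by (simp only:)
  then show "inf_energy g p (?T ` B) \<le> ?c * inf_energy (\<lambda>x. g (?T x)) p B"
    using t by (simp add: divide_le_eq mult.commute)
qed (rule inf_energy_htrans_ge[OF g t B])

section \<open>The gain of an open set\<close>

lemma Xg_zero_outside: "(\<And>x. x \<notin> K \<Longrightarrow> \<phi> x = 0) \<Longrightarrow> compact K \<Longrightarrow> x \<notin> K \<Longrightarrow> Xg \<phi> x = 0"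
  unfolding Xg_def vec_eq_iff using Xd_zero_outside[of K \<phi> x] compact_imp_closed[of K] by simp

lemma integrable_indicator_open_bounded:
  fixes B :: "'a::euclidean_space set"
  assumes "open B" "bounded B"
  shows "integrable lebesgue (\<lambda>x. indicator B x :: real)"
  using assms emeasure_bounded_finite[OF assms(2)] by (intro integrable_real_indicator) (auto simp: infinity_ennreal_def)

context integrand
begin

definition "growth_const p = C2 * (norm p powr \<alpha> + 1)"

text \<open>The amount saved with respect to the trivial bound from the growth condition. Unlike the
  infimal energy itself it is superadditive, with no correction for the part of \<open>B\<close> that the pieces
  do not cover.\<close>

definition "gain p B = growth_const p * measure lebesgue B - inf_energy g p B"

lemma integrable_indicator_energy:
  assumes "open B" "bounded B" "\<phi> \<in> test_functions B"
  shows "integrable lebesgue (\<lambda>x. indicator B x * g x (p + Xg \<phi> x))"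
proof -
  have "integrable (lebesgue_on B) (\<lambda>x. g x (p + Xg \<phi> x))"
    by (rule integrable_compose[OF assms(1,2) LpV_test[OF params(3) assms]])
  then show ?thesis using assms(1) by (subst (asm) integrable_restrict_space) auto
qed

lemma inf_energy_nonneg: "0 \<le> inf_energy g p B"
  unfolding inf_energy_def using test_functions_zero energy_nonneg by (intro cINF_greatest) auto

lemma gain_nonneg:
  assumes "open B" "bounded B" shows "0 \<le> gain p B"
proof -
  have "inf_energy g p B \<le> energy g B (\<lambda>x. p + Xg (\<lambda>x. 0) x)"
    by (rule inf_energy_le[OF test_functions_zero])
  also have "Xg (\<lambda>x. 0) = (\<lambda>x. 0)" by (simp add: Xg_def[abs_def] Xd_const vec_eq_iff fun_eq_iff)
  also have "energy g B (\<lambda>x. p + 0) \<le> (LINT x|lebesgue_on B. growth_const p)"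
    unfolding energy_def
  proof (rule integral_mono)
    interpret finite_measure "lebesgue_on B" by (rule finite_measure_lebesgue_on[OF assms])
    show "integrable (lebesgue_on B) (\<lambda>x. growth_const p)" by simp
    show "integrable (lebesgue_on B) (\<lambda>x. g x (p + 0))"
      by (rule integrable_compose[OF assms]) (simp add: LpV_def)
  qed (simp add: growth_const_def upper)
  also have "\<dots> = growth_const p * measure lebesgue B" using assms(1) by (simp add: measure_restrict_space)
  finally show ?thesis by (simp add: gain_def)
qed

lemma gain_le: "gain p B \<le> growth_const p * measure lebesgue B"
  using inf_energy_nonneg by (simp add: gain_def)

text \<open>Near-minimizers on the two pieces extend by zero and can be added, as their supports are
  disjoint. On the rest of \<open>B\<close> the gradient is \<open>p\<close>, which costs at most
  \<open>growth_const p\<close> per volume, and this is what the definition of the gain already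
  allows for.\<close>

lemma gain_superadditive:
  assumes B: "open B" "bounded B" and B1: "open B1" and B2: "open B2"
    and dj: "B1 \<inter> B2 = {}" and sub: "B1 \<union> B2 \<subseteq> B"
  shows "gain p B1 + gain p B2 \<le> gain p B"
proof -
  have bd: "bounded B1" "bounded B2" using bounded_subset[OF B(2)] sub by auto
  let ?C = "growth_const p"
  have "inf_energy g p B \<le> inf_energy g p B1 + inf_energy g p B2 +
      ?C * (measure lebesgue B - measure lebesgue B1 - measure lebesgue B2)"
  proof (rule field_le_epsilon)
    fix e :: real assume "e > 0"
    then have e2: "e / 2 > 0" by simp
    obtain \<phi> where phi: "\<phi> \<in> test_functions B1" "energy g B1 (\<lambda>x. p + Xg \<phi> x) < inf_energy g p B1 + e / 2"
      using inf_energy_approx[OF e2] by blast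
    obtain \<psi> where psi: "\<psi> \<in> test_functions B2" "energy g B2 (\<lambda>x. p + Xg \<psi> x) < inf_energy g p B2 + e / 2"
      using inf_energy_approx[OF e2] by blast
    obtain K where K: "compact K" "K \<subseteq> B1" "\<And>x. x \<notin> K \<Longrightarrow> \<phi> x = 0" using test_function_support[OF phi(1)] by blast
    obtain L where L: "compact L" "L \<subseteq> B2" "\<And>x. x \<notin> L \<Longrightarrow> \<psi> x = 0" using test_function_support[OF psi(1)] by blast
    have zK: "x \<notin> B1 \<Longrightarrow> Xg \<phi> x = 0" for x using Xg_zero_outside[of K \<phi> x, OF K(3,1)] K(2) by blast
    have zL: "x \<notin> B2 \<Longrightarrow> Xg \<psi> x = 0" for x using Xg_zero_outside[of L \<psi> x, OF L(3,1)] L(2) by blast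
    define \<theta> where "\<theta> x = \<phi> x + \<psi> x" for x
    have sub1: "test_functions B1 \<subseteq> test_functions B" "test_functions B2 \<subseteq> test_functions B"
      using sub by (auto intro!: test_functions_mono)
    have th: "\<theta> \<in> test_functions B" unfolding \<theta>_def using phi psi sub1 by (intro test_functions_add) auto
    have X: "Xg \<theta> x = Xg \<phi> x + Xg \<psi> x" for x
      unfolding \<theta>_def by (rule Xg_add[OF test_function_C1[OF phi(1)] test_function_C1[OF psi(1)]])
    have i1: "integrable lebesgue (\<lambda>x. indicator B1 x * g x (p + Xg \<phi> x))"
      by (rule integrable_indicator_energy[OF B1 bd(1) phi(1)])
    have i2: "integrable lebesgue (\<lambda>x. indicator B2 x * g x (p + Xg \<psi> x))"
      by (rule integrable_indicator_energy[OF B2 bd(2) psi(1)])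
    have ii: "integrable lebesgue (\<lambda>x. indicator B x :: real)" "integrable lebesgue (\<lambda>x. indicator B1 x :: real)"
      "integrable lebesgue (\<lambda>x. indicator B2 x :: real)"
      by (intro integrable_indicator_open_bounded B B1 B2 bd)+
    have "energy g B (\<lambda>x. p + Xg \<theta> x) = (LINT x|lebesgue. indicator B x * g x (p + Xg \<theta> x))"
      using B(1) by (intro energy_lebesgue) simp
    also have "\<dots> \<le> (LINT x|lebesgue. indicator B1 x * g x (p + Xg \<phi> x) + indicator B2 x * g x (p + Xg \<psi> x) +
        ?C * (indicator B x - indicator B1 x - indicator B2 x))"
    proof (rule integral_mono)
      show "integrable lebesgue (\<lambda>x. indicator B x * g x (p + Xg \<theta> x))"
        by (rule integrable_indicator_energy[OF B th])
      show "integrable lebesgue (\<lambda>x. indicator B1 x * g x (p + Xg \<phi> x) + indicator B2 x * g x (p + Xg \<psi> x) +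
        ?C * (indicator B x - indicator B1 x - indicator B2 x))"
        by (intro Bochner_Integration.integrable_add integrable_mult_right Bochner_Integration.integrable_diff i1 i2 ii)
      fix x
      consider "x \<in> B1" "x \<notin> B2" "x \<in> B" | "x \<in> B2" "x \<notin> B1" "x \<in> B" | "x \<notin> B1" "x \<notin> B2" "x \<in> B" | "x \<notin> B" "x \<notin> B1" "x \<notin> B2"
        using dj sub by blast
      then show "indicator B x * g x (p + Xg \<theta> x) \<le> indicator B1 x * g x (p + Xg \<phi> x) + indicator B2 x * g x (p + Xg \<psi> x) +
        ?C * (indicator B x - indicator B1 x - indicator B2 x)"
        by cases (use zK[of x] zL[of x] upper[of x p] in \<open>auto simp: X growth_const_def\<close>)
    qed
    also have "\<dots> = energy g B1 (\<lambda>x. p + Xg \<phi> x) + energy g B2 (\<lambda>x. p + Xg \<psi> x) +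
        ?C * (measure lebesgue B - measure lebesgue B1 - measure lebesgue B2)"
      using i1 i2 ii B1 B2 B(1) by (simp add: energy_lebesgue)
    finally show "inf_energy g p B \<le> inf_energy g p B1 + inf_energy g p B2 +
      ?C * (measure lebesgue B - measure lebesgue B1 - measure lebesgue B2) + e"
      using inf_energy_le[OF th, of p] phi(2) psi(2) by linarith
  qed
  then show ?thesis by (simp add: gain_def algebra_simps)
qed

end

subsection \<open>Tilings by dilated lattice translates of the unit box\<close>

lemma Pair_zero_Basis: "u \<in> Basis \<Longrightarrow> (u, 0) \<in> Basis" and Pair_Basis_zero: "v \<in> Basis \<Longrightarrow> (0, v) \<in> Basis"
  by (simp_all add: Basis_prod_def)

lemma ball_Basis_heis:
  "(\<forall>b\<in>(Basis :: 'n::finite heis set). P b) \<longleftrightarrow>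
    (\<forall>i. P (axis i 1, 0, 0)) \<and> (\<forall>i. P (0, axis i 1, 0)) \<and> P (0, 0, 1)"
proof -
  have "(axis i 1, 0, 0) \<in> (Basis :: 'n heis set)" "(0, axis i 1, 0) \<in> (Basis :: 'n heis set)" "(0, 0, 1) \<in> (Basis :: 'n heis set)" for i
    by (intro Pair_zero_Basis[of _ , where 'b = "(real ^ 'n) \<times> real", unfolded zero_prod_def] Pair_Basis_zero Pair_zero_Basis; simp add: axis_in_Basis_iff)+
  then show ?thesis by (metis Basis_heis_cases)
qed

lemma integer_points_iff:
  "(l1, l2, l3) \<in> integer_points \<longleftrightarrow> (\<forall>i. l1 $ i \<in> \<int>) \<and> (\<forall>i. l2 $ i \<in> \<int>) \<and> l3 \<in> \<int>"
  unfolding integer_points_def by (simp add: ball_Basis_heis inner_axis)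

lemma Q_unit_iff:
  "(x1, x2, x3) \<in> Q_unit \<longleftrightarrow> (\<forall>i. -1 \<le> x1 $ i \<and> x1 $ i < 1) \<and> (\<forall>i. -1 \<le> x2 $ i \<and> x2 $ i < 1) \<and> -1 \<le> x3 \<and> x3 < 1"
  unfolding Q_unit_def by (simp add: ball_Basis_heis inner_axis)

definition unit_box :: "'n::finite heis set" where
  "unit_box = box (- One) One"

lemma unit_box_Q_unit: "unit_box \<subseteq> Q_unit" "Q_unit \<subseteq> cbox (- One) (One :: 'n::finite heis)"
  unfolding unit_box_def Q_unit_def subset_iff mem_box mem_Collect_eq by (simp_all add: less_imp_le)

lemma open_unit_box: "open unit_box" and bounded_unit_box: "bounded unit_box"
  by (auto simp: unit_box_def)

lemma negligible_Q_unit: "negligible (Q_unit - (unit_box :: 'n::finite heis set))"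
  by (rule negligible_subset[OF negligible_frontier_interval[of "- One" "One :: 'n heis"]])
    (use unit_box_Q_unit in \<open>auto simp: unit_box_def\<close>)

lemma Q_unit_lebesgue: "(Q_unit :: 'n::finite heis set) \<in> sets lebesgue"
  and measure_Q_unit: "measure lebesgue (Q_unit :: 'n heis set) = measure lebesgue (unit_box :: 'n heis set)"
proof -
  have n: "Q_unit - (unit_box :: 'n heis set) \<in> null_sets lebesgue" using negligible_Q_unit negligible_iff_null_sets by blast
  have u: "(unit_box :: 'n heis set) \<in> sets lebesgue" by (simp add: open_unit_box)
  have e: "(Q_unit :: 'n heis set) = unit_box \<union> (Q_unit - unit_box)" using unit_box_Q_unit(1) by blast
  show "(Q_unit :: 'n heis set) \<in> sets lebesgue" by (subst e) (rule sets.Un[OF u null_setsD2[OF n]])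
  show "measure lebesgue (Q_unit :: 'n heis set) = measure lebesgue (unit_box :: 'n heis set)"
    by (subst e) (rule measure_Un_null_set[OF u n])
qed

lemma measure_unit_box_pos: "measure lebesgue (unit_box :: 'n::finite heis set) > 0"
proof -
  have "measure lborel (box (- One) (One :: 'n heis)) = (\<Prod>b\<in>Basis. (One - (- One :: 'n heis)) \<bullet> b)"
    by (rule measure_lborel_box) simp
  moreover have "(\<Prod>b\<in>Basis. (One - (- One :: 'n heis)) \<bullet> b) > 0"
    by (intro prod_pos) (simp only: inner_diff_left inner_minus_left inner_sum_left_Basis; simp)
  ultimately show ?thesis by (simp add: unit_box_def)
qed

lemma integer_shift_exists:
  fixes t :: real
  obtains l where "l \<in> \<int>" "-1 \<le> t - 2 * l" "t - 2 * l < 1"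
proof
  show "of_int \<lfloor>(t + 1) / 2\<rfloor> \<in> (\<int> :: real set)" by simp
  show "-1 \<le> t - 2 * of_int \<lfloor>(t + 1) / 2\<rfloor>"
    using floor_correct[of "(t + 1) / 2"] by (simp add: field_simps)
  show "t - 2 * of_int \<lfloor>(t + 1) / 2\<rfloor> < 1"
    using floor_correct[of "(t + 1) / 2"] by (simp add: field_simps)
qed

lemma integer_shift_unique:
  fixes l m v w :: real
  assumes "l \<in> \<int>" "m \<in> \<int>" "2 * l + v = 2 * m + w" "-1 \<le> v" "v < 1" "-1 \<le> w" "w < 1"
  shows "l = m"
proof -
  obtain a b where ab: "l = of_int a" "m = of_int b" using assms(1,2) by (auto elim!: Ints_cases)
  have "\<bar>l - m\<bar> < 1" using assms by linarith
  then have "real_of_int \<bar>a - b\<bar> < 1" by (simp add: ab)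
  then have "a = b" by linarith
  then show ?thesis using ab by simp
qed

text \<open>The \<open>s\<close>-dilate of the lattice translate of \<open>B\<close> by
  \<open>2 *\<^sub>R l\<close>. Since dilations are automorphisms, this is the image under a single
  \<open>htrans\<close>, to which the change of variables applies.\<close>

definition tile :: "real \<Rightarrow> 'n::finite heis \<Rightarrow> 'n heis set \<Rightarrow> 'n heis set" where
  "tile s l B = htrans (dil s (2 *\<^sub>R l)) s ` B"

lemma tile_eq: "htrans (dil s (2 *\<^sub>R l)) s w = dil s (heis_mult (2 *\<^sub>R l) w)"
  by (simp add: htrans_def dil_heis_mult)

text \<open>The horizontal shifts are found coordinate by coordinate. They determine the bilinear
  term, and the vertical shift is then again a problem on the line.\<close>

lemma tile_cover:
  assumes "s > 0"
  obtains l where "l \<in> integer_points" "x \<in> tile s l Q_unit"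
proof -
  obtain y1 y2 y3 where y: "dil (1 / s) x = (y1, y2, y3)" by (metis prod_cases3)
  have "\<forall>i. \<exists>l. l \<in> \<int> \<and> -1 \<le> y1 $ i - 2 * l \<and> y1 $ i - 2 * l < 1" using integer_shift_exists by metis
  then obtain m1 where m1: "\<forall>i. m1 i \<in> \<int> \<and> -1 \<le> y1 $ i - 2 * m1 i \<and> y1 $ i - 2 * m1 i < 1" by metis
  have "\<forall>i. \<exists>l. l \<in> \<int> \<and> -1 \<le> y2 $ i - 2 * l \<and> y2 $ i - 2 * l < 1" using integer_shift_exists by metis
  then obtain m2 where m2: "\<forall>i. m2 i \<in> \<int> \<and> -1 \<le> y2 $ i - 2 * m2 i \<and> y2 $ i - 2 * m2 i < 1" by metis
  define l1 l2 where "l1 = (\<chi> i. m1 i)" and "l2 = (\<chi> i. m2 i)"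
  \<comment> \<open>This is the third coordinate of the product of \<open>- (2 *\<^sub>R l)\<close>
    with the point; the 2 of the lattice cancels the half in the group law.\<close>
  obtain l3 where l3: "l3 \<in> \<int>" "-1 \<le> (y3 - (l1 \<bullet> y2 - l2 \<bullet> y1)) - 2 * l3" "(y3 - (l1 \<bullet> y2 - l2 \<bullet> y1)) - 2 * l3 < 1"
    using integer_shift_exists by metis
  define l where "l = (l1, l2, l3)"
  define w where "w = heis_mult (- (2 *\<^sub>R l)) (y1, y2, y3)"
  have "l \<in> integer_points" using m1 m2 l3(1) by (simp add: l_def integer_points_iff l1_def l2_def)
  moreover have "w \<in> Q_unit"
  proof -
    have "w = (y1 - 2 *\<^sub>R l1, y2 - 2 *\<^sub>R l2, (y3 - (l1 \<bullet> y2 - l2 \<bullet> y1)) - 2 * l3)"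
      by (simp add: w_def l_def heis_mult_def algebra_simps add_divide_distrib diff_divide_distrib)
    then show ?thesis using m1 m2 l3 by (simp add: Q_unit_iff l1_def l2_def)
  qed
  moreover have "x = htrans (dil s (2 *\<^sub>R l)) s w"
  proof -
    have "heis_mult (2 *\<^sub>R l) w = dil (1 / s) x" by (simp add: w_def y flip: heis_mult_assoc)
    then show ?thesis using assms by (simp add: tile_eq dil_dil)
  qed
  ultimately show thesis using that by (auto simp: tile_def)
qed

text \<open>The same triangular order as for the covering. Once the horizontal parts of the lattice
  points agree, so do those of \<open>v\<close> and \<open>w\<close>; the bilinear terms then cancel
  and the vertical parts can be compared.\<close>

lemma tile_disjoint:
  assumes s: "s > 0" and l: "l \<in> integer_points" "m \<in> integer_points" and x: "x \<in> tile s l Q_unit" "x \<in> tile s m Q_unit"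
  shows "l = m"
proof -
  obtain v w where v: "v \<in> Q_unit" "x = dil s (heis_mult (2 *\<^sub>R l) v)" and w: "w \<in> Q_unit" "x = dil s (heis_mult (2 *\<^sub>R m) w)"
    using x by (auto simp: tile_def tile_eq)
  have "dil (1 / s) (dil s (heis_mult (2 *\<^sub>R l) v)) = dil (1 / s) (dil s (heis_mult (2 *\<^sub>R m) w))"
    using v(2) w(2) by simp
  then have eq: "heis_mult (2 *\<^sub>R l) v = heis_mult (2 *\<^sub>R m) w" using s by (simp add: dil_dil)
  obtain l1 l2 l3 where l': "l = (l1, l2, l3)" by (metis prod_cases3)
  obtain m1 m2 m3 where m': "m = (m1, m2, m3)" by (metis prod_cases3)
  obtain v1 v2 v3 where v': "v = (v1, v2, v3)" by (metis prod_cases3)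
  obtain w1 w2 w3 where w': "w = (w1, w2, w3)" by (metis prod_cases3)
  have e1: "2 *\<^sub>R l1 + v1 = 2 *\<^sub>R m1 + w1" and e2: "2 *\<^sub>R l2 + v2 = 2 *\<^sub>R m2 + w2"
    using eq by (auto simp: l' m' v' w' heis_mult_def)
  have e3: "2 * l3 + v3 + (l1 \<bullet> v2 - l2 \<bullet> v1) = 2 * m3 + w3 + (m1 \<bullet> w2 - m2 \<bullet> w1)"
    using eq by (auto simp: l' m' v' w' heis_mult_def diff_divide_distrib)
  note lm = l[unfolded l' m' integer_points_iff] and vw = v(1)[unfolded v' Q_unit_iff] w(1)[unfolded w' Q_unit_iff]
  have "l1 $ i = m1 $ i" for i
  proof (rule integer_shift_unique)
    show "2 * l1 $ i + v1 $ i = 2 * m1 $ i + w1 $ i" using arg_cong[OF e1, of "\<lambda>z. z $ i"] by simp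
  qed (use lm vw in blast)+
  then have l1: "l1 = m1" by (simp add: vec_eq_iff)
  have "l2 $ i = m2 $ i" for i
  proof (rule integer_shift_unique)
    show "2 * l2 $ i + v2 $ i = 2 * m2 $ i + w2 $ i" using arg_cong[OF e2, of "\<lambda>z. z $ i"] by simp
  qed (use lm vw in blast)+
  then have l2: "l2 = m2" by (simp add: vec_eq_iff)
  have "v1 = w1" "v2 = w2" using e1 e2 l1 l2 by auto
  then have "2 * l3 + v3 = 2 * m3 + w3" using e3 l1 l2 by simp
  then have "l3 = m3" using lm vw integer_shift_unique by blast
  then show ?thesis using l1 l2 l' m' by simp
qed

lemma measure_tile:
  assumes "s > 0"
  shows "measure lebesgue (tile s l Q_unit) = s ^ (2 * CARD('n) + 2) * measure lebesgue (unit_box :: 'n::finite heis set)"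
    and "tile s (l :: 'n heis) Q_unit \<in> sets lebesgue"
  unfolding tile_def measure_htrans[OF assms Q_unit_lebesgue] measure_Q_unit
  by (rule refl, rule lebesgue_htrans[OF assms Q_unit_lebesgue])

lemma norm_heis_mult_le: "norm (heis_mult u v) \<le> norm u + norm v + norm u * norm v"
proof -
  obtain u1 u2 u3 where u: "u = (u1, u2, u3)" by (metis prod_cases3)
  obtain v1 v2 v3 where v: "v = (v1, v2, v3)" by (metis prod_cases3)
  let ?e = "(u1 \<bullet> v2 - u2 \<bullet> v1) / 2"
  have "norm u1 \<le> norm u" "norm u2 \<le> norm u" "norm v1 \<le> norm v" "norm v2 \<le> norm v"
    unfolding u v using norm_fst_le[of u1 "(u2, u3)"] norm_fst_le[of v1 "(v2, v3)"]
      order_trans[OF norm_fst_le[of u2 u3] norm_snd_le[of "(u2, u3)" u1]]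
      order_trans[OF norm_fst_le[of v2 v3] norm_snd_le[of "(v2, v3)" v1]] by simp_all
  then have "\<bar>u1 \<bullet> v2\<bar> \<le> norm u * norm v" "\<bar>u2 \<bullet> v1\<bar> \<le> norm u * norm v"
    using order_trans[OF Cauchy_Schwarz_ineq2[of u1 v2] mult_mono] order_trans[OF Cauchy_Schwarz_ineq2[of u2 v1] mult_mono]
    by simp_all
  then have e: "\<bar>?e\<bar> \<le> norm u * norm v"
    using abs_triangle_ineq4[of "u1 \<bullet> v2" "u2 \<bullet> v1"] by simp
  have "heis_mult u v = (u + v) + (0, 0, ?e)" by (simp add: u v heis_mult_def)
  then have "norm (heis_mult u v) \<le> norm (u + v) + norm (0 :: real ^ 'a, 0 :: real ^ 'a, ?e)" by (metis norm_triangle_ineq)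
  also have "\<dots> \<le> norm u + norm v + \<bar>?e\<bar>" using norm_triangle_ineq[of u v] by (simp add: norm_Pair)
  finally show ?thesis using e by linarith
qed

lemma norm_dil_le:
  assumes "0 < s" "s \<le> 1"
  shows "norm (dil s v) \<le> s * norm v"
proof -
  obtain v1 v2 v3 where v: "v = (v1, v2, v3)" by (metis prod_cases3)
  have "dil s v = s *\<^sub>R (v1, v2, s * v3)" by (simp add: v dil_def power2_eq_square)
  then have "norm (dil s v) = \<bar>s\<bar> * norm (v1, v2, s * v3)" by (simp only: norm_scaleR)
  then have "norm (dil s v) = s * norm (v1, v2, s * v3)" using assms by simp
  also have "norm (v1, v2, s * v3) \<le> norm v"
  proof -
    have "(s * v3)\<^sup>2 \<le> v3\<^sup>2"
      using assms by (simp add: power_mult_distrib mult_left_le_one_le power_le_one)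
    then show ?thesis by (simp add: v norm_Pair)
  qed
  finally show ?thesis using assms by simp
qed

text \<open>Two points of a tile differ by right multiplication with
  \<open>dil s (heis_mult (- w) w')\<close>, which is uniformly small. Left translation by the fixed
  \<open>x\<close> is continuous at 0, so all tiles through \<open>x\<close> shrink to it, although
  the Euclidean diameter of a tile depends on its position.\<close>

lemma tile_small:
  assumes "\<eta> > 0"
  obtains s0 where "s0 > 0" "\<And>s l. 0 < s \<Longrightarrow> s < s0 \<Longrightarrow> x \<in> tile s l Q_unit \<Longrightarrow> tile s l Q_unit \<subseteq> ball x \<eta>"
proof -
  have "isCont (htrans x 1) 0" using continuous_htrans continuous_on_eq_continuous_at open_UNIV by blast
  then obtain d where d: "d > 0" "\<And>h. norm h < d \<Longrightarrow> dist (htrans x 1 h) (htrans x 1 0) < \<eta>"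
    using assms unfolding continuous_at_eps_delta by (metis diff_zero dist_norm)
  have d2: "dist (heis_mult x h) x < \<eta>" if "norm h < d" for h
    using d(2)[OF that] by (simp add: htrans_def)
  have "bounded (Q_unit :: 'a heis set)" using unit_box_Q_unit(2) bounded_cbox bounded_subset by blast
  then obtain R where R: "R > 0" "\<And>w :: 'a heis. w \<in> Q_unit \<Longrightarrow> norm w \<le> R" unfolding bounded_pos by blast
  \<comment> \<open>The bound of \<open>norm_heis_mult_le\<close> for two factors of norm at most
    \<open>R\<close>.\<close>
  define M where "M = R + R + R * R"
  have M: "M > 0" using R(1) by (simp add: M_def add_pos_pos)
  show thesis
  proof (rule that)
    show "min 1 (d / M) > 0" using d M by simp
    fix s l assume s: "0 < s" "s < min 1 (d / M)" and x: "x \<in> tile s l Q_unit"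
    obtain w where w: "w \<in> Q_unit" "x = heis_mult (dil s (2 *\<^sub>R l)) (dil s w)" using x by (auto simp: tile_def htrans_def)
    show "tile s l Q_unit \<subseteq> ball x \<eta>"
    proof
      fix y assume "y \<in> tile s l Q_unit"
      then obtain w' where w': "w' \<in> Q_unit" "y = heis_mult (dil s (2 *\<^sub>R l)) (dil s w')" by (auto simp: tile_def htrans_def)
      have "heis_mult x (dil s (heis_mult (- w) w')) = y"
        by (simp add: w(2) w'(2) dil_heis_mult heis_mult_assoc dil_minus)
          (simp flip: heis_mult_assoc)
      moreover have "norm (dil s (heis_mult (- w) w')) < d"
      proof -
        have "norm (heis_mult (- w) w') \<le> M"
          using norm_heis_mult_le[of "- w" w'] R(2)[OF w(1)] R(2)[OF w'(1)] R(1)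
            mult_mono[of "norm w" R "norm w'" R] by (simp add: M_def)
        then have "norm (dil s (heis_mult (- w) w')) \<le> s * M"
          using s by (intro order_trans[OF norm_dil_le] mult_left_mono) auto
        also have "\<dots> < d" using s M by (simp add: field_simps)
        finally show ?thesis .
      qed
      ultimately show "y \<in> ball x \<eta>" using d2 by (metis dist_commute mem_ball)
    qed
  qed
qed

definition inner_tiles :: "real \<Rightarrow> 'n::finite heis set \<Rightarrow> 'n heis set" where
  "inner_tiles s A = {l \<in> integer_points. tile s l Q_unit \<subseteq> A}"

lemma measure_tiles_union:
  fixes F :: "'n::finite heis set"
  assumes "s > 0" "finite F" "F \<subseteq> integer_points"
  shows "measure lebesgue (\<Union>l\<in>F. tile s l Q_unit) =
    real (card F) * (s ^ (2 * CARD('n) + 2) * measure lebesgue (unit_box :: 'n heis set))"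
proof -
  have fin: "emeasure lebesgue (tile s l Q_unit) \<noteq> \<infinity>" for l :: "'n heis"
  proof -
    have "measure lebesgue (tile s l Q_unit) > 0"
      using assms(1) measure_unit_box_pos[where 'n = 'n] by (simp add: measure_tile)
    then show ?thesis by (auto simp: measure_def)
  qed
  have "measure lebesgue (\<Union>l\<in>F. tile s l Q_unit) = (\<Sum>l\<in>F. measure lebesgue (tile s l Q_unit))"
  proof (intro measure_finite_Union fin assms(2))
    show "(\<lambda>l. tile s l Q_unit) ` F \<subseteq> sets lebesgue" using measure_tile(2)[OF assms(1)] by blast
    show "disjoint_family_on (\<lambda>l. tile s l Q_unit) F"
      unfolding disjoint_family_on_def
    proof (intro ballI impI equals0I)
      fix l m x assume "l \<in> F" "m \<in> F" "l \<noteq> m" "x \<in> tile s l Q_unit \<inter> tile s m Q_unit"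
      then show False using tile_disjoint[OF assms(1), of l m x] assms(3) by auto
    qed
  qed
  then show ?thesis using assms(1) by (simp add: measure_tile)
qed

text \<open>Inner tiles are disjoint and have equal positive measure, so a ratio of volumes bounds
  their number.\<close>

lemma finite_inner_tiles:
  fixes A :: "'n::finite heis set"
  assumes "s > 0" "open A" "bounded A"
  shows "finite (inner_tiles s A)"
proof -
  define m where "m = s ^ (2 * CARD('n) + 2) * measure lebesgue (unit_box :: 'n heis set)"
  have m: "m > 0" using assms(1) measure_unit_box_pos[where 'n = 'n] by (simp add: m_def)
  have A: "A \<in> lmeasurable" using assms by (simp add: lmeasurable_open)
  show ?thesis
  proof (rule finite_if_finite_subsets_card_bdd[THEN conjunct1])
    fix F assume F: "F \<subseteq> inner_tiles s A" "finite F"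
    have "real (card F) * m = measure lebesgue (\<Union>l\<in>F. tile s l Q_unit)"
      unfolding m_def using F by (intro measure_tiles_union[symmetric] assms(1)) (auto simp: inner_tiles_def)
    also have "\<dots> \<le> measure lebesgue A"
      using F assms(1) A by (intro measure_mono_fmeasurable sets.finite_UN) (auto simp: inner_tiles_def measure_tile(2))
    finally have "real (card F) \<le> measure lebesgue A / m" using m by (simp add: field_simps)
    then show "card F \<le> nat \<lfloor>measure lebesgue A / m\<rfloor>" by linarith
  qed
qed

text \<open>A point of \<open>A\<close> lies in some tile of every scale, and by
  \<open>tile_small\<close> that tile is contained in \<open>A\<close> once the scale is small. The
  indicators of the unions thus converge pointwise, and dominated convergence gives the
  volumes.\<close>

lemma inner_tiles_exhaust:
  fixes A :: "'n::finite heis set"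
  assumes A: "open A" "bounded A" and s: "\<And>j. s j > 0" "s \<longlonglongrightarrow> 0"
  shows "(\<lambda>j. real (card (inner_tiles (s j) A)) * (s j ^ (2 * CARD('n) + 2) * measure lebesgue (unit_box :: 'n heis set)))
    \<longlonglongrightarrow> measure lebesgue A"
proof -
  define U where "U j = (\<Union>l\<in>inner_tiles (s j) A. tile (s j) l Q_unit)" for j
  have fin: "finite (inner_tiles (s j) A)" for j by (rule finite_inner_tiles[OF s(1) A])
  have Um: "U j \<in> sets lebesgue" for j
    unfolding U_def by (rule sets.finite_UN[OF fin measure_tile(2)[OF s(1)]])
  have UA: "U j \<subseteq> A" for j by (auto simp: U_def inner_tiles_def)
  have "(\<lambda>j. LINT x|lebesgue. indicator (U j) x :: real) \<longlonglongrightarrow> (LINT x|lebesgue. indicator A x)"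
  proof (rule integral_dominated_convergence)
    show "integrable lebesgue (\<lambda>x. indicator A x :: real)" by (rule integrable_indicator_open_bounded[OF A])
    show "AE x in lebesgue. (\<lambda>j. indicator (U j) x :: real) \<longlonglongrightarrow> indicator A x"
    proof (rule AE_I2)
      fix x
      show "(\<lambda>j. indicator (U j) x :: real) \<longlonglongrightarrow> indicator A x"
      proof (cases "x \<in> A")
        case False
        then have "indicator (U j) x = (indicator A x :: real)" for j using UA by (auto simp: indicator_def)
        then show ?thesis by simp
      next
        case True
        then obtain \<eta> where eta: "\<eta> > 0" "ball x \<eta> \<subseteq> A" using A(1) open_contains_ball by blast
        obtain s0 where s0: "s0 > 0" "\<forall>s l. 0 < s \<longrightarrow> s < s0 \<longrightarrow> x \<in> tile s l Q_unit \<longrightarrow> tile s l Q_unit \<subseteq> ball x \<eta>"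
          by (rule tile_small[OF eta(1), of x]) blast
        have "\<forall>\<^sub>F j in sequentially. s j < s0" by (rule order_tendstoD(2)[OF s(2) s0(1)])
        then have "\<forall>\<^sub>F j in sequentially. indicator (U j) x = (indicator A x :: real)"
        proof eventually_elim
          case (elim j)
          obtain l where l: "l \<in> integer_points" "x \<in> tile (s j) l Q_unit" by (rule tile_cover[OF s(1)])
          then have "l \<in> inner_tiles (s j) A" using s0(2) s(1) elim eta(2) unfolding inner_tiles_def by blast
          then have "x \<in> U j" using l by (auto simp: U_def)
          then show ?case using True by simp
        qed
        then show ?thesis by (rule tendsto_eventually)
      qed
    qed
    show "AE x in lebesgue. norm (indicator (U j) x :: real) \<le> indicator A x" for j
      using UA by (intro AE_I2) (auto simp: indicator_def)
    show "(\<lambda>x. indicator A x :: real) \<in> borel_measurable lebesgue" using A(1) by (intro borel_measurable_indicator) simp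
    show "(\<lambda>x. indicator (U j) x :: real) \<in> borel_measurable lebesgue" for j by (intro borel_measurable_indicator Um)
  qed
  then show ?thesis
    using measure_tiles_union[OF s(1) fin] by (simp add: U_def inner_tiles_def)
qed

subsection \<open>Asymptotics of superadditive set functions\<close>

lemma dil_htrans: "dil t = htrans 0 t"
  by (simp add: fun_eq_iff htrans_def)

lemma open_dil: "t > 0 \<Longrightarrow> open B \<Longrightarrow> open (dil t ` B)"
  unfolding dil_htrans by (rule open_htrans)

lemma bounded_dil: "bounded B \<Longrightarrow> bounded (dil t ` B)"
  unfolding dil_htrans by (rule bounded_htrans)

lemma measure_dil_unit_box:
  assumes "t > 0"
  shows "measure lebesgue (dil t ` unit_box :: 'n::finite heis set) =
    t ^ (2 * CARD('n) + 2) * measure lebesgue (unit_box :: 'n heis set)"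
  unfolding dil_htrans by (rule measure_htrans[OF assms]) (simp add: open_unit_box)

lemma unit_box_iff:
  "(x1, x2, x3) \<in> unit_box \<longleftrightarrow> (\<forall>i. \<bar>x1 $ i\<bar> < 1) \<and> (\<forall>i. \<bar>x2 $ i\<bar> < 1) \<and> \<bar>x3\<bar> < 1"
proof -
  have "(x1, x2, x3) \<in> unit_box \<longleftrightarrow> (\<forall>b\<in>Basis. -1 < (x1, x2, x3) \<bullet> b \<and> (x1, x2, x3) \<bullet> b < 1)"
    unfolding unit_box_def mem_box by simp
  also have "\<dots> \<longleftrightarrow> (\<forall>i. \<bar>x1 $ i\<bar> < 1) \<and> (\<forall>i. \<bar>x2 $ i\<bar> < 1) \<and> \<bar>x3\<bar> < 1"
    unfolding ball_Basis_heis by (simp add: inner_axis abs_less_iff) (auto simp: less_minus_iff minus_less_iff)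
  finally show ?thesis .
qed

lemma dil_unit_box_mono:
  assumes "0 < s" "s \<le> t"
  shows "dil s ` unit_box \<subseteq> dil t ` unit_box"
proof
  fix x assume "x \<in> dil s ` unit_box"
  then obtain w1 w2 w3 where w: "(w1, w2, w3) \<in> unit_box" "x = dil s (w1, w2, w3)" by (metis imageE prod_cases3)
  define r where "r = s / t"
  have c: "0 \<le> r" "r \<le> 1" using assms by (auto simp: r_def)
  have less: "\<bar>r * y\<bar> < 1" if "0 \<le> r" "r \<le> 1" "\<bar>y\<bar> < 1" for r y :: real
    using that mult_left_le_one_le[of "\<bar>y\<bar>" r] by (simp add: abs_mult)
  have "dil r (w1, w2, w3) \<in> unit_box"
    using w(1) c less power_le_one[OF c, of 2] by (simp add: dil_def unit_box_iff)
  moreover have "x = dil t (dil r (w1, w2, w3))" using assms w(2) by (simp add: dil_dil r_def)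
  ultimately show "x \<in> dil t ` unit_box" by blast
qed

lemma ball_subset_dil_unit_box:
  assumes "t \<ge> 1" "norm x < t"
  shows "x \<in> dil t ` unit_box"
proof -
  obtain w1 w2 w3 where w: "dil (1 / t) x = (w1, w2, w3)" by (metis prod_cases3)
  have "norm (dil (1 / t) x) \<le> 1 / t * norm x" using assms by (intro norm_dil_le) auto
  also have "\<dots> < 1" using assms by (simp add: field_simps)
  finally have n: "norm (w1, w2, w3) < 1" by (simp add: w)
  have "norm w1 < 1" "norm w2 < 1" "\<bar>w3\<bar> < 1"
    using n norm_fst_le[of w1 "(w2, w3)"] norm_fst_le[of w2 w3] norm_snd_le[of w3 w2] norm_snd_le[of "(w2, w3)" w1]
    by auto
  then have "(w1, w2, w3) \<in> unit_box"
    unfolding unit_box_iff using le_less_trans[OF component_le_norm_cart] by blast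
  moreover have "x = dil t (w1, w2, w3)" using assms by (simp flip: w add: dil_dil)
  ultimately show ?thesis by blast
qed

text \<open>The part of the homogenization argument in which no energy occurs. It is instantiated
  with \<open>gain p\<close> for every slope \<open>p\<close>.\<close>

locale superadditive_gain =
  fixes N :: "'n::finite heis set \<Rightarrow> real" and C :: real
  assumes nonneg: "\<And>B. open B \<Longrightarrow> bounded B \<Longrightarrow> 0 \<le> N B"
    and le: "\<And>B. open B \<Longrightarrow> bounded B \<Longrightarrow> N B \<le> C * measure lebesgue B"
    and super: "\<And>B B1 B2. open B \<Longrightarrow> bounded B \<Longrightarrow> open B1 \<Longrightarrow> open B2 \<Longrightarrow> B1 \<inter> B2 = {} \<Longrightarrow>
      B1 \<union> B2 \<subseteq> B \<Longrightarrow> N B1 + N B2 \<le> N B"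
    and periodic: "\<And>B k. open B \<Longrightarrow> bounded B \<Longrightarrow> k \<in> integer_points \<Longrightarrow> N (htrans (2 *\<^sub>R k) 1 ` B) = N B"
begin

abbreviation (input) vol :: "'n heis set \<Rightarrow> real" where
  "vol \<equiv> measure lebesgue"

definition rate :: "nat \<Rightarrow> real" where
  "rate k = N (dil (real k) ` unit_box) / measure lebesgue (dil (real k) ` unit_box :: 'n heis set)"

definition sup_rate :: real where
  "sup_rate = (SUP k\<in>{1..}. rate k)"

lemma sum_le:
  assumes "finite F" "\<And>l. l \<in> F \<Longrightarrow> open (T l)" "disjoint_family_on T F" "open B" "bounded B" "\<Union>(T ` F) \<subseteq> B"
  shows "(\<Sum>l\<in>F. N (T l)) \<le> N B"
  using assms
proof (induction F arbitrary: B rule: finite_induct)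
  case empty
  then show ?case using nonneg by simp
next
  case (insert l F)
  have o: "open (\<Union>(T ` F))" using insert.prems(1) by (intro open_UN ballI) simp
  have b: "bounded (\<Union>(T ` F))" by (rule bounded_subset[OF insert.prems(4)]) (use insert.prems(5) in blast)
  have "(\<Sum>l\<in>F. N (T l)) \<le> N (\<Union>(T ` F))"
  proof (rule insert.IH[OF _ _ o b])
    show "open (T m)" if "m \<in> F" for m by (rule insert.prems(1)[OF insertI2[OF that]])
    show "disjoint_family_on T F"
      by (rule disjoint_family_on_mono[OF _ insert.prems(2)]) (rule subset_insertI)
  qed (rule order_refl)
  moreover have "N (T l) + N (\<Union>(T ` F)) \<le> N B"
  proof (rule super[OF insert.prems(3,4) _ o])
    have "T l \<inter> T m = {}" if "m \<in> F" for m
      using insert.prems(2) insert.hyps(2) that by (intro disjoint_family_onD[OF insert.prems(2)]) auto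
    then show "T l \<inter> \<Union>(T ` F) = {}" by blast
    show "open (T l)" using insert.prems(1) by simp
    show "T l \<union> \<Union>(T ` F) \<subseteq> B" using insert.prems(5) by blast
  qed
  ultimately show ?case using insert.hyps by simp
qed

lemma rate_eq: "k \<ge> 1 \<Longrightarrow> N (dil (real k) ` unit_box) = rate k * (real k ^ (2 * CARD('n) + 2) * vol unit_box)"
  using measure_unit_box_pos[where 'n = 'n] by (simp add: rate_def measure_dil_unit_box)

lemma rate_bounds:
  assumes "k \<ge> 1" shows "0 \<le> rate k" "rate k \<le> C"
proof -
  have k: "real k > 0" using assms by simp
  have o: "open (dil (real k) ` unit_box)" "bounded (dil (real k) ` unit_box)"
    by (rule open_dil[OF k open_unit_box], rule bounded_dil[OF bounded_unit_box])
  have m: "measure lebesgue (dil (real k) ` unit_box :: 'n heis set) > 0"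
    using k measure_unit_box_pos[where 'n = 'n] by (simp add: measure_dil_unit_box)
  show "0 \<le> rate k" using nonneg[OF o] m by (simp add: rate_def)
  show "rate k \<le> C" using le[OF o] m by (simp add: rate_def field_simps)
qed

lemma rate_le_sup: "k \<ge> 1 \<Longrightarrow> rate k \<le> sup_rate"
  unfolding sup_rate_def using rate_bounds(2) by (intro cSUP_upper bdd_aboveI2[of _ _ C]) auto

lemma sup_rate_nonneg: "0 \<le> sup_rate"
  using rate_bounds(1)[of 1] rate_le_sup[of 1] by simp

lemma rate_near_sup:
  assumes "e > 0" obtains k where "k \<ge> 1" "sup_rate - e < rate k"
proof -
  have "sup_rate - e < (SUP k\<in>{1..}. rate k)" using assms by (simp add: sup_rate_def)
  then show thesis
    using that rate_bounds(2) by (subst (asm) less_cSUP_iff) (auto intro: bdd_aboveI2[of _ _ C])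
qed

text \<open>Dilation by \<open>1 / e\<close> turns inner tiles of \<open>A\<close> at scale
  \<open>real k * e\<close> into lattice translates of the cell of size \<open>k\<close>. By
  periodicity all of these have the same gain, and superadditivity sums them up.\<close>

lemma tiles_lower_bound:
  assumes A: "open A" "bounded A" and e: "e > 0" and k: "k \<ge> 1"
  shows "real (card (inner_tiles (real k * e) A)) * ((real k * e) ^ (2 * CARD('n) + 2) * vol unit_box) * rate k \<le> e ^ (2 * CARD('n) + 2) * N (dil (1 / e) ` A)"
proof -
  define F where "F = inner_tiles (real k * e) A"
  \<comment> \<open>Superadditivity concerns open sets, so the open boxes are used; they are
    disjoint as subsets of the half-open tiles.\<close>
  define T where "T l = tile (real k) l unit_box" for l :: "'n heis"
  have kp: "real k > 0" "real k * e > 0" using k e by auto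
  have fin: "finite F" unfolding F_def by (rule finite_inner_tiles[OF kp(2) A])
  have int: "l \<in> integer_points" if "l \<in> F" for l using that by (simp add: F_def inner_tiles_def)
  have "(\<Sum>l\<in>F. N (T l)) \<le> N (dil (1 / e) ` A)"
  proof (rule sum_le[OF fin])
    show "open (T l)" for l unfolding T_def tile_def by (rule open_htrans[OF kp(1) open_unit_box])
    have TQ: "T l \<subseteq> tile (real k) l Q_unit" for l
      unfolding T_def tile_def using unit_box_Q_unit(1) by (rule image_mono)
    show "disjoint_family_on T F"
      unfolding disjoint_family_on_def
    proof (intro ballI impI equals0I)
      fix l m x assume "l \<in> F" "m \<in> F" "l \<noteq> m" "x \<in> T l \<inter> T m"
      then show False using tile_disjoint[OF kp(1), of l m x] int TQ by blast
    qed
    show "open (dil (1 / e) ` A)" "bounded (dil (1 / e) ` A)"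
      using open_dil[OF _ A(1), of "1 / e"] bounded_dil[OF A(2)] e by auto
    show "\<Union>(T ` F) \<subseteq> dil (1 / e) ` A"
    proof
      fix y assume "y \<in> \<Union>(T ` F)"
      then obtain l w where l: "l \<in> F" "w \<in> unit_box" "y = dil (real k) (heis_mult (2 *\<^sub>R l) w)"
        by (auto simp: T_def tile_def tile_eq)
      have "dil (real k * e) (heis_mult (2 *\<^sub>R l) w) \<in> tile (real k * e) l Q_unit"
        using l(2) unit_box_Q_unit(1) unfolding tile_def tile_eq[symmetric] by blast
      then have "dil (real k * e) (heis_mult (2 *\<^sub>R l) w) \<in> A" using l(1) by (auto simp: F_def inner_tiles_def)
      moreover have "y = dil (1 / e) (dil (real k * e) (heis_mult (2 *\<^sub>R l) w))"
        using e l(3) by (simp add: dil_dil)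
      ultimately show "y \<in> dil (1 / e) ` A" by blast
    qed
  qed
  moreover have "N (T l) = N (dil (real k) ` unit_box)" if "l \<in> F" for l
  proof -
    \<comment> \<open>An integer dilation maps the lattice into itself: coordinates are multiplied
      by \<open>k\<close> or by its square.\<close>
    have "dil (real k) l \<in> integer_points"
      using int[OF that] by (cases l) (simp add: dil_def integer_points_iff)
    moreover have "T l = htrans (2 *\<^sub>R dil (real k) l) 1 ` dil (real k) ` unit_box"
      unfolding T_def tile_def image_image
    proof (rule image_cong[OF refl])
      fix w :: "'n heis"
      have "dil (real k) (2 *\<^sub>R l) = 2 *\<^sub>R dil (real k) l" by (cases l) (simp add: dil_def)
      then show "htrans (dil (real k) (2 *\<^sub>R l)) (real k) w = htrans (2 *\<^sub>R dil (real k) l) 1 (dil (real k) w)"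
        by (simp add: htrans_def)
    qed
    ultimately show ?thesis
      using periodic[OF open_dil[OF kp(1) open_unit_box] bounded_dil[OF bounded_unit_box]] by simp
  qed
  ultimately have "real (card F) * N (dil (real k) ` unit_box) \<le> N (dil (1 / e) ` A)" by simp
  then have "e ^ (2 * CARD('n) + 2) * (real (card F) * N (dil (real k) ` unit_box)) \<le> e ^ (2 * CARD('n) + 2) * N (dil (1 / e) ` A)"
    using e by (intro mult_left_mono) auto
  then show ?thesis
    unfolding rate_eq[OF k] F_def[symmetric] by (simp add: power_mult_distrib ac_simps)
qed

text \<open>A cell whose rate is within \<open>\<delta>\<close> of the supremum is fixed first. Then
  the scale tends to zero and tiles made of that cell exhaust the volume of
  \<open>A\<close>.\<close>

lemma scaled_gain_eventually_ge:
  assumes A: "open A" "bounded A" and s: "\<And>j. s j > 0" "s \<longlonglongrightarrow> 0" and e: "e > 0"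
  shows "\<forall>\<^sub>F j in sequentially. sup_rate * measure lebesgue A - e < s j ^ (2 * CARD('n) + 2) * N (dil (1 / s j) ` A)"
proof -
  define \<delta> where "\<delta> = e / (measure lebesgue A + 1)"
  have p: "measure lebesgue A + 1 > 0" by (smt (verit) measure_nonneg)
  have d: "\<delta> > 0" using e p by (simp add: \<delta>_def)
  have dA: "\<delta> * measure lebesgue A < e"
  proof -
    have "\<delta> * measure lebesgue A < \<delta> * (measure lebesgue A + 1)" using d by (intro mult_strict_left_mono) auto
    then show ?thesis using p by (simp add: \<delta>_def)
  qed
  obtain k where k: "k \<ge> 1" "sup_rate - \<delta> < rate k" using rate_near_sup[OF d] by blast
  have kp: "real k > 0" using k by simp
  have "(\<lambda>j. real k * s j) \<longlonglongrightarrow> 0" using tendsto_mult_right_zero[OF s(2)] .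
  from tendsto_mult_right[OF inner_tiles_exhaust[OF A _ this], of "rate k"]
  have "(\<lambda>j. real (card (inner_tiles (real k * s j) A)) * ((real k * s j) ^ (2 * CARD('n) + 2) * vol unit_box) * rate k) \<longlonglongrightarrow> measure lebesgue A * rate k"
    using kp s(1) by (simp add: mult.commute)
  moreover have "sup_rate * measure lebesgue A - e < measure lebesgue A * rate k"
  proof -
    have "(sup_rate - \<delta>) * measure lebesgue A \<le> rate k * measure lebesgue A" using k(2) by (intro mult_right_mono) auto
    then show ?thesis using dA by (simp add: left_diff_distrib mult.commute)
  qed
  ultimately have "\<forall>\<^sub>F j in sequentially. sup_rate * measure lebesgue A - e <
      real (card (inner_tiles (real k * s j) A)) * ((real k * s j) ^ (2 * CARD('n) + 2) * vol unit_box) * rate k"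
    by (rule order_tendstoD(1))
  then show ?thesis
    using tiles_lower_bound[OF A s(1) k(1)] by (auto elim!: eventually_mono intro: less_le_trans)
qed

text \<open>An analogue of Fekete's lemma. No rate exceeds the supremum, and the lower bound for the
  unit box at scale \<open>1 / real (Suc j)\<close> pushes the rates up to it. The shift by
  \<open>Suc\<close> avoids the degenerate cell of size 0.\<close>

theorem rate_tendsto: "rate \<longlonglongrightarrow> sup_rate"
proof (rule LIMSEQ_imp_Suc, rule LIMSEQ_I)
  fix e :: real assume e: "e > 0"
  have Vpos: "vol unit_box > 0" by (rule measure_unit_box_pos)
  have "\<forall>\<^sub>F j in sequentially. sup_rate * vol unit_box - e * vol unit_box <
      (1 / real (Suc j)) ^ (2 * CARD('n) + 2) * N (dil (1 / (1 / real (Suc j))) ` unit_box)"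
    using Vpos e by (intro scaled_gain_eventually_ge open_unit_box bounded_unit_box LIMSEQ_Suc[OF lim_1_over_n]) auto
  then obtain j0 where j0: "\<And>j. j \<ge> j0 \<Longrightarrow> sup_rate * vol unit_box - e * vol unit_box <
      (1 / real (Suc j)) ^ (2 * CARD('n) + 2) * N (dil (1 / (1 / real (Suc j))) ` unit_box)"
    unfolding eventually_sequentially by blast
  show "\<exists>no. \<forall>j\<ge>no. norm (rate (Suc j) - sup_rate) < e"
  proof (intro exI[of _ j0] allI impI)
    fix j assume "j \<ge> j0"
    have "(1 / real (Suc j)) ^ (2 * CARD('n) + 2) * N (dil (1 / (1 / real (Suc j))) ` unit_box) = rate (Suc j) * vol unit_box"
      using rate_eq[of "Suc j"] by (simp only: power_one_over) (simp del: of_nat_Suc power_Suc)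
    then have "(sup_rate - e) * vol unit_box < rate (Suc j) * vol unit_box" using j0[OF \<open>j \<ge> j0\<close>] by (simp add: left_diff_distrib)
    then have "sup_rate - e < rate (Suc j)" using Vpos by simp
    moreover have "rate (Suc j) \<le> sup_rate" by (rule rate_le_sup) simp
    ultimately show "norm (rate (Suc j) - sup_rate) < e" by simp
  qed
qed

text \<open>The lower bound comes from tiling \<open>A\<close>. The upper bound is the lower bound for the complement of
  \<open>A\<close> in a large box, since the gain of the box is at most \<open>sup_rate\<close> times its volume.\<close>

theorem scaled_gain_tendsto:
  assumes A: "open A" "bounded A" and fr: "negligible (frontier A)" and s: "\<And>j. s j > 0" "s \<longlonglongrightarrow> 0"
  shows "(\<lambda>j. s j ^ (2 * CARD('n) + 2) * N (dil (1 / s j) ` A)) \<longlonglongrightarrow> sup_rate * measure lebesgue A"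
proof -
  obtain R where R: "\<And>x. x \<in> closure A \<Longrightarrow> norm x \<le> R"
    using bounded_closure[OF A(2)] unfolding bounded_iff by blast
  \<comment> \<open>Chosen so that the box of size \<open>t\<close> contains the closure of
    \<open>A\<close>; \<open>ball_subset_dil_unit_box\<close> asks for a size at least 1 that
    exceeds all norms.\<close>
  define t where "t = max 1 R + 1"
  have t: "t \<ge> 1" "t > 0" "R < t" by (auto simp: t_def)
  define Q where "Q = (dil t ` unit_box :: 'n heis set)"
  define A' where "A' = Q - closure A"
  have Q: "open Q" "bounded Q"
    unfolding Q_def by (rule open_dil[OF t(2) open_unit_box], rule bounded_dil[OF bounded_unit_box])
  have clQ: "closure A \<subseteq> Q"
    unfolding Q_def using R t by (intro subsetI ball_subset_dil_unit_box) (auto intro: le_less_trans)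
  have A': "open A'" "bounded A'"
    unfolding A'_def by (rule open_Diff[OF Q(1) closed_closure], rule bounded_subset[OF Q(2) Diff_subset])
  have AA': "A \<inter> A' = {}" "A \<union> A' \<subseteq> Q" using clQ closure_subset[of A] by (auto simp: A'_def)
  have vol: "measure lebesgue Q = measure lebesgue A + measure lebesgue A'"
  proof -
    have "Q = (A \<union> A') \<union> frontier A"
      using clQ closure_subset[of A] A(1) by (auto simp: A'_def frontier_def interior_open)
    then have "measure lebesgue Q = measure lebesgue (A \<union> A')"
      using measure_Un_null_set[of "A \<union> A'" lebesgue "frontier A"] A(1) A'(1) fr
      by (simp add: negligible_iff_null_sets)
    also have "\<dots> = measure lebesgue A + measure lebesgue A'"
    proof -
      have "A' - A = A'" using AA'(1) by blast
      then show ?thesis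
        using measure_Un2[OF lmeasurable_open[OF A(2,1)] lmeasurable_open[OF A'(2,1)]] by simp
    qed
    finally show ?thesis .
  qed
  have upper: "s j ^ (2 * CARD('n) + 2) * N (dil (1 / s j) ` A) + s j ^ (2 * CARD('n) + 2) * N (dil (1 / s j) ` A') \<le> sup_rate * ((t + s j) ^ (2 * CARD('n) + 2) * vol unit_box)" for j
  proof -
    \<comment> \<open>Rates are bounded by \<open>sup_rate\<close> for integer sizes, so the box of
      size \<open>t / s j\<close> is enlarged to the next integer. After rescaling this costs at
      most the step from \<open>t\<close> to \<open>t + s j\<close>, which disappears in the
      limit.\<close>
    define K where "K = nat \<lceil>t / s j\<rceil>"
    have tp: "t / s j > 0" using t s(1) by simp
    then have Kc: "real K = of_int \<lceil>t / s j\<rceil>" by (simp add: K_def)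
    have K: "t / s j \<le> real K" "real K \<le> t / s j + 1"
      using ceiling_correct[of "t / s j"] unfolding Kc by simp_all
    have K1: "K \<ge> 1" using K(1) tp by (cases K) auto
    have K2: "real K * s j \<le> t + s j" using K(2) s(1)[of j] by (simp add: field_simps)
    have inv: "1 / s j > 0" using s(1) by simp
    have sub: "dil (1 / s j) ` A \<union> dil (1 / s j) ` A' \<subseteq> dil (real K) ` unit_box"
    proof -
      have "dil (1 / s j) ` A \<union> dil (1 / s j) ` A' \<subseteq> dil (1 / s j) ` Q" using AA'(2) by blast
      also have "dil (1 / s j) ` Q = dil (t / s j) ` unit_box" by (simp add: Q_def image_image dil_dil)
      also have "\<dots> \<subseteq> dil (real K) ` unit_box" using K(1) t s(1) by (intro dil_unit_box_mono) auto
      finally show ?thesis .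
    qed
    have inj: "inj (dil (1 / s j) :: 'n heis \<Rightarrow> 'n heis)"
    proof (rule inj_on_inverseI[of _ "dil (s j)"])
      show "dil (s j) (dil (1 / s j) x) = x" for x :: "'n heis" using s(1)[of j] by (simp add: dil_dil)
    qed
    have "N (dil (1 / s j) ` A) + N (dil (1 / s j) ` A') \<le> N (dil (real K) ` unit_box)"
    proof (rule super)
      show "open (dil (real K) ` unit_box)" "bounded (dil (real K) ` unit_box)"
        using K1 by (auto intro!: open_dil bounded_dil open_unit_box bounded_unit_box)
      show "open (dil (1 / s j) ` A)" "open (dil (1 / s j) ` A')"
        by (rule open_dil[OF inv A(1)], rule open_dil[OF inv A'(1)])
      show "dil (1 / s j) ` A \<inter> dil (1 / s j) ` A' = {}"
        using image_Int[OF inj, of A A'] AA'(1) by simp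
    qed (fact sub)
    also have "\<dots> = rate K * (real K ^ (2 * CARD('n) + 2) * vol unit_box)" by (rule rate_eq[OF K1])
    also have "\<dots> \<le> sup_rate * (real K ^ (2 * CARD('n) + 2) * vol unit_box)" using rate_le_sup[OF K1] by (intro mult_right_mono) auto
    finally have "s j ^ (2 * CARD('n) + 2) * (N (dil (1 / s j) ` A) + N (dil (1 / s j) ` A')) \<le> s j ^ (2 * CARD('n) + 2) * (sup_rate * (real K ^ (2 * CARD('n) + 2) * vol unit_box))"
      using s(1)[of j] by (intro mult_left_mono) auto
    also have "\<dots> = sup_rate * ((real K * s j) ^ (2 * CARD('n) + 2) * vol unit_box)" by (simp add: power_mult_distrib ac_simps)
    also have "\<dots> \<le> sup_rate * ((t + s j) ^ (2 * CARD('n) + 2) * vol unit_box)"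
      using K2 s(1)[of j] sup_rate_nonneg by (intro mult_left_mono mult_right_mono power_mono) auto
    finally show ?thesis by (simp add: distrib_left)
  qed
  have "(\<lambda>j. sup_rate * ((t + s j) ^ (2 * CARD('n) + 2) * vol unit_box)) \<longlonglongrightarrow> sup_rate * ((t + 0) ^ (2 * CARD('n) + 2) * vol unit_box)"
    by (intro tendsto_intros s(2))
  then have lim: "(\<lambda>j. sup_rate * ((t + s j) ^ (2 * CARD('n) + 2) * vol unit_box)) \<longlonglongrightarrow> sup_rate * measure lebesgue Q"
    using measure_dil_unit_box[OF t(2), where 'n = 'n] by (simp add: Q_def)
  show ?thesis
  proof (rule order_tendstoI)
    fix a assume "a < sup_rate * measure lebesgue A"
    then show "\<forall>\<^sub>F j in sequentially. a < s j ^ (2 * CARD('n) + 2) * N (dil (1 / s j) ` A)"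
      using scaled_gain_eventually_ge[OF A s, of "sup_rate * measure lebesgue A - a"] by simp
  next
    fix a assume a: "sup_rate * measure lebesgue A < a"
    \<comment> \<open>Half of the slack is spent on the large box and half on the
      complement.\<close>
    define e where "e = (a - sup_rate * measure lebesgue A) / 2"
    have e: "e > 0" using a by (simp add: e_def)
    have "\<forall>\<^sub>F j in sequentially. sup_rate * ((t + s j) ^ (2 * CARD('n) + 2) * vol unit_box) < sup_rate * measure lebesgue Q + e"
      by (rule order_tendstoD(2)[OF lim]) (use e in simp)
    moreover have "\<forall>\<^sub>F j in sequentially. sup_rate * measure lebesgue A' - e < s j ^ (2 * CARD('n) + 2) * N (dil (1 / s j) ` A')"
      by (rule scaled_gain_eventually_ge[OF A' s e])
    ultimately show "\<forall>\<^sub>F j in sequentially. s j ^ (2 * CARD('n) + 2) * N (dil (1 / s j) ` A) < a"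
    proof eventually_elim
      case (elim j)
      have "sup_rate * measure lebesgue Q = sup_rate * measure lebesgue A + sup_rate * measure lebesgue A'"
        by (simp add: vol distrib_left)
      moreover have "2 * e = a - sup_rate * measure lebesgue A" by (simp add: e_def)
      ultimately show ?case using elim upper[of j] by linarith
    qed
  qed
qed

end

text \<open>The translates of the zero set along \<open>\<nu>\<close> are pairwise disjoint.\<close>

lemma negligible_zero_set_translation:
  fixes h :: "'a::euclidean_space \<Rightarrow> real"
  assumes h: "continuous_on UNIV h" and shift: "\<And>x t. h (x + t *\<^sub>R \<nu>) = h x + t" and r: "r > 0"
  shows "negligible (cball z r \<inter> {x. h x = 0})"
proof -
  define G where "G = cball z r \<inter> {x. h x = 0}"
  have cG: "compact G" unfolding G_def using h by (intro compact_Int_closed closed_Collect_eq) auto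
  then have Gm: "G \<in> lmeasurable" by (rule lmeasurable_compact)
  define W where "W = cball z (r + norm \<nu>)"
  have Wm: "W \<in> lmeasurable" unfolding W_def by simp
  define T where "T t = (\<lambda>x. t *\<^sub>R \<nu> + x) ` G" for t
  have Tm: "T t \<in> lmeasurable" "measure lebesgue (T t) = measure lebesgue G" for t
    unfolding T_def using Gm by (auto simp: measure_translation intro: measurable_translation)
  have hT: "h x = t" if "x \<in> T t" for x t
    using that shift by (auto simp: T_def G_def add.commute[of "t *\<^sub>R \<nu>"])
  have TW: "T t \<subseteq> W" if t: "0 \<le> t" "t \<le> 1" for t
  proof
    fix y assume "y \<in> T t"
    then obtain x where x: "x \<in> G" "y = t *\<^sub>R \<nu> + x" by (auto simp: T_def)
    have "dist z y \<le> dist z x + norm (t *\<^sub>R \<nu>)"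
      using norm_triangle_ineq4[of "z - x" "t *\<^sub>R \<nu>"] by (simp add: x(2) dist_norm algebra_simps)
    also have "\<dots> \<le> r + norm \<nu>"
      using x(1) t by (intro add_mono) (auto simp: G_def mult_left_le_one_le)
    finally show "y \<in> W" by (simp add: W_def)
  qed
  \<comment> \<open>Shifts from the unit interval keep any number of copies in one fixed ball, so a
    positive measure would eventually exceed the volume of the ball.\<close>
  have bound: "real n * measure lebesgue G \<le> measure lebesgue W" for n :: nat
  proof -
    have "real n * measure lebesgue G = (\<Sum>i<n. measure lebesgue (T (real i / real n)))" by (simp add: Tm)
    also have "\<dots> = measure lebesgue (\<Union>i<n. T (real i / real n))"
    proof (rule measure_finite_Union[symmetric])
      show "disjoint_family_on (\<lambda>i. T (real i / real n)) {..<n}"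
        unfolding disjoint_family_on_def
      proof (intro ballI impI equals0I)
        fix i j x assume "i \<in> {..<n}" "j \<in> {..<n}" "i \<noteq> j" "x \<in> T (real i / real n) \<inter> T (real j / real n)"
        then show False using hT[of x "real i / real n"] hT[of x "real j / real n"] by simp
      qed
      show "emeasure lebesgue (T (real i / real n)) \<noteq> \<infinity>" for i
        unfolding infinity_ennreal_def by (rule fmeasurableD2[OF Tm(1)])
      show "(\<lambda>i. T (real i / real n)) ` {..<n} \<subseteq> sets lebesgue" using Tm(1) fmeasurableD by blast
    qed simp
    also have "\<dots> \<le> measure lebesgue W"
    proof (rule measure_mono_fmeasurable)
      show "(\<Union>i<n. T (real i / real n)) \<subseteq> W" by (intro UN_least TW) auto
      show "(\<Union>i<n. T (real i / real n)) \<in> sets lebesgue" using Tm(1) fmeasurableD by (intro sets.finite_UN) auto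
    qed (rule Wm)
    finally show ?thesis .
  qed
  have "measure lebesgue G = 0"
  proof (rule ccontr)
    assume "measure lebesgue G \<noteq> 0"
    then have p: "measure lebesgue G > 0" by (simp add: less_le)
    obtain n where "measure lebesgue W < real n * measure lebesgue G" using reals_Archimedean3[OF p] by blast
    then show False using bound[of n] by linarith
  qed
  then show ?thesis using Gm by (simp add: G_def[symmetric] negligible_iff_measure)
qed

text \<open>Near a boundary point \<open>A\<close> is the set where \<open>h\<close> is positive. A
  point where \<open>h\<close> is negative has a neighbourhood missing \<open>A\<close>, so the
  boundary lies in the zero set of \<open>h\<close>; and \<open>h\<close> increases at unit speed
  along \<open>\<nu>\<close>.\<close>

lemma negligible_frontier_lipschitz:
  fixes A :: "'a::euclidean_space set"
  assumes lip: "lipschitz_boundary A" and A: "open A"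
  shows "negligible (frontier A)"
  unfolding locally_negligible_alt[of "frontier A"]
proof
  fix z assume z: "z \<in> frontier A"
  obtain r \<nu> L and \<gamma> :: "'a \<Rightarrow> real" where r: "r > 0" and nu: "norm \<nu> = 1"
    and L: "L-lipschitz_on {y. y \<bullet> \<nu> = 0} \<gamma>"
    and graph: "A \<inter> ball z r = {x \<in> ball z r. \<gamma> (x - (x \<bullet> \<nu>) *\<^sub>R \<nu>) < x \<bullet> \<nu>}"
    using lip z unfolding lipschitz_boundary_def by blast
  define h where "h x = x \<bullet> \<nu> - \<gamma> (x - (x \<bullet> \<nu>) *\<^sub>R \<nu>)" for x
  have nn: "\<nu> \<bullet> \<nu> = 1" using nu by (simp add: dot_square_norm)
  have "continuous_on UNIV (\<lambda>x. \<gamma> (x - (x \<bullet> \<nu>) *\<^sub>R \<nu>))"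
    by (rule continuous_on_compose2[OF lipschitz_on_continuous_on[OF L]])
      (auto intro!: continuous_intros simp: inner_diff_left nn)
  then have hc: "continuous_on UNIV h"
    unfolding h_def[abs_def] by (intro continuous_on_diff continuous_on_inner continuous_on_id continuous_on_const)
  have shift: "h (x + t *\<^sub>R \<nu>) = h x + t" for x t
    by (simp add: h_def inner_add_left nn scaleR_add_left)
  have graph': "x \<in> A \<longleftrightarrow> h x > 0" if "x \<in> ball z r" for x
    using graph that by (auto simp: h_def set_eq_iff)
  have "frontier A \<inter> ball z r \<subseteq> cball z r \<inter> {x. h x = 0}"
  proof
    fix x assume x: "x \<in> frontier A \<inter> ball z r"
    have "\<not> h x > 0"
      using x graph'[of x] A by (auto simp: frontier_def interior_open)
    moreover have "\<not> h x < 0"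
    proof
      assume "h x < 0"
      have "open (ball z r \<inter> {x. h x < 0})" using hc by (intro open_Int open_Collect_less) auto
      moreover have "x \<in> ball z r \<inter> {x. h x < 0}" using x \<open>h x < 0\<close> by simp
      moreover have "x \<in> closure A" using x by (simp add: frontier_def)
      ultimately have "(ball z r \<inter> {x. h x < 0}) \<inter> A \<noteq> {}" using open_Int_closure_eq_empty by blast
      then show False using graph' by force
    qed
    ultimately show "x \<in> cball z r \<inter> {x. h x = 0}" using x by auto
  qed
  then have "negligible (frontier A \<inter> ball z r)"
    by (rule negligible_subset[OF negligible_zero_set_translation[OF hc shift r]])
  moreover have "openin (top_of_set (frontier A)) (frontier A \<inter> ball z r)" by (simp add: openin_open_Int)
  ultimately show "\<exists>U. openin (top_of_set (frontier A)) U \<and> z \<in> U \<and> negligible U"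
    using z r by (intro exI[of _ "frontier A \<inter> ball z r"]) auto
qed

subsection \<open>Convexity and Jensen's inequality\<close>

text \<open>A hyperplane separates the strict epigraph from the point \<open>(p, h p)\<close>. It
  cannot be vertical because \<open>h\<close> is finite in all directions from \<open>p\<close>, and
  dividing by its vertical component gives the slope.\<close>

lemma convex_on_subgradient:
  fixes h :: "'b::euclidean_space \<Rightarrow> real"
  assumes "convex_on UNIV h"
  obtains \<xi> where "\<And>v. h p + \<xi> \<bullet> v \<le> h (p + v)"
proof -
  define S where "S = {(x, y). h x < y}"
  have "convex S"
  proof (rule convexI)
    fix z w :: "'b \<times> real" and u v :: real
    assume zw: "z \<in> S" "w \<in> S" and uv: "0 \<le> u" "0 \<le> v" "u + v = 1"
    obtain a b where z: "z = (a, b)" "h a < b" using zw(1) by (auto simp: S_def)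
    obtain c d where w: "w = (c, d)" "h c < d" using zw(2) by (auto simp: S_def)
    have "h (u *\<^sub>R a + v *\<^sub>R c) \<le> u * h a + v * h c"
      using assms uv unfolding convex_on_def by blast
    also have "\<dots> < u * b + v * d"
    proof (cases "u = 0")
      case True
      then show ?thesis using uv w(2) by simp
    next
      case False
      then have "u * h a < u * b" using uv z(2) by (intro mult_strict_left_mono) auto
      moreover have "v * h c \<le> v * d" using uv w(2) by (intro mult_left_mono) auto
      ultimately show ?thesis by linarith
    qed
    finally show "u *\<^sub>R z + v *\<^sub>R w \<in> S" by (simp add: z(1) w(1) S_def)
  qed
  moreover have "S \<noteq> {}"
  proof -
    have "(p, h p + 1) \<in> S" by (simp add: S_def)
    then show ?thesis by blast
  qed
  moreover have "S \<inter> {(p, h p)} = {}" by (auto simp: S_def)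
  ultimately obtain a b where ab: "a \<noteq> 0" "\<forall>x\<in>S. a \<bullet> x \<le> b" "\<forall>x\<in>{(p, h p)}. b \<le> a \<bullet> x"
    using separating_hyperplane_sets[of S "{(p, h p)}", OF _ convex_singleton _ insert_not_empty] by blast
  obtain u c where a: "a = (u, c)" by (cases a)
  have sep: "u \<bullet> x + c * y \<le> u \<bullet> p + c * h p" if "h x < y" for x y
    using ab(2,3) that by (force simp: S_def a)
  have "c \<le> 0" using sep[of p "h p + 1"] by (simp add: distrib_left)
  moreover have "c \<noteq> 0"
  proof
    assume c: "c = 0"
    have "u \<bullet> (p + u) \<le> u \<bullet> p" using sep[of "p + u" "h (p + u) + 1"] c by simp
    then have "u \<bullet> u \<le> 0" by (simp add: inner_add_right)
    then have "\<not> 0 < u \<bullet> u" by (simp only: not_less)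
    then have "u = 0" using inner_gt_zero_iff[of u] by blast
    then show False using ab(1) a c by (simp add: zero_prod_def)
  qed
  ultimately have c: "c < 0" by simp
  \<comment> \<open>Separation is known on the strict epigraph; points of the graph are limits of
    such points.\<close>
  have lim: "u \<bullet> x + c * h x \<le> u \<bullet> p + c * h p" for x
  proof (rule field_le_epsilon)
    fix e :: real assume "e > 0"
    then have "h x < h x + e / (- c)" using c by (simp add: divide_pos_neg)
    from sep[OF this] have "u \<bullet> x + c * h x - e \<le> u \<bullet> p + c * h p" using c by (simp add: right_diff_distrib)
    then show "u \<bullet> x + c * h x \<le> u \<bullet> p + c * h p + e" by simp
  qed
  define d where "d = - c"
  have d: "d > 0" using c by (simp add: d_def)
  show thesis
  proof (rule that[of "(1 / d) *\<^sub>R u"])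
    fix v
    have "u \<bullet> v \<le> (h (p + v) - h p) * d" using lim[of "p + v"] by (simp add: d_def inner_add_right algebra_simps)
    then have "u \<bullet> v / d \<le> h (p + v) - h p" using d by (simp add: pos_divide_le_eq)
    then show "h p + (1 / d) *\<^sub>R u \<bullet> v \<le> h (p + v)" by simp
  qed
qed

lemma convex_norm_powr:
  assumes "\<alpha> > 1" "C > 0"
  shows "convex_on UNIV (\<lambda>p :: 'b::real_normed_vector. C * norm p powr \<alpha>)"
proof -
  have 1: "convex_on UNIV (\<lambda>t::real. \<bar>t\<bar> powr \<alpha>)"
  proof (rule convex_on_realI[of _ _ "dpow \<alpha>"])
    show "dpow \<alpha> x \<le> dpow \<alpha> y" if "x \<le> y" for x y
      using dpow_strict_mono[OF assms(1), of x y] that by (cases "x = y") auto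
  qed (use abs_powr_has_derivative[OF assms(1)] in auto)
  show ?thesis
  proof (rule convex_onI)
    fix s :: real and p q :: 'b assume s: "0 < s" "s < 1"
    have "norm ((1 - s) *\<^sub>R p + s *\<^sub>R q) \<le> (1 - s) * norm p + s * norm q"
      using norm_triangle_ineq[of "(1 - s) *\<^sub>R p" "s *\<^sub>R q"] s by simp
    then have "norm ((1 - s) *\<^sub>R p + s *\<^sub>R q) powr \<alpha> \<le> \<bar>(1 - s) * norm p + s * norm q\<bar> powr \<alpha>"
      using assms(1) by (intro powr_mono2) auto
    also have "\<dots> \<le> (1 - s) * norm p powr \<alpha> + s * norm q powr \<alpha>"
      using convex_onD[OF 1, of s "norm p" "norm q"] s by simp
    finally show "C * norm ((1 - s) *\<^sub>R p + s *\<^sub>R q) powr \<alpha> \<le> (1 - s) * (C * norm p powr \<alpha>) + s * (C * norm q powr \<alpha>)"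
      using mult_left_mono[of _ _ C] assms(2) by (fastforce simp: algebra_simps)
  qed simp
qed

lemma integral_Xd_test_zero:
  assumes "open B" "\<phi> \<in> test_functions B"
  shows "integrable (lebesgue_on B) (Xd i \<phi>)" "(LINT x|lebesgue_on B. Xd i \<phi> x) = 0"
proof -
  obtain K where K: "compact K" "K \<subseteq> B" "\<And>x. x \<notin> K \<Longrightarrow> \<phi> x = 0" using test_function_support[OF assms(2)] by blast
  have C1: "C_k (Suc 0) \<phi>" by (rule test_function_C1[OF assms(2)])
  have z: "x \<notin> K \<Longrightarrow> Xd i \<phi> x = 0" for x by (rule Xd_zero_outside[OF K(3) compact_imp_closed[OF K(1)]])
  show "integrable (lebesgue_on B) (Xd i \<phi>)"
    by (rule integral_on_compact_support(1)[OF continuous_Xd[OF C1] K(1) z K(2) assms(1)])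
  show "(LINT x|lebesgue_on B. Xd i \<phi> x) = 0"
    using integral_on_compact_support(2)[OF continuous_Xd[OF C1] K(1) z K(2) assms(1)] integral_Xd_zero[OF C1 K(1,3)]
    by simp
qed

text \<open>Jensen's inequality: a subgradient at \<open>p\<close> bounds the integrand below by
  \<open>h p\<close> plus a linear term in the gradient of the test function, and that term
  integrates to zero. The zero test function gives the other inequality.\<close>

lemma inf_energy_homogeneous:
  assumes h: "integrand (\<lambda>x. h) C1 C2 \<alpha>" and B: "open B" "bounded B"
  shows "inf_energy (\<lambda>x. h) p B = measure lebesgue B * h p"
proof (rule antisym)
  interpret integrand "\<lambda>x. h" C1 C2 \<alpha> by fact
  interpret finite_measure "lebesgue_on B" by (rule finite_measure_lebesgue_on[OF B])
  have mB: "measure (lebesgue_on B) (space (lebesgue_on B)) = measure lebesgue B"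
    using B(1) by (simp add: measure_restrict_space)
  have "inf_energy (\<lambda>x. h) p B \<le> energy (\<lambda>x. h) B (\<lambda>x. p + Xg (\<lambda>x. 0) x)"
    by (rule inf_energy_le[OF test_functions_zero])
  also have "\<dots> = measure lebesgue B * h p"
    using mB by (simp add: energy_def Xg_def Xd_const flip: zero_vec_def)
  finally show "inf_energy (\<lambda>x. h) p B \<le> measure lebesgue B * h p" .
  obtain \<xi> where xi: "\<And>v. h p + \<xi> \<bullet> v \<le> h (p + v)" using convex_on_subgradient[OF convex, of p] by blast
  show "measure lebesgue B * h p \<le> inf_energy (\<lambda>x. h) p B"
    unfolding inf_energy_def
  proof (rule cINF_greatest)
    show "test_functions B \<noteq> {}" using test_functions_zero by blast
    fix \<phi> assume phi: "\<phi> \<in> test_functions B"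
    note X = integral_Xd_test_zero[OF B(1) phi]
    have in_sum: "\<xi> \<bullet> Xg \<phi> x = (\<Sum>i\<in>UNIV. \<xi> $ i * Xd i \<phi> x)" for x by (simp add: inner_vec_def Xg_def)
    have "measure lebesgue B * h p = (LINT x|lebesgue_on B. h p + \<xi> \<bullet> Xg \<phi> x)"
      using X mB by (simp add: in_sum)
    also have "\<dots> \<le> (LINT x|lebesgue_on B. h (p + Xg \<phi> x))"
      using X by (intro integral_mono integrable_compose[OF B LpV_test[OF params(3) B phi]] xi) (simp add: in_sum)
    finally show "measure lebesgue B * h p \<le> energy (\<lambda>x. h) B (\<lambda>x. p + Xg \<phi> x)" by (simp add: energy_def)
  qed
qed

context integrand
begin

text \<open>Comparison with the homogeneous integrand from the lower growth bound, whose infimal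
  energy is explicit.\<close>

lemma inf_energy_lower:
  assumes B: "open B" "bounded B"
  shows "C1 * norm p powr \<alpha> * measure lebesgue B \<le> inf_energy g p B"
proof -
  define h where "h = (\<lambda>p :: 'n hor. C1 * norm p powr \<alpha>)"
  have I: "integrand (\<lambda>x. h) C1 C2 \<alpha>"
  proof
    \<comment> \<open>The power inherits the upper growth bound because \<open>g\<close>, at any
      point, lies between the two.\<close>
    show "h p \<le> C2 * (norm p powr \<alpha> + 1)" for p
      using lower[of p undefined] upper[of undefined p] by (simp add: h_def)
  qed (use params convex_norm_powr in \<open>auto simp: h_def\<close>)
  interpret h: integrand "\<lambda>x. h" C1 C2 \<alpha> by (rule I)
  have "measure lebesgue B * h p = inf_energy (\<lambda>x. h) p B" by (rule inf_energy_homogeneous[OF I B, symmetric])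
  also have "\<dots> \<le> inf_energy g p B"
    unfolding inf_energy_def[of g]
  proof (rule cINF_greatest)
    show "test_functions B \<noteq> {}" using test_functions_zero by blast
    fix \<phi> assume phi: "\<phi> \<in> test_functions B"
    note L = LpV_test[OF params(3) B phi]
    have "inf_energy (\<lambda>x. h) p B \<le> energy (\<lambda>x. h) B (\<lambda>x. p + Xg \<phi> x)" by (rule h.inf_energy_le[OF phi])
    also have "\<dots> \<le> energy g B (\<lambda>x. p + Xg \<phi> x)"
      unfolding energy_def using lower
      by (intro integral_mono h.integrable_compose[OF B L] integrable_compose[OF B L]) (simp add: h_def)
    finally show "inf_energy (\<lambda>x. h) p B \<le> energy g B (\<lambda>x. p + Xg \<phi> x)" .
  qed
  finally show ?thesis by (simp add: h_def ac_simps)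
qed

text \<open>The energy is jointly convex in the slope and the perturbation, and minimizing over one
  of two variables preserves joint convexity.\<close>

lemma convex_inf_energy:
  assumes B: "open B" "bounded B"
  shows "convex_on UNIV (\<lambda>p. inf_energy g p B)"
proof (rule convex_onI)
  fix s :: real and p q assume s: "0 < s" "s < 1"
  show "inf_energy g ((1 - s) *\<^sub>R p + s *\<^sub>R q) B \<le> (1 - s) * inf_energy g p B + s * inf_energy g q B"
  proof (rule field_le_epsilon)
    fix e :: real assume e: "e > 0"
    obtain \<phi> where phi: "\<phi> \<in> test_functions B" "energy g B (\<lambda>x. p + Xg \<phi> x) < inf_energy g p B + e"
      using inf_energy_approx[OF e] by blast
    obtain \<psi> where psi: "\<psi> \<in> test_functions B" "energy g B (\<lambda>x. q + Xg \<psi> x) < inf_energy g q B + e"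
      using inf_energy_approx[OF e] by blast
    define \<theta> where "\<theta> = (\<lambda>x. (1 - s) * \<phi> x + s * \<psi> x)"
    have th: "\<theta> \<in> test_functions B"
      unfolding \<theta>_def by (intro test_functions_add test_functions_cmult phi psi)
    have C1: "C_k (Suc 0) \<phi>" "C_k (Suc 0) \<psi>" by (rule test_function_C1[OF phi(1)], rule test_function_C1[OF psi(1)])
    have X: "Xg \<theta> x = (1 - s) *\<^sub>R Xg \<phi> x + s *\<^sub>R Xg \<psi> x" for x
      unfolding \<theta>_def by (simp only: Xg_add[OF C_k_cmult[OF C1(1)] C_k_cmult[OF C1(2)]] Xg_cmult[OF C1(1)] Xg_cmult[OF C1(2)])
    have i: "integrable (lebesgue_on B) (\<lambda>x. g x (r + Xg \<phi> x))" if "\<phi> \<in> test_functions B" for \<phi> r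
      by (rule integrable_compose[OF B LpV_test[OF params(3) B that]])
    have "inf_energy g ((1 - s) *\<^sub>R p + s *\<^sub>R q) B \<le> energy g B (\<lambda>x. ((1 - s) *\<^sub>R p + s *\<^sub>R q) + Xg \<theta> x)"
      by (rule inf_energy_le[OF th])
    also have "\<dots> \<le> (LINT x|lebesgue_on B. (1 - s) * g x (p + Xg \<phi> x) + s * g x (q + Xg \<psi> x))"
      unfolding energy_def
    proof (rule integral_mono)
      show "integrable (lebesgue_on B) (\<lambda>x. g x (((1 - s) *\<^sub>R p + s *\<^sub>R q) + Xg \<theta> x))" by (rule i[OF th])
      show "integrable (lebesgue_on B) (\<lambda>x. (1 - s) * g x (p + Xg \<phi> x) + s * g x (q + Xg \<psi> x))"
        by (intro Bochner_Integration.integrable_add integrable_mult_right i phi psi)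
      fix x
      have "((1 - s) *\<^sub>R p + s *\<^sub>R q) + Xg \<theta> x = (1 - s) *\<^sub>R (p + Xg \<phi> x) + s *\<^sub>R (q + Xg \<psi> x)"
        by (simp add: X scaleR_add_right)
      then show "g x (((1 - s) *\<^sub>R p + s *\<^sub>R q) + Xg \<theta> x) \<le> (1 - s) * g x (p + Xg \<phi> x) + s * g x (q + Xg \<psi> x)"
        using convex_onD[OF convex, of s "p + Xg \<phi> x" "q + Xg \<psi> x" x] s by simp
    qed
    also have "\<dots> = (1 - s) * energy g B (\<lambda>x. p + Xg \<phi> x) + s * energy g B (\<lambda>x. q + Xg \<psi> x)"
      using i[OF phi(1)] i[OF psi(1)] by (simp add: energy_def)
    also have "\<dots> \<le> (1 - s) * (inf_energy g p B + e) + s * (inf_energy g q B + e)"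
      using phi(2) psi(2) s by (intro add_mono mult_left_mono) auto
    also have "\<dots> = (1 - s) * inf_energy g p B + s * inf_energy g q B + e" by (simp add: algebra_simps)
    finally show "inf_energy g ((1 - s) *\<^sub>R p + s *\<^sub>R q) B \<le> (1 - s) * inf_energy g p B + s * inf_energy g q B + e" .
  qed
qed simp

lemma int_functional_admissible:
  assumes B: "open B" "bounded B" and u0: "\<And>x. u0 x = p \<bullet> hproj x + c" and u: "u \<in> admissible \<alpha> u0 B"
  shows "int_functional \<alpha> g u B = ereal (energy g B (hgrad B u))"
  using admissible_affine(2)[OF params(3) B u0 u] by (simp add: int_functional_def energy_def)

text \<open>Since the infimum is attained, \<open>LEAST\<close> returns it. From here on the Sobolev
  minima are replaced by \<open>inf_energy\<close>, which depends on the boundary data only through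
  the slope.\<close>

lemma int_functional_minimum:
  assumes B: "open B" "bounded B" and u0: "\<And>x. u0 x = p \<bullet> hproj x + c"
  shows "\<exists>u. is_arg_min (\<lambda>u. int_functional \<alpha> g u B) (\<lambda>u. u \<in> admissible \<alpha> u0 B) u"
    and "min_value \<alpha> (int_functional \<alpha> g) u0 B = ereal (inf_energy g p B)"
proof -
  obtain u where u: "u \<in> admissible \<alpha> u0 B" "energy g B (hgrad B u) = inf_energy g p B"
    by (rule minimizer_exists[OF B u0])
  have ge: "ereal (inf_energy g p B) \<le> int_functional \<alpha> g w B" if "w \<in> admissible \<alpha> u0 B" for w
    using inf_energy_le_admissible[OF B u0 that] int_functional_admissible[OF B u0 that] by simp
  have eq: "int_functional \<alpha> g u B = ereal (inf_energy g p B)"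
    using int_functional_admissible[OF B u0 u(1)] u(2) by simp
  show "\<exists>u. is_arg_min (\<lambda>u. int_functional \<alpha> g u B) (\<lambda>u. u \<in> admissible \<alpha> u0 B) u"
    unfolding is_arg_min_def using u(1) ge eq by (intro exI[of _ u]) (auto simp: not_less)
  show "min_value \<alpha> (int_functional \<alpha> g) u0 B = ereal (inf_energy g p B)"
    unfolding min_value_def
  proof (rule Least_equality)
    show "ereal (inf_energy g p B) \<in> (\<lambda>u. int_functional \<alpha> g u B) ` admissible \<alpha> u0 B"
      using u(1) eq by (intro image_eqI[of _ _ u]) simp_all
  qed (use ge in auto)
qed

end

subsection \<open>The homogenized integrand\<close>

lemma linear_dil: "linear (dil t)"
  by (rule linearI) (auto simp: dil_def scaleR_add_right algebra_simps)

lemma interior_Q_unit: "interior Q_unit = (unit_box :: 'n::finite heis set)"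
proof
  show "interior Q_unit \<subseteq> (unit_box :: 'n heis set)"
    using interior_mono[OF unit_box_Q_unit(2)] by (simp add: unit_box_def)
  show "unit_box \<subseteq> interior (Q_unit :: 'n heis set)"
    by (rule interior_maximal[OF unit_box_Q_unit(1) open_unit_box])
qed

lemma inj_dil:
  assumes "t > 0" shows "inj (dil t)"
proof (rule inj_on_inverseI[of _ "dil (1 / t)"])
  show "dil (1 / t) (dil t x) = x" for x :: "'n::finite heis" using assms by (simp add: dil_dil)
qed

lemma interior_Q_cube:
  assumes "k \<ge> 1" shows "interior (Q_cube k) = dil (real k) ` unit_box"
  unfolding Q_cube_def interior_Q_unit[symmetric]
  using assms by (intro interior_injective_linear_image linear_dil inj_dil) simp

lemma Q_cube_measure:
  fixes k :: nat
  assumes "k \<ge> 1"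
  shows "(Q_cube k :: 'n::finite heis set) \<in> sets lebesgue"
    and "measure lebesgue (Q_cube k :: 'n heis set) = measure lebesgue (dil (real k) ` unit_box :: 'n heis set)"
    and "Q_cube k - dil (real k) ` (unit_box :: 'n heis set) \<in> null_sets lebesgue"
proof -
  have k: "real k > 0" using assms by simp
  show "(Q_cube k :: 'n heis set) \<in> sets lebesgue"
    unfolding Q_cube_def dil_htrans by (rule lebesgue_htrans[OF k Q_unit_lebesgue])
  show "measure lebesgue (Q_cube k :: 'n heis set) = measure lebesgue (dil (real k) ` unit_box :: 'n heis set)"
    unfolding Q_cube_def dil_htrans measure_htrans[OF k Q_unit_lebesgue]
    by (subst measure_htrans[OF k]) (simp_all add: open_unit_box measure_Q_unit)
  have "negligible (dil (real k) ` (Q_unit - (unit_box :: 'n heis set)))"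
  proof -
    have "Q_unit - (unit_box :: 'n heis set) \<in> sets lebesgue"
      using negligible_Q_unit negligible_imp_sets by blast
    moreover have "measure lebesgue (Q_unit - (unit_box :: 'n heis set)) = 0"
      using negligible_Q_unit negligible_imp_measure0 by blast
    ultimately have "measure lebesgue (dil (real k) ` (Q_unit - (unit_box :: 'n heis set))) = 0"
      unfolding dil_htrans by (simp add: measure_htrans[OF k])
    moreover have "dil (real k) ` (Q_unit - (unit_box :: 'n heis set)) \<in> lmeasurable"
    proof (rule bounded_set_imp_lmeasurable)
      show "bounded (dil (real k) ` (Q_unit - (unit_box :: 'n heis set)))"
        by (rule bounded_dil[OF bounded_subset[OF bounded_cbox order_trans[OF Diff_subset unit_box_Q_unit(2)]]])
      show "dil (real k) ` (Q_unit - (unit_box :: 'n heis set)) \<in> sets lebesgue"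
        unfolding dil_htrans by (rule lebesgue_htrans[OF k]) fact
    qed
    ultimately show ?thesis using negligible_iff_measure by blast
  qed
  moreover have "dil (real k) ` (Q_unit - unit_box) = Q_cube k - dil (real k) ` (unit_box :: 'n heis set)"
    unfolding Q_cube_def by (rule image_set_diff[OF inj_dil[OF k]])
  ultimately show "Q_cube k - dil (real k) ` (unit_box :: 'n heis set) \<in> null_sets lebesgue"
    using negligible_iff_null_sets by auto
qed

text \<open>The half-open cell exceeds its interior by a null set. On that set the representative of
  the gradient carries no information, and measurability across it comes from completeness.\<close>

lemma cell_energy_eq:
  assumes "integrand g C1 C2 \<alpha>" and k: "k \<ge> 1" and u: "u \<in> admissible \<alpha> (lin p) (interior (Q_cube k))"
  shows "cell_energy g (Q_cube k) u = energy g (interior (Q_cube k)) (hgrad (interior (Q_cube k)) u)"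
proof -
  interpret integrand g C1 C2 \<alpha> by fact
  let ?B = "interior (Q_cube k)" and ?G = "hgrad (interior (Q_cube k)) u"
  have B: "open ?B" "bounded ?B"
    unfolding interior_Q_cube[OF k] using k by (auto intro!: open_dil open_unit_box bounded_dil bounded_unit_box)
  have "LpV \<alpha> ?B ?G"
    by (rule admissible_affine(3)[OF params(3) B _ u, of p 0]) (simp add: lin_def)
  then have "(\<lambda>x. g x (?G x)) \<in> borel_measurable (lebesgue_on ?B)" by (intro meas_compose) (simp add: LpV_def)
  then have m: "(\<lambda>x. indicator ?B x *\<^sub>R g x (?G x)) \<in> borel_measurable lebesgue"
    using B(1) by (subst (asm) borel_measurable_restrict_space_iff) auto
  have "AE x in lebesgue. x \<notin> Q_cube k - ?B"
    using AE_not_in[OF Q_cube_measure(3)[OF k]] by (simp add: interior_Q_cube[OF k])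
  then have ae: "AE x in lebesgue. indicator ?B x *\<^sub>R g x (?G x) = indicator (Q_cube k) x *\<^sub>R g x (?G x)"
    using interior_subset[of "Q_cube k"] by (auto elim!: eventually_mono simp: indicator_def)
  have m': "(\<lambda>x. indicator (Q_cube k) x *\<^sub>R g x (?G x)) \<in> borel_measurable lebesgue"
    by (rule borel_measurable_AE[OF m ae])
  have "cell_energy g (Q_cube k) u = (LINT x|lebesgue. indicator (Q_cube k) x *\<^sub>R g x (?G x))"
    unfolding cell_energy_def using Q_cube_measure(1)[OF k] by (subst integral_restrict_space) auto
  also have "\<dots> = (LINT x|lebesgue. indicator ?B x *\<^sub>R g x (?G x))"
    using ae by (intro integral_cong_AE m m') (auto elim!: eventually_mono)
  also have "\<dots> = energy g ?B ?G"
    unfolding energy_def using B(1) by (subst integral_restrict_space) auto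
  finally show ?thesis .
qed

section \<open>Cell problems of a periodic integrand\<close>

locale periodic_integrand = integrand +
  assumes periodic: "\<And>x p k. k \<in> integer_points \<Longrightarrow> g (heis_mult (2 *\<^sub>R k) x) p = g x p"
begin

lemma gain_periodic:
  assumes B: "open B" "bounded B" and k: "k \<in> integer_points"
  shows "gain p (htrans (2 *\<^sub>R k) 1 ` B) = gain p B"
proof -
  have "(\<lambda>x. g (htrans (2 *\<^sub>R k) 1 x)) = g" using periodic[OF k] by (simp add: htrans_def fun_eq_iff)
  then have "inf_energy g p (htrans (2 *\<^sub>R k) 1 ` B) = inf_energy g p B"
    using inf_energy_htrans[OF integrand_axioms zero_less_one B, of p "2 *\<^sub>R k"] by simp
  moreover have "measure lebesgue (htrans (2 *\<^sub>R k) 1 ` B) = measure lebesgue B"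
    using measure_htrans[OF zero_less_one, of B "2 *\<^sub>R k"] B(1) by simp
  ultimately show ?thesis by (simp add: gain_def)
qed

lemma superadditive_gain_gain: "superadditive_gain (gain p) (growth_const p)"
  by (rule superadditive_gain.intro)
    (rule gain_nonneg gain_le gain_superadditive gain_periodic; assumption)+

end

sublocale periodic_integrand \<subseteq> gain: superadditive_gain "gain p" "growth_const p" for p
  by (rule superadditive_gain_gain)

context periodic_integrand
begin

text \<open>The trivial energy density less the largest gain density of a cell;
  \<open>f_hom_eq\<close> identifies it with the limit of the cell means.\<close>

definition "homogenized p = growth_const p - gain.sup_rate p"

lemma cell_minimum:
  assumes k: "k \<ge> 1"
  shows "\<exists>u. is_arg_min (cell_energy g (Q_cube k)) (\<lambda>u. u \<in> admissible \<alpha> (lin p) (interior (Q_cube k))) u"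
    and "mu \<alpha> g p (Q_cube k) = inf_energy g p (dil (real k) ` unit_box)"
proof -
  let ?B = "interior (Q_cube k)"
  have B: "open ?B" "bounded ?B"
    unfolding interior_Q_cube[OF k] using k by (auto intro!: open_dil open_unit_box bounded_dil bounded_unit_box)
  have lp: "lin p x = p \<bullet> hproj x + 0" for x by (simp add: lin_def)
  obtain u where u: "u \<in> admissible \<alpha> (lin p) ?B" "energy g ?B (hgrad ?B u) = inf_energy g p ?B"
    by (rule minimizer_exists[OF B lp])
  have ge: "inf_energy g p ?B \<le> cell_energy g (Q_cube k) w" if "w \<in> admissible \<alpha> (lin p) ?B" for w
    using inf_energy_le_admissible[OF B lp that] cell_energy_eq[OF integrand_axioms k that] by simp
  have eq: "cell_energy g (Q_cube k) u = inf_energy g p ?B"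
    using cell_energy_eq[OF integrand_axioms k u(1)] u(2) by simp
  show "\<exists>u. is_arg_min (cell_energy g (Q_cube k)) (\<lambda>u. u \<in> admissible \<alpha> (lin p) ?B) u"
    unfolding is_arg_min_def using u(1) ge eq by (intro exI[of _ u]) (auto simp: not_less)
  show "mu \<alpha> g p (Q_cube k) = inf_energy g p (dil (real k) ` unit_box)"
    unfolding mu_def interior_Q_cube[OF k, symmetric]
  proof (rule Least_equality)
    show "inf_energy g p ?B \<in> cell_energy g (Q_cube k) ` admissible \<alpha> (lin p) ?B"
      using u(1) eq by (intro image_eqI[of _ _ u]) simp_all
  qed (use ge in auto)
qed

text \<open>The dictionary between cell means and rates of gain: convergence to an infimum on one
  side is convergence to a supremum on the other.\<close>

lemma cell_mean_eq:
  assumes k: "k \<ge> 1"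
  shows "cell_mean \<alpha> g p k = growth_const p - gain.rate p k"
proof -
  have "real k > 0" using k by simp
  then have "measure lebesgue (dil (real k) ` unit_box :: 'a heis set) > 0"
    using measure_unit_box_pos[where 'n = 'a] by (simp add: measure_dil_unit_box)
  then show ?thesis
    by (simp add: cell_mean_def cell_minimum(2)[OF k] Q_cube_measure(2)[OF k] gain.rate_def gain_def field_simps)
qed

lemma cell_mean_tendsto: "cell_mean \<alpha> g p \<longlonglongrightarrow> homogenized p"
proof -
  have "(\<lambda>k. growth_const p - gain.rate p k) \<longlonglongrightarrow> homogenized p"
    unfolding homogenized_def by (intro tendsto_diff tendsto_const gain.rate_tendsto)
  moreover have "\<forall>\<^sub>F k in sequentially. growth_const p - gain.rate p k = cell_mean \<alpha> g p k"
    using cell_mean_eq by (intro eventually_sequentiallyI[of 1]) simp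
  ultimately show ?thesis by (rule Lim_transform_eventually)
qed

lemma f_hom_eq: "f_hom \<alpha> g = homogenized"
  by (simp add: fun_eq_iff f_hom_def limI[OF cell_mean_tendsto])

lemma homogenized_eq_INF: "homogenized p = (INF k\<in>{1..}. cell_mean \<alpha> g p k)"
proof (rule antisym)
  show "homogenized p \<le> (INF k\<in>{1..}. cell_mean \<alpha> g p k)"
    by (rule cINF_greatest) (use gain.rate_le_sup in \<open>auto simp: cell_mean_eq homogenized_def\<close>)
  have bdd: "bdd_below (cell_mean \<alpha> g p ` {1..})"
    using gain.rate_bounds(2) by (intro bdd_belowI2[of _ 0]) (auto simp: cell_mean_eq)
  show "(INF k\<in>{1..}. cell_mean \<alpha> g p k) \<le> homogenized p"
    by (rule LIMSEQ_le_const[OF cell_mean_tendsto]) (use cINF_lower[OF bdd] in auto)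
qed

lemma homogenized_bounds: "C1 * norm p powr \<alpha> \<le> homogenized p" "homogenized p \<le> C2 * (norm p powr \<alpha> + 1)"
proof -
  show "C1 * norm p powr \<alpha> \<le> homogenized p"
  proof (rule LIMSEQ_le_const[OF cell_mean_tendsto], intro exI[of _ 1] allI impI)
    fix k :: nat assume k: "1 \<le> k"
    then have kp: "real k > 0" by simp
    have "C1 * norm p powr \<alpha> * measure lebesgue (dil (real k) ` unit_box :: 'a heis set) \<le> inf_energy g p (dil (real k) ` unit_box)"
      by (rule inf_energy_lower[OF open_dil[OF kp open_unit_box] bounded_dil[OF bounded_unit_box]])
    moreover have "measure lebesgue (dil (real k) ` unit_box :: 'a heis set) > 0"
      using kp measure_unit_box_pos[where 'n = 'a] by (simp add: measure_dil_unit_box)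
    ultimately show "C1 * norm p powr \<alpha> \<le> cell_mean \<alpha> g p k"
      by (simp add: cell_mean_def cell_minimum(2)[OF k] Q_cube_measure(2)[OF k] le_divide_eq)
  qed
  show "homogenized p \<le> C2 * (norm p powr \<alpha> + 1)"
    using gain.sup_rate_nonneg[of p] by (simp add: homogenized_def growth_const_def)
qed

lemma convex_homogenized: "convex_on UNIV homogenized"
proof (rule convex_onI)
  fix s :: real and p q assume s: "0 < s" "s < 1"
  show "homogenized ((1 - s) *\<^sub>R p + s *\<^sub>R q) \<le> (1 - s) * homogenized p + s * homogenized q"
  proof (rule LIMSEQ_le)
    show "cell_mean \<alpha> g ((1 - s) *\<^sub>R p + s *\<^sub>R q) \<longlonglongrightarrow> homogenized ((1 - s) *\<^sub>R p + s *\<^sub>R q)"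
      by (rule cell_mean_tendsto)
    show "(\<lambda>k. (1 - s) * cell_mean \<alpha> g p k + s * cell_mean \<alpha> g q k) \<longlonglongrightarrow> (1 - s) * homogenized p + s * homogenized q"
      by (intro tendsto_add tendsto_mult tendsto_const cell_mean_tendsto)
    show "\<exists>N. \<forall>k\<ge>N. cell_mean \<alpha> g ((1 - s) *\<^sub>R p + s *\<^sub>R q) k \<le> (1 - s) * cell_mean \<alpha> g p k + s * cell_mean \<alpha> g q k"
    proof (intro exI[of _ 1] allI impI)
      fix k :: nat assume k: "1 \<le> k"
      then have kp: "real k > 0" by simp
      let ?B = "dil (real k) ` unit_box :: 'a heis set"
      have "inf_energy g ((1 - s) *\<^sub>R p + s *\<^sub>R q) ?B \<le> (1 - s) * inf_energy g p ?B + s * inf_energy g q ?B"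
        using convex_onD[OF convex_inf_energy[OF open_dil[OF kp open_unit_box] bounded_dil[OF bounded_unit_box]], of s p q] s
        by simp
      then have "inf_energy g ((1 - s) *\<^sub>R p + s *\<^sub>R q) ?B / measure lebesgue ?B \<le>
          ((1 - s) * inf_energy g p ?B + s * inf_energy g q ?B) / measure lebesgue ?B"
        by (rule divide_right_mono) simp
      then show "cell_mean \<alpha> g ((1 - s) *\<^sub>R p + s *\<^sub>R q) k \<le> (1 - s) * cell_mean \<alpha> g p k + s * cell_mean \<alpha> g q k"
        by (simp add: cell_mean_def cell_minimum(2)[OF k] Q_cube_measure(2)[OF k] add_divide_distrib)
    qed
  qed
qed simp

lemma integrand_homogenized: "integrand (\<lambda>x. homogenized) C1 C2 \<alpha>"
  by unfold_locales (use convex_homogenized params homogenized_bounds in auto)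

lemma integrand_scaled: "\<epsilon> > 0 \<Longrightarrow> integrand (\<lambda>x. g (dil (1 / \<epsilon>) x)) C1 C2 \<alpha>"
  unfolding dil_htrans by (rule integrand_htrans[OF integrand_axioms]) simp

text \<open>The rescaled integrand on \<open>A\<close> is the pullback of \<open>g\<close> on the
  dilated set. There volume and energy carry the same factor, which the power of
  \<open>\<epsilon>\<close> cancels.\<close>

lemma inf_energy_scaled:
  fixes A :: "'a heis set"
  assumes A: "open A" "bounded A" and e: "\<epsilon> > 0"
  shows "inf_energy (\<lambda>x. g (dil (1 / \<epsilon>) x)) p A =
    growth_const p * measure lebesgue A - \<epsilon> ^ (2 * CARD('a) + 2) * gain p (dil (1 / \<epsilon>) ` A)"
proof -
  let ?c = "(1 / \<epsilon>) ^ (2 * CARD('a) + 2)"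
  have t: "1 / \<epsilon> > 0" using e by simp
  have E: "inf_energy g p (dil (1 / \<epsilon>) ` A) = ?c * inf_energy (\<lambda>x. g (dil (1 / \<epsilon>) x)) p A"
    unfolding dil_htrans by (rule inf_energy_htrans[OF integrand_axioms t A])
  have M: "measure lebesgue (dil (1 / \<epsilon>) ` A) = ?c * measure lebesgue A"
    unfolding dil_htrans using A(1) by (intro measure_htrans[OF t]) simp
  have c: "\<epsilon> ^ (2 * CARD('a) + 2) * ?c = 1" using e by (simp flip: power_mult_distrib)
  have "\<epsilon> ^ (2 * CARD('a) + 2) * gain p (dil (1 / \<epsilon>) ` A) =
      (\<epsilon> ^ (2 * CARD('a) + 2) * ?c) * (growth_const p * measure lebesgue A - inf_energy (\<lambda>x. g (dil (1 / \<epsilon>) x)) p A)"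
    unfolding gain_def E M by (simp only: right_diff_distrib ac_simps)
  then show ?thesis unfolding c by simp
qed

text \<open>Tested along sequences of scales, to which \<open>gain.scaled_gain_tendsto\<close>
  applies; subtracting the limit of the gain from the trivial bound leaves
  \<open>homogenized p\<close> per volume.\<close>

theorem inf_energy_tendsto:
  assumes A: "open A" "bounded A" and fr: "negligible (frontier A)"
  shows "((\<lambda>\<epsilon>. inf_energy (\<lambda>x. g (dil (1 / \<epsilon>) x)) p A) \<longlongrightarrow> measure lebesgue A * homogenized p) (at_right 0)"
proof (rule tendsto_at_right_sequentially[of 0 1])
  fix s :: "nat \<Rightarrow> real" assume s: "\<And>j. 0 < s j" "s \<longlonglongrightarrow> 0"
  have "(\<lambda>j. growth_const p * measure lebesgue A - s j ^ (2 * CARD('a) + 2) * gain p (dil (1 / s j) ` A)) \<longlonglongrightarrow>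
      growth_const p * measure lebesgue A - gain.sup_rate p * measure lebesgue A"
    by (intro tendsto_diff tendsto_const gain.scaled_gain_tendsto A fr s)
  then show "(\<lambda>j. inf_energy (\<lambda>x. g (dil (1 / s j) x)) p A) \<longlonglongrightarrow> measure lebesgue A * homogenized p"
    by (simp add: inf_energy_scaled[OF A s(1)] homogenized_def algebra_simps)
qed simp

end

theorem theorem5p2:
  fixes f :: "'n::finite heis \<Rightarrow> 'n hor \<Rightarrow> real"
    and A :: "'n heis set" and u0 :: "'n heis \<Rightarrow> real"
    and q :: "'n hor" and a C1 C2 \<alpha> :: real
  assumes f_measurable: "\<And>p. (\<lambda>x. f x p) \<in> borel_measurable lebesgue"
    and f_convex: "\<And>x. convex_on UNIV (f x)"
    and params: "C1 > 0" "C2 > 0" "\<alpha> > 1"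
    and f_growth: "\<And>x p. C1 * norm p powr \<alpha> \<le> f x p \<and> f x p \<le> C2 * (norm p powr \<alpha> + 1)"
    and f_periodic: "\<And>x p k. k \<in> integer_points \<Longrightarrow> f (heis_mult (2 *\<^sub>R k) x) p = f x p"
    and A_domain: "open A" "connected A" "A \<noteq> {}" "bounded A"
    and A_lipschitz: "lipschitz_boundary A"
    and u0: "\<And>x. u0 x = q \<bullet> hproj x + a"
  shows
    \<comment> \<open>the minima in the definitions of \<open>mu\<close> and \<open>min_value\<close> are attained\<close>
    "(\<forall>p. \<forall>k\<ge>1. \<exists>u. is_arg_min (cell_energy f (Q_cube k))
        (\<lambda>u. u \<in> admissible \<alpha> (lin p) (interior (Q_cube k))) u)
     \<and> (\<forall>\<epsilon>>0. \<exists>u. is_arg_min (\<lambda>u. F_eps \<alpha> f \<epsilon> u A) (\<lambda>u. u \<in> admissible \<alpha> u0 A) u)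
     \<and> (\<exists>u. is_arg_min (\<lambda>u. F_inf \<alpha> f u A) (\<lambda>u. u \<in> admissible \<alpha> u0 A) u)
     \<and> (\<forall>p. cell_mean \<alpha> f p \<longlonglongrightarrow> f_hom \<alpha> f p
          \<and> f_hom \<alpha> f p = (INF k\<in>{1..}. cell_mean \<alpha> f p k))
     \<and> ((\<lambda>\<epsilon>. min_value \<alpha> (F_eps \<alpha> f \<epsilon>) u0 A) \<longlongrightarrow> min_value \<alpha> (F_inf \<alpha> f) u0 A) (at_right 0)
     \<and> f_hom \<alpha> f \<in> borel_measurable lebesgue
     \<and> convex_on UNIV (f_hom \<alpha> f)
     \<and> (\<forall>p. C1 * norm p powr \<alpha> \<le> f_hom \<alpha> f p \<and> f_hom \<alpha> f p \<le> C2 * (norm p powr \<alpha> + 1))"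
proof (intro conjI allI impI)
  interpret f: periodic_integrand f C1 C2 \<alpha>
    by unfold_locales (use f_measurable f_convex params f_growth f_periodic in auto)
  interpret h: integrand "\<lambda>x. f_hom \<alpha> f" C1 C2 \<alpha>
    unfolding f.f_hom_eq by (rule f.integrand_homogenized)
  note A = A_domain(1,4)
  have scaled: "integrand (\<lambda>x. f (dil (1 / \<epsilon>) x)) C1 C2 \<alpha>" if "\<epsilon> > 0" for \<epsilon>
    by (rule f.integrand_scaled[OF that])
  show "\<exists>u. is_arg_min (cell_energy f (Q_cube k)) (\<lambda>u. u \<in> admissible \<alpha> (lin p) (interior (Q_cube k))) u"
    if "1 \<le> k" for p k
    by (rule f.cell_minimum(1)[OF that])
  show "\<exists>u. is_arg_min (\<lambda>u. F_eps \<alpha> f \<epsilon> u A) (\<lambda>u. u \<in> admissible \<alpha> u0 A) u" if "0 < \<epsilon>" for \<epsilon>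
    unfolding F_eps_def by (rule integrand.int_functional_minimum(1)[OF scaled[OF that] A u0])
  show "\<exists>u. is_arg_min (\<lambda>u. F_inf \<alpha> f u A) (\<lambda>u. u \<in> admissible \<alpha> u0 A) u"
    unfolding F_inf_def by (rule h.int_functional_minimum(1)[OF A u0])
  show "cell_mean \<alpha> f p \<longlonglongrightarrow> f_hom \<alpha> f p" for p unfolding f.f_hom_eq by (rule f.cell_mean_tendsto)
  show "f_hom \<alpha> f p = (INF k\<in>{1..}. cell_mean \<alpha> f p k)" for p unfolding f.f_hom_eq by (rule f.homogenized_eq_INF)
  have Feps: "min_value \<alpha> (F_eps \<alpha> f \<epsilon>) u0 A = ereal (inf_energy (\<lambda>x. f (dil (1 / \<epsilon>) x)) q A)" if "\<epsilon> > 0" for \<epsilon>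
    unfolding F_eps_def by (rule integrand.int_functional_minimum(2)[OF scaled[OF that] A u0])
  have Finf: "min_value \<alpha> (F_inf \<alpha> f) u0 A = ereal (measure lebesgue A * f_hom \<alpha> f q)"
    unfolding F_inf_def h.int_functional_minimum(2)[OF A u0] inf_energy_homogeneous[OF h.integrand_axioms A] ..
  \<comment> \<open>Here the Lipschitz condition enters, by making the frontier of \<open>A\<close>
    a null set.\<close>
  have "((\<lambda>\<epsilon>. ereal (inf_energy (\<lambda>x. f (dil (1 / \<epsilon>) x)) q A)) \<longlongrightarrow> ereal (measure lebesgue A * f_hom \<alpha> f q)) (at_right 0)"
    unfolding f.f_hom_eq
    by (intro tendsto_ereal f.inf_energy_tendsto[OF A negligible_frontier_lipschitz[OF A_lipschitz A(1)]])
  moreover have "\<forall>\<^sub>F \<epsilon> in at_right 0. ereal (inf_energy (\<lambda>x. f (dil (1 / \<epsilon>) x)) q A) = min_value \<alpha> (F_eps \<alpha> f \<epsilon>) u0 A"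
    using eventually_at_right_less[of "0::real"] by eventually_elim (simp add: Feps)
  ultimately show "((\<lambda>\<epsilon>. min_value \<alpha> (F_eps \<alpha> f \<epsilon>) u0 A) \<longlongrightarrow> min_value \<alpha> (F_inf \<alpha> f) u0 A) (at_right 0)"
    unfolding Finf by (rule Lim_transform_eventually)
  \<comment> \<open>A finite convex function on a finite-dimensional space is continuous.\<close>
  show "f_hom \<alpha> f \<in> borel_measurable lebesgue"
    using convex_on_continuous[OF open_UNIV h.convex]
    by (simp add: borel_measurable_continuous_onI measurable_completion)
  show "convex_on UNIV (f_hom \<alpha> f)" by (rule h.convex)
  show "C1 * norm p powr \<alpha> \<le> f_hom \<alpha> f p" "f_hom \<alpha> f p \<le> C2 * (norm p powr \<alpha> + 1)" for p
    by (rule h.lower, rule h.upper)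
qed

end
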